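(* Let $\Omega$, $\mathcal O$, $g$, $\Omega_n$, $\mathcal O_n$, $\mathbf g_n$, $\delta_n$, $\eta$, $h$ be as in the context. Let $\varepsilon>0$, and let the kernel assumption, the domain assumption, the data assumption and the scaling assumption (for the parameters $\delta_n>0$, $h>0$, $\varepsilon>0$) stated in the context hold. Let $\mathbf u_n:\Omega_n\to\mathbb R$ solve the graph infinity Laplacian equation with labels $\mathbf g_n$ on $\mathcal O_n$, let $u:\overline\Omega\to\mathbb R$ be an absolutely minimizing Lipschitz extension of $g$, and let $u_n=\mathbf u_n\circ\pi_n:\overline\Omega\to\mathbb R$ be the piecewise constant extension of $\mathbf u_n$. 1. It holds $$\sup_{\Omega_n}|u-\mathbf u_n|=\sup_{\overline\Omega}|u-u_n|\lesssim\varepsilon+\sqrt[3]{\frac{\delta_n}{h\varepsilon}+\frac{h}{\varepsilon^2}+\frac{\phi(h)}{h\varepsilon}}.$$ 2. If $\inf_{\overline\Omega}|\nabla u|>0$, then it even holds $$\sup_{\Omega_n}|u-\mathbf u_n|=\sup_{\overline\Omega}|u-u_n|\lesssim\varepsilon+\frac{\delta_n}{h\varepsilon}+\frac{h}{\varepsilon^2}+\frac{\phi(h)}{h\varepsilon}.$$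
   Context: Notation: $a\vee b=\max\{a,b\}$, $|\cdot|$ is the Euclidean norm, and $a\lesssim b$ means $a\le C\,b$ for a universal constant $C>0$, possibly depending on the kernel $\eta$ or the label function $g$. Domain. $\Omega\subset\mathbb R^d$ is an open bounded domain, and $d_\Omega(x,y)=\inf\{\int_0^1|\dot\xi(t)|\,dt:\ \xi\in C^1([0,1];\overline\Omega),\ \xi(0)=x,\ \xi(1)=y\}$ for $x,y\in\overline\Omega$. Relatively open, connected, and relative boundary $\partial^{\mathrm{rel}}$ refer to the metric space $(\overline\Omega,d_\Omega)$. Domain assumption: there exist $\phi:[0,\infty)\to[0,\infty)$ with $\lim_{h\downarrow0}\phi(h)/h=0$ and $r_\Omega>0$ such that $d_\Omega(x,y)\le|x-y|+\phi(|x-y|)$ for all $x,y\in\Omega$ with $|x-y|\le r_\Omega$. For $h>0$ set $\sigma_\phi(h)=\sup_{0<s\le h}\phi(s)/s$. Labels and point clouds. $\mathcal O\subset\overline\Omega$ is closed, $\Omega_{\mathcal O}=\overline\Omega\setminus\mathcal O$, and $g:\mathcal O\to\mathbb R$ is the labelling function. For $n\in\mathbb N$, $\Omega_n\subset\overline\Omega$ is a (finite) point cloud, $\mathcal O_n\subset\Omega_n$ is the set of labelled vertices, and $\mathbf g_n:\mathcal O_n\to\mathbb R$. With the Hausdorff distance $d_H(A,B)=\sup_{x\in A}\inf_{y\in B}|x-y|\vee\sup_{x\in B}\inf_{y\in A}|x-y|$, the graph resolution is $\delta_n=d_H(\Omega_n,\overline\Omega)\vee d_H(\mathcal O_n,\mathcal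 O)$. Closest point projections: $\pi_n(x)\in\operatorname{argmin}_{\mathbf x\in\Omega_n}|x-\mathbf x|$ for $x\in\overline\Omega$, and $\pi_{\mathcal O_n}(z)\in\operatorname{argmin}_{\mathbf z\in\mathcal O_n}|z-\mathbf z|$ for $z\in\mathcal O$. Kernel assumption: $\eta:(0,\infty)\to[0,\infty)$ is nonincreasing with $\operatorname{supp}\eta\subset[0,1]$, $\sigma_\eta:=\sup_{t>0}t\eta(t)\in(0,\infty)$, and there exists $t_0\in(0,1]$ (chosen as the largest number with this property) with $\sigma_\eta=t_0\eta(t_0)$. For the graph length scale $h>0$ set $\eta_h(t)=\frac1{\sigma_\eta h}\eta(t/h)$, with the convention $\eta(0)\cdot0:=0$. Graph. Weights on $\Omega_n$: $\mathbf w_n(\mathbf x,\mathbf y)=\eta_h(|\mathbf x-\mathbf y|)$ for $\mathbf x\ne\mathbf y$ and $0$ for $\mathbf x=\mathbf y$. Graph distance: $\mathbf d_n(\mathbf x,\mathbf x)=0$ and, for $\mathbf x\ne\mathbf y$, $\mathbf d_n(\mathbf x,\mathbf y)=\min\{\sum_{i=1}^N\mathbf w_n(\mathbf x_{i-1},\mathbf x_i)^{-1}\}$ over all $N\in\mathbb N$ and sequences $(\mathbf x_i)_{i=0}^N$ in $\Omega_n$ with $\mathbf x_0=\mathbf x$, $\mathbf x_N=\mathbf y$ (with $0^{-1}=\infty$). For $A\subset\Omega_n$, $\operatorname{Lip}_n(\mathbf v;A)=\max_{\mathbf x\neq\mathbf y\in A}|\mathbf v(\mathbf x)-\mathbf v(\mathbf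 y)|/\mathbf d_n(\mathbf x,\mathbf y)$. Graph infinity Laplacian equation: $\min_{\mathbf y\in\Omega_n}\eta_h(|\mathbf x-\mathbf y|)(\mathbf u_n(\mathbf y)-\mathbf u_n(\mathbf x))+\max_{\mathbf y\in\Omega_n}\eta_h(|\mathbf x-\mathbf y|)(\mathbf u_n(\mathbf y)-\mathbf u_n(\mathbf x))=0$ for $\mathbf x\in\Omega_n\setminus\mathcal O_n$, and $\mathbf u_n=\mathbf g_n$ on $\mathcal O_n$. Absolutely minimizing Lipschitz extension. For $A\subset\overline\Omega$, $\operatorname{Lip}_\Omega(u;A)=\sup_{x\ne y\in A}|u(x)-u(y)|/d_\Omega(x,y)$. A function $u\in C(\overline\Omega)$ is an absolutely minimizing Lipschitz extension of $g$ if $u=g$ on $\mathcal O$ and $\operatorname{Lip}_\Omega(u;\overline V)=\operatorname{Lip}_\Omega(u;\partial^{\mathrm{rel}}V)$ for all relatively open and connected subsets $V\subset\Omega_{\mathcal O}$. Data assumption: $\sup_{n\in\mathbb N}\operatorname{Lip}_n(\mathbf g_n;\mathcal O_n)<\infty$, $\operatorname{Lip}_\Omega(g;\mathcal O)<\infty$, and there exists a constant $C>0$ such that $|\mathbf g_n(\pi_{\mathcal O_n}(z))-g(z)|\le C\delta_n$ for all $z\in\mathcal O$. Scaling assumption on $(\delta_n,h,\varepsilon)$: $h\le r_\Omega$, $\ \frac h\varepsilon<\frac12$, and $\sigma_\phi(h)+\frac{\delta_n}h\le\frac{t_0}{4+2\sigma_\phi(h)}\left(1-2\frac h\varepsilo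n\right)$.
   Formalization: The equality of the suprema over Ω_n and over the closure of Ω is false as printed; it is replaced by: the first is at most the second, which is at most the first plus Cδ_n. Both rates are proved for the supremum over the closure, hence for both. O and O_n are taken nonempty. *)

theory Defs
  imports "HOL-Analysis.Analysis"
begin

section \<open>The geodesic metric space\<close>

text \<open>The distances are \<^typ>\<open>ennreal\<close>-valued, so an infimum over no curves (or no paths) is
  \<open>\<infinity>\<close>. \<open>\<xi>'\<close> is the derivative of \<open>\<xi>\<close>, one-sided at the end points.\<close>

definition C1_curves :: "'a::euclidean_space set \<Rightarrow> 'a \<Rightarrow> 'a \<Rightarrow> ((real \<Rightarrow> 'a) \<times> (real \<Rightarrow> 'a)) set" where
  "C1_curves S x y = {(\<xi>, \<xi>').
     (\<forall>t\<in>{0..1}. (\<xi> has_vector_derivative \<xi>' t) (at t within {0..1})) \<and>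
     continuous_on {0..1} \<xi>' \<and> \<xi> ` {0..1} \<subseteq> S \<and> \<xi> 0 = x \<and> \<xi> 1 = y}"

definition geo_dist :: "'a::euclidean_space set \<Rightarrow> 'a \<Rightarrow> 'a \<Rightarrow> ennreal" where
  "geo_dist \<Omega> x y =
     (INF (\<xi>, \<xi>') \<in> C1_curves (closure \<Omega>) x y. ennreal (integral {0..1} (\<lambda>t. norm (\<xi>' t))))"

text \<open>The topology of the metric space \<open>(closure \<Omega>, geo_dist \<Omega>)\<close>. The conversion to a real-valued metric
  is harmless for a domain satisfying \<open>domain_assumption\<close> below, where \<open>geo_dist \<Omega>\<close> is finite on
  \<open>closure \<Omega>\<close>.\<close>

definition geo_topology :: "'a::euclidean_space set \<Rightarrow> 'a topology" where
  "geo_topology \<Omega> = Metric_space.mtopology (closure \<Omega>) (\<lambda>x y. enn2real (geo_dist \<Omega> x y))"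

definition domain_assumption :: "'a::euclidean_space set \<Rightarrow> (real \<Rightarrow> real) \<Rightarrow> real \<Rightarrow> bool" where
  "domain_assumption \<Omega> \<phi> r \<longleftrightarrow>
     (\<forall>s\<ge>0. \<phi> s \<ge> 0) \<and> ((\<lambda>s. \<phi> s / s) \<longlongrightarrow> 0) (at_right 0) \<and> r > 0 \<and>
     (\<forall>x\<in>\<Omega>. \<forall>y\<in>\<Omega>. norm (x - y) \<le> r \<longrightarrow>
        geo_dist \<Omega> x y \<le> ennreal (norm (x - y) + \<phi> (norm (x - y))))"

definition sigma_phi :: "(real \<Rightarrow> real) \<Rightarrow> real \<Rightarrow> real" where
  "sigma_phi \<phi> h = (SUP s\<in>{0<..h}. \<phi> s / s)"

section \<open>Lipschitz constants and absolute minimizers\<close>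

text \<open>The supremum over no pairs is \<open>0\<close>, and pairs at infinite distance contribute \<open>0\<close>.\<close>

definition Lip_const :: "('a \<Rightarrow> 'a \<Rightarrow> ennreal) \<Rightarrow> ('a \<Rightarrow> real) \<Rightarrow> 'a set \<Rightarrow> ennreal" where
  "Lip_const d v A = (SUP (x, y) \<in> {(x, y). x \<in> A \<and> y \<in> A \<and> x \<noteq> y}. ennreal \<bar>v x - v y\<bar> / d x y)"

definition AMLE :: "'a::euclidean_space set \<Rightarrow> 'a set \<Rightarrow> ('a \<Rightarrow> real) \<Rightarrow> ('a \<Rightarrow> real) \<Rightarrow> bool" where
  "AMLE \<Omega> \<O> g u \<longleftrightarrow>
     continuous_on (closure \<Omega>) u \<and> (\<forall>z\<in>\<O>. u z = g z) \<and>
     (\<forall>V. openin (geo_topology \<Omega>) V \<and> connectedin (geo_topology \<Omega>) V \<and> V \<subseteq> closure \<Omega> - \<O> \<longrightarrow>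
        Lip_const (geo_dist \<Omega>) u (geo_topology \<Omega> closure_of V) =
        Lip_const (geo_dist \<Omega>) u (geo_topology \<Omega> frontier_of V))"

text \<open>The infimum of the gradient norm of \<open>u\<close> over the points of \<open>S\<close> at which \<open>u\<close>, as a function on
  \<open>S\<close>, is differentiable. A Lipschitz \<open>u\<close> need not be differentiable everywhere; for example an
  absolute minimizer usually is not at an isolated label.\<close>

definition inf_grad :: "'a::euclidean_space set \<Rightarrow> ('a \<Rightarrow> real) \<Rightarrow> ennreal" where
  "inf_grad S u =
     (INF (x, D) \<in> {(x, D). x \<in> S \<and> (u has_derivative (\<lambda>v. D \<bullet> v)) (at x within S)}. ennreal (norm D))"

section \<open>Kernels and graphs\<close>

definition kernel_sup :: "(real \<Rightarrow> real) \<Rightarrow> real" where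
  "kernel_sup \<eta> = (SUP t\<in>{0<..}. t * \<eta> t)"

definition kernel_assumption :: "(real \<Rightarrow> real) \<Rightarrow> real \<Rightarrow> bool" where
  "kernel_assumption \<eta> t0 \<longleftrightarrow>
     (\<forall>t>0. \<eta> t \<ge> 0) \<and> antimono_on {0<..} \<eta> \<and> closure {t. t > 0 \<and> \<eta> t \<noteq> 0} \<subseteq> {0..1} \<and>
     bdd_above ((\<lambda>t. t * \<eta> t) ` {0<..}) \<and> kernel_sup \<eta> > 0 \<and>
     t0 \<in> {0<..1} \<and> kernel_sup \<eta> = t0 * \<eta> t0 \<and>
     (\<forall>t\<in>{0<..1}. kernel_sup \<eta> = t * \<eta> t \<longrightarrow> t \<le> t0)"

definition scaled_kernel :: "(real \<Rightarrow> real) \<Rightarrow> real \<Rightarrow> real \<Rightarrow> real" where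
  "scaled_kernel \<eta> h t = 1 / (kernel_sup \<eta> * h) * \<eta> (t / h)"

definition graph_weight :: "(real \<Rightarrow> real) \<Rightarrow> real \<Rightarrow> 'a::euclidean_space \<Rightarrow> 'a \<Rightarrow> real" where
  "graph_weight \<eta> h x y = (if x = y then 0 else scaled_kernel \<eta> h (norm (x - y)))"

text \<open>\<open>X\<close> is the vertex set. In \<^typ>\<open>ennreal\<close>, \<open>inverse 0 = \<infinity>\<close>.\<close>

definition graph_dist :: "(real \<Rightarrow> real) \<Rightarrow> real \<Rightarrow> 'a::euclidean_space set \<Rightarrow> 'a \<Rightarrow> 'a \<Rightarrow> ennreal" where
  "graph_dist \<eta> h X x y =
     (if x = y then 0
      else (INF (N, p) \<in> {(N::nat, p). N \<ge> 1 \<and> p ` {0..N} \<subseteq> X \<and> p 0 = x \<and> p N = y}.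
              \<Sum>i=1..N. inverse (ennreal (graph_weight \<eta> h (p (i - 1)) (p i)))))"

text \<open>The term \<open>y = x\<close> is \<open>0\<close> whatever the value of \<open>\<eta> 0\<close>.\<close>

definition graph_inf_laplacian ::
  "(real \<Rightarrow> real) \<Rightarrow> real \<Rightarrow> 'a::euclidean_space set \<Rightarrow> ('a \<Rightarrow> real) \<Rightarrow> 'a \<Rightarrow> real" where
  "graph_inf_laplacian \<eta> h X v x =
     Min ((\<lambda>y. scaled_kernel \<eta> h (norm (x - y)) * (v y - v x)) ` X) +
     Max ((\<lambda>y. scaled_kernel \<eta> h (norm (x - y)) * (v y - v x)) ` X)"

definition solves_graph_equation ::
  "(real \<Rightarrow> real) \<Rightarrow> real \<Rightarrow> 'a::euclidean_space set \<Rightarrow> 'a set \<Rightarrow> ('a \<Rightarrow> real) \<Rightarrow> ('a \<Rightarrow> real) \<Rightarrow> bool" where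
  "solves_graph_equation \<eta> h X Y f v \<longleftrightarrow>
     (\<forall>x\<in>X - Y. graph_inf_laplacian \<eta> h X v x = 0) \<and> (\<forall>x\<in>Y. v x = f x)"

section \<open>Point clouds\<close>

text \<open>Only used for nonempty bounded sets.\<close>

definition hausdorff_dist :: "'a::metric_space set \<Rightarrow> 'a set \<Rightarrow> real" where
  "hausdorff_dist A B = max (SUP x\<in>A. infdist x B) (SUP x\<in>B. infdist x A)"

definition resolution :: "'a::euclidean_space set \<Rightarrow> 'a set \<Rightarrow> 'a set \<Rightarrow> 'a set \<Rightarrow> real" where
  "resolution \<Omega> \<O> X Y = max (hausdorff_dist X (closure \<Omega>)) (hausdorff_dist Y \<O>)"

definition closest_point_projection :: "'a::euclidean_space set \<Rightarrow> 'a set \<Rightarrow> ('a \<Rightarrow> 'a) \<Rightarrow> bool" where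
  "closest_point_projection S X p \<longleftrightarrow> (\<forall>x\<in>S. is_arg_min (\<lambda>y. norm (x - y)) (\<lambda>y. y \<in> X) (p x))"

definition point_clouds :: "'a::euclidean_space set \<Rightarrow> (nat \<Rightarrow> 'a set) \<Rightarrow> (nat \<Rightarrow> 'a set) \<Rightarrow> bool" where
  "point_clouds \<Omega> X Y \<longleftrightarrow> (\<forall>n. finite (X n) \<and> X n \<subseteq> closure \<Omega> \<and> Y n \<subseteq> X n \<and> Y n \<noteq> {})"

text \<open>The part of the data assumption on the discrete labels \<open>f n\<close>: \<open>L\<close> bounds the graph Lipschitz
  constants, \<open>K\<close> is the constant in the consistency estimate and \<open>p n\<close> is the closest point
  projection onto the labelled vertices \<open>Y n\<close>.\<close>

definition data_assumption ::
  "'a::euclidean_space set \<Rightarrow> 'a set \<Rightarrow> ('a \<Rightarrow> real) \<Rightarrow> (real \<Rightarrow> real) \<Rightarrow> real \<Rightarrow> real \<Rightarrow>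
   (nat \<Rightarrow> real) \<Rightarrow> (nat \<Rightarrow> 'a set) \<Rightarrow> (nat \<Rightarrow> 'a set) \<Rightarrow> (nat \<Rightarrow> 'a \<Rightarrow> 'a) \<Rightarrow> (nat \<Rightarrow> 'a \<Rightarrow> real) \<Rightarrow> bool" where
  "data_assumption \<Omega> \<O> g \<eta> L K h X Y p f \<longleftrightarrow>
     (SUP n. Lip_const (graph_dist \<eta> (h n) (X n)) (f n) (Y n)) \<le> ennreal L \<and>
     (\<forall>n. \<forall>z\<in>\<O>. \<bar>f n (p n z) - g z\<bar> \<le> K * resolution \<Omega> \<O> (X n) (Y n))"

text \<open>The boundedness clause says that \<open>\<sigma>\<^sub>\<phi>(h)\<close> is finite, without which the last inequality
  would be meaningless.\<close>

definition scaling_assumption ::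
  "(real \<Rightarrow> real) \<Rightarrow> real \<Rightarrow> real \<Rightarrow> real \<Rightarrow> real \<Rightarrow> real \<Rightarrow> bool" where
  "scaling_assumption \<phi> r t0 \<delta> h \<epsilon> \<longleftrightarrow>
     h \<le> r \<and> h / \<epsilon> < 1 / 2 \<and> bdd_above ((\<lambda>s. \<phi> s / s) ` {0<..h}) \<and>
     sigma_phi \<phi> h + \<delta> / h \<le> t0 / (4 + 2 * sigma_phi \<phi> h) * (1 - 2 * (h / \<epsilon>))"

end

theory Submission
  imports Defs
begin

text \<open>Both \<open>u\<close> and \<open>un\<close> obey comparison with cones, each in its own metric: \<open>u\<close> in the geodesic
  distance \<open>d\<close> of the domain (\<open>cone_comparison\<close>), \<open>un\<close> in the graph distance, where a vertex has an
  ascending edge exactly as steep as its steepest descending one, so that steepest ascent never loses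
  slope until it meets a label (\<open>ascent_step\<close>). The link between the two is the nonlocal operator
  \<open>max + min - 2 w(x)\<close>, with maximum and minimum of \<open>w\<close> over the \<open>d\<close>-ball of radius \<open>\<epsilon>\<close> around \<open>x\<close>.
  By comparison with cones, the slope of \<open>u\<close> from \<open>x\<close> to its maximum over the ball of radius \<open>r\<close> does not
  decrease in \<open>r\<close> (\<open>slope_bound\<close>); hence the function of maxima of \<open>u\<close> over \<open>\<epsilon>\<close>-balls is a subsolution (\<open>ball_max_subsolution\<close>). In the same way the
  function of minima of \<open>un\<close> over \<open>\<epsilon>\<close>-balls is a supersolution up to an error \<open>e\<close>
  (\<open>discrete_subsolution\<close>, for \<open>- un\<close>). The error comes from
  converting graph distances to geodesic ones: a relative error of order \<open>\<delta> / h\<close> in one direction, one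
  of order \<open>\<phi> h / h\<close> in the other, and an absolute error of order \<open>h\<close>, so that \<open>e\<close> is of
  order \<open>\<epsilon>\<^sup>2 * rate\<close>. Near the labels the two functions differ by \<open>O(\<epsilon>)\<close>.

  A maximum principle finishes the proof once the subsolution is strict. If its slope over \<open>\<epsilon>\<close>-balls is
  at least \<open>\<alpha> \<epsilon>\<close>, composing it with a slightly convex function of size \<open>\<tau>\<close> produces strictness of order
  \<open>\<tau> \<alpha>\<^sup>2 \<epsilon>\<^sup>2\<close>, which beats \<open>e\<close> for \<open>\<tau>\<close> of order \<open>rate / \<alpha>\<^sup>2\<close> (\<open>comparison_strict\<close>). When the gradient of
  \<open>u\<close> is bounded below, \<open>\<alpha>\<close> is a constant and the error is \<open>O(\<epsilon> + rate)\<close>. Otherwise the subsolution is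
  first replaced, where it is flatter than \<open>\<alpha>\<close>, by one of slope \<open>\<alpha>\<close>, at a price of order \<open>\<alpha>\<close>
  (\<open>patching\<close>), and \<open>\<alpha> + rate / \<alpha>\<^sup>2\<close> is balanced by the cube root of the rate. The same argument with
  \<open>e\<close> tending to \<open>0\<close> shows that absolute minimizers are unique (\<open>absmin_unique\<close>), so a lower bound for
  the gradient depends on \<open>\<Omega>\<close>, \<open>\<O>\<close> and \<open>g\<close> only. The reverse inequality between \<open>u\<close> and \<open>un\<close>
  follows by changing signs.

  Two points need extra care. The rate contains \<open>\<phi>\<close> at the single scale \<open>h\<close>, while graph paths use edges of
  all lengths up to \<open>h\<close>. Only pairs at distance exactly \<open>h\<close> are controlled by \<open>\<phi> h\<close>, but a near geodesic of
  length between \<open>h\<close> and \<open>2 h\<close> is covered by overlapping windows that span exactly \<open>h\<close>, each nearly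
  straight, and hence is nearly straight itself (\<open>two_windows\<close>); a polygon is then measured after cutting it
  into pieces that span more than \<open>h\<close> (\<open>polygon_length\<close>). Second, the gradient bound must give
  a bound for slopes everywhere. Where the slope of \<open>u\<close> is below \<open>\<alpha>\<close>, \<open>u\<close> has a local Lipschitz constant
  below \<open>\<alpha>\<close>; a paraboloid touches its graph from above nearby, and at such a touching point an absolute
  minimizer is differentiable (\<open>touching_differentiable\<close>).\<close>

section \<open>A maximum principle for a nonlocal operator\<close>

text \<open>The maximum principle for the operator \<open>max + min - 2 w(x)\<close> over the neighbours of \<open>x\<close> under \<open>R\<close>. At a point
  that nearly maximizes \<open>F(W) - V\<close>, the operator applied to \<open>F(W)\<close> is at most its value at \<open>V\<close>, that is
  \<open>e\<close>. Since \<open>F\<close> has second derivative \<open>\<tau>\<close> and first derivative at least \<open>1\<close>, an increment \<open>s\<close> of \<open>W\<close> raises it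
  to \<open>\<tau> s\<^sup>2 / 2\<close>, which exceeds \<open>e\<close> for \<open>\<tau> = 4 e / s\<^sup>2\<close>.\<close>

lemma comparison_strict:
  fixes W V :: "'b \<Rightarrow> real" and R :: "'b \<Rightarrow> 'b \<Rightarrow> bool"
  assumes W: "\<And>x. x \<in> X \<Longrightarrow> \<bar>W x\<bar> \<le> M" and V: "\<And>x. x \<in> X \<Longrightarrow> \<bar>V x\<bar> \<le> M"
    and sub: "\<And>x \<theta>. x \<in> I \<Longrightarrow> \<theta> > 0 \<Longrightarrow> \<exists>y\<in>X. R x y \<and> W y \<ge> W x + s - \<theta> \<and>
                (\<forall>z\<in>X. R x z \<longrightarrow> W y + W z \<ge> 2 * W x - \<theta>)"
    and super: "\<And>x. x \<in> I \<Longrightarrow> \<exists>z\<in>X. R x z \<and> (\<forall>y\<in>X. R x y \<longrightarrow> V y + V z \<le> 2 * V x + e)"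
    and bdry: "\<And>x. x \<in> X - I \<Longrightarrow> W x - V x \<le> B"
    and s: "s > 0" and e: "e > 0" and x: "x \<in> X"
  shows "W x - V x \<le> B + 8 * e * M\<^sup>2 / s\<^sup>2"
proof -
  define \<tau> where "\<tau> = 4 * e / s\<^sup>2"
  have \<tau>: "\<tau> > 0" using e s by (simp add: \<tau>_def)
  have \<tau>s: "\<tau> * s\<^sup>2 = 4 * e" using s by (simp add: \<tau>_def)
  define F where "F t = t + \<tau> / 2 * (t + M)\<^sup>2" for t :: real
  have M0: "M \<ge> 0" using W[OF x] by linarith
  have FF: "W z \<le> F (W z)" for z using \<tau> by (simp add: F_def)
  have Fu: "F (W z) \<le> W z + 2 * \<tau> * M\<^sup>2" if "z \<in> X" for z
  proof -
    have "(W z + M)\<^sup>2 \<le> (2*M)\<^sup>2" using W[OF that] by (intro power_mono) auto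
    then have "\<tau> / 2 * (W z + M)\<^sup>2 \<le> \<tau> / 2 * (2*M)\<^sup>2" using \<tau> by (intro mult_left_mono) auto
    then show ?thesis unfolding F_def by (simp add: power2_eq_square mult.assoc mult.left_commute)
  qed
  define m where "m = (SUP z\<in>X. F (W z) - V z)"
  have bdd: "bdd_above ((\<lambda>z. F (W z) - V z) ` X)"
    by (rule bdd_aboveI2[where M="M + 2 * \<tau> * M\<^sup>2 + M"]) (use Fu W V in fastforce)
  have mge: "F (W z) - V z \<le> m" if "z \<in> X" for z
    unfolding m_def by (rule cSUP_upper[OF that bdd])
  have "m \<le> B + 2 * \<tau> * M\<^sup>2"
  proof (rule ccontr)
    assume neg: "\<not> ?thesis"
    define D where "D = 1 + 2 * \<tau> * M"
    have D: "D \<ge> 1" using \<tau> M0 by (simp add: D_def)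
    have key: "e \<le> \<theta> * (2 + D + \<tau> * s)" if th: "0 < \<theta>" "\<theta> < s" "\<theta> < m - (B + 2 * \<tau> * M\<^sup>2)" for \<theta>
    proof -
      have "\<exists>z\<in>X. m - \<theta> < F (W z) - V z"
        using less_cSUP_iff[of X "\<lambda>z. F (W z) - V z" "m - \<theta>"] x bdd th(1) by (auto simp: m_def)
      then obtain z where z: "z \<in> X" "m - \<theta> < F (W z) - V z" by blast
      have zI: "z \<in> I"
      proof (rule ccontr)
        assume "z \<notin> I"
        then have "W z - V z \<le> B" using z bdry by blast
        then show False using z Fu[OF z(1)] th(3) by linarith
      qed
      obtain y where y: "y \<in> X" "R z y" "W y \<ge> W z + s - \<theta>"
        and y2: "\<And>q. q \<in> X \<Longrightarrow> R z q \<Longrightarrow> W y + W q \<ge> 2 * W z - \<theta>"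
        using sub[OF zI th(1)] by blast
      obtain q where q: "q \<in> X" "R z q" and q2: "\<And>y. y \<in> X \<Longrightarrow> R z y \<Longrightarrow> V y + V q \<le> 2 * V z + e"
        using super[OF zI] by blast
      have i1: "V y + V q \<le> 2 * V z + e" using q2 y by blast
      have i2: "W y + W q \<ge> 2 * W z - \<theta>" using y2 q by blast
      have "F (W y) - V y \<le> m" "F (W q) - V q \<le> m" using mge y q by auto
      then have up: "F (W y) + F (W q) - 2 * F (W z) \<le> e + 2 * \<theta>" using i1 z by linarith
      define F' where "F' = 1 + \<tau> * (W z + M)"
      have F': "0 \<le> F'" "F' \<le> D" using W[OF z(1)] \<tau> by (auto simp: F'_def D_def intro!: add_nonneg_nonneg mult_nonneg_nonneg)
      have "F (W y) + F (W q) - 2 * F (W z)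
          = F' * (W y + W q - 2 * W z) + \<tau> / 2 * ((W y - W z)\<^sup>2 + (W q - W z)\<^sup>2)"
        unfolding F_def F'_def by (simp add: power2_eq_square algebra_simps add_divide_distrib diff_divide_distrib)
      moreover have "F' * (W y + W q - 2 * W z) \<ge> F' * (- \<theta>)" using F' i2 by (intro mult_left_mono) auto
      moreover have "F' * (- \<theta>) \<ge> - (D * \<theta>)" using F' th by (simp add: mult_right_mono)
      moreover have "\<tau> / 2 * ((W y - W z)\<^sup>2 + (W q - W z)\<^sup>2) \<ge> \<tau> / 2 * (s - \<theta>)\<^sup>2"
      proof -
        have "(s - \<theta>)\<^sup>2 \<le> (W y - W z)\<^sup>2" using y th by (intro power_mono) auto
        then show ?thesis using \<tau> by (intro mult_left_mono) (auto simp: add_increasing2)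
      qed
      moreover have "\<tau> / 2 * (s - \<theta>)\<^sup>2 \<ge> 2 * e - \<tau> * s * \<theta>"
      proof -
        have "\<tau> / 2 * (s - \<theta>)\<^sup>2 = \<tau> * s\<^sup>2 / 2 - \<tau> * s * \<theta> + \<tau> / 2 * \<theta>\<^sup>2"
          by (simp add: power2_eq_square algebra_simps)
        then show ?thesis using \<tau>s \<tau> by simp
      qed
      ultimately have "2 * e - \<tau> * s * \<theta> - D * \<theta> \<le> e + 2 * \<theta>" using up by linarith
      then show ?thesis by (simp add: algebra_simps)
    qed
    define K where "K = 2 + D + \<tau> * s"
    have K: "K > 0" using D \<tau> s by (simp add: K_def add_pos_pos)
    define g where "g = m - (B + 2 * \<tau> * M\<^sup>2)"
    have g: "g > 0" using neg by (simp add: g_def)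
    define \<theta> where "\<theta> = min (min (s/2) (g/2)) (e / (2*K))"
    have th: "0 < \<theta>" "\<theta> < s" "\<theta> < g" "\<theta> \<le> e / (2*K)" using s e K g by (auto simp: \<theta>_def min_def)
    have "e \<le> \<theta> * K" using key[of \<theta>] th by (simp add: K_def g_def)
    also have "\<dots> \<le> e / (2*K) * K" using th K by (intro mult_right_mono) auto
    also have "\<dots> = e / 2" using K by simp
    finally show False using e by simp
  qed
  then have "W x - V x \<le> B + 2 * \<tau> * M\<^sup>2" using mge[OF x] FF[of x] by linarith
  then show ?thesis by (simp add: \<tau>_def)
qed

text \<open>On the flat set \<open>G\<close> the patched function is the supremum of \<open>U(y) - k s\<close> over chains of \<open>k\<close> steps through \<open>G\<close> that end in
  a point \<open>y\<close> outside \<open>G\<close>; it solves the discrete eikonal equation with slope \<open>s\<close> on \<open>G\<close> and has the values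
  of \<open>U\<close> elsewhere. The predicate collects the competing values.\<close>

inductive patch_value :: "('b \<Rightarrow> 'b \<Rightarrow> bool) \<Rightarrow> 'b set \<Rightarrow> 'b set \<Rightarrow> ('b \<Rightarrow> real) \<Rightarrow> real \<Rightarrow> 'b \<Rightarrow> real \<Rightarrow> bool"
  for R X G U s where
    stop: "x \<in> X - G \<Longrightarrow> patch_value R X G U s x (U x)"
  | step: "x \<in> X \<inter> G \<Longrightarrow> R x y \<Longrightarrow> patch_value R X G U s y c \<Longrightarrow> patch_value R X G U s x (c - s)"

lemma patch_value_in: "patch_value R X G U s x c \<Longrightarrow> x \<in> X"
  by (induction rule: patch_value.induct) auto

text \<open>The set \<open>G\<close> consists of the points with slope below \<open>s\<close>. Inside \<open>G\<close> the patch ascends by \<open>s\<close> along a chain and never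
  descends faster. Outside \<open>G\<close> nothing is lost, because the slope of a subsolution does not decrease
  along an ascent: the neighbour where \<open>U\<close> is maximal has slope at least \<open>s\<close> again, so it lies outside \<open>G\<close> and
  the patch keeps its value there. On \<open>G\<close> the function \<open>U\<close> moves by at most \<open>s\<close> per step, so a chain of \<open>N\<close> steps
  bounds the change by \<open>2 N s\<close>.\<close>

lemma patching:
  fixes U :: "'b \<Rightarrow> real" and R :: "'b \<Rightarrow> 'b \<Rightarrow> bool"
  assumes sym: "\<And>x y. x \<in> X \<Longrightarrow> y \<in> X \<Longrightarrow> R x y \<Longrightarrow> R y x" and I: "I \<subseteq> X"
    and sub: "\<And>x. x \<in> I \<Longrightarrow> \<exists>y\<in>X. R x y \<and> (\<forall>z\<in>X. R x z \<longrightarrow> U z \<le> U y) \<and>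
                (\<forall>z\<in>X. R x z \<longrightarrow> U y + U z \<ge> 2 * U x)"
    and chain: "\<And>x. x \<in> X \<Longrightarrow> \<exists>k\<le>N. \<exists>f. f 0 = x \<and> f k \<in> X - I \<and> (\<forall>i<k. f i \<in> X \<and> R (f i) (f (Suc i)))"
    and s: "s > 0"
  obtains W where "\<And>x. x \<in> X - I \<Longrightarrow> W x = U x" "\<And>x. x \<in> X \<Longrightarrow> W x \<le> U x"
    "\<And>x. x \<in> X \<Longrightarrow> W x \<ge> U x - 2 * real N * s"
    "\<And>x \<theta>. x \<in> I \<Longrightarrow> \<theta> > 0 \<Longrightarrow> \<exists>y\<in>X. R x y \<and> W y \<ge> W x + s - \<theta> \<and>
                (\<forall>z\<in>X. R x z \<longrightarrow> W y + W z \<ge> 2 * W x - \<theta>)"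
proof -
  define G where "G = {x\<in>I. \<forall>y\<in>X. R x y \<longrightarrow> U y < U x + s}"
  let ?P = "patch_value R X G U s"
  have GX: "G \<subseteq> I" by (auto simp: G_def)
  have low: "U z > U x - s" if "x \<in> G" "z \<in> X" "R x z" for x z
  proof -
    have xI: "x \<in> I" using that GX by auto
    from sub[OF xI] obtain y where y: "y \<in> X" "R x y" and y2: "\<And>z. z \<in> X \<Longrightarrow> R x z \<Longrightarrow> U y + U z \<ge> 2 * U x"
      by blast
    have "U y < U x + s" using that y by (auto simp: G_def)
    then show ?thesis using y2[of z] that by linarith
  qed
  have up: "c \<le> U x" if "?P x c" for x c using that
  proof (induction rule: patch_value.induct)
    case (stop x)
    show ?case by simp
  next
    case (step x y c)
    have "U y < U x + s" using step patch_value_in[OF step(3)] by (auto simp: G_def)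
    then show ?case using step by linarith
  qed
  have out: "?P x c \<longleftrightarrow> c = U x" if "x \<in> X - G" for x c
    using that by (auto elim: patch_value.cases intro: patch_value.stop)
  have ex: "\<exists>c. ?P (f 0) c \<and> c \<ge> U (f 0) - 2 * real k * s"
    if "f k \<in> X - I" "\<forall>i<k. f i \<in> X \<and> R (f i) (f (Suc i))" for f k
    using that
  proof (induction k arbitrary: f)
    case 0
    then have "?P (f 0) (U (f 0))" using GX by (intro patch_value.stop) auto
    then show ?case by auto
  next
    case (Suc k)
    have f0: "f 0 \<in> X" "R (f 0) (f 1)" using Suc.prems by auto
    have IH: "\<exists>c. ?P (f 1) c \<and> c \<ge> U (f 1) - 2 * real k * s"
      using Suc.IH[of "\<lambda>i. f (Suc i)"] Suc.prems by auto
    show ?case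
    proof (cases "f 0 \<in> G")
      case False
      then have "?P (f 0) (U (f 0))" using f0 by (intro patch_value.stop) auto
      then show ?thesis using s by (intro exI[of _ "U (f 0)"]) auto
    next
      case True
      obtain c where c: "?P (f 1) c" "c \<ge> U (f 1) - 2 * real k * s" using IH by blast
      have "?P (f 0) (c - s)" using True f0 c by (intro patch_value.step[of _ _ _ _ "f 1"]) auto
      moreover have "U (f 1) > U (f 0) - s" using low[OF True _ f0(2)] patch_value_in[OF c(1)] by auto
      ultimately show ?thesis using c by (intro exI[of _ "c - s"]) (auto simp: algebra_simps)
    qed
  qed
  have ex': "\<exists>c. ?P x c \<and> c \<ge> U x - 2 * real N * s" if x: "x \<in> X" for x
  proof -
    obtain k f where k: "k \<le> N" "f 0 = x" "f k \<in> X - I" "\<forall>i<k. f i \<in> X \<and> R (f i) (f (Suc i))"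
      using chain[OF x] by blast
    obtain c where c: "?P x c" "c \<ge> U x - 2 * real k * s" using ex[of f k] k by auto
    have "real k * s \<le> real N * s" using k s by simp
    then show ?thesis using c by (intro exI[of _ c]) auto
  qed
  define W where "W x = Sup {c. ?P x c}" for x
  have bdd: "bdd_above {c. ?P x c}" for x using up by (intro bdd_aboveI[of _ "U x"]) auto
  have Wge: "c \<le> W x" if "?P x c" for x c
    unfolding W_def using that bdd by (intro cSup_upper) auto
  have Wle: "W x \<le> b" if "x \<in> X" "\<And>c. ?P x c \<Longrightarrow> c \<le> b" for x b
    unfolding W_def using that ex'[of x] by (intro cSup_least) auto
  have WU: "W x \<le> U x" if "x \<in> X" for x using that up by (intro Wle) auto
  have Wout: "W x = U x" if "x \<in> X - G" for x using out[OF that] by (simp add: W_def)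
  have Wlow: "W x - s \<le> W z" if "x \<in> G" "z \<in> X" "R x z" for x z
  proof (cases "z \<in> G")
    case False
    then show ?thesis using Wout[of z] low[OF that] WU[of x] that GX I by force
  next
    case True
    have "W x \<le> W z + s"
    proof (rule Wle)
      show "x \<in> X" using that GX I by auto
      then have "R z x" using that sym by auto
      fix c assume "?P x c"
      then have "?P z (c - s)" using True that \<open>R z x\<close> by (intro patch_value.step) auto
      then show "c \<le> W z + s" using Wge by fastforce
    qed
    then show ?thesis by simp
  qed
  show thesis
  proof (rule that[of W])
    show "W x = U x" if "x \<in> X - I" for x using that GX by (intro Wout) auto
    show "W x \<le> U x" if "x \<in> X" for x using WU that .
    show "W x \<ge> U x - 2 * real N * s" if "x \<in> X" for x using ex'[OF that] Wge by force
    fix x and \<theta> :: real assume xI: "x \<in> I" and th: "\<theta> > 0"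
    then have xX: "x \<in> X" using I by auto
    show "\<exists>y\<in>X. R x y \<and> W y \<ge> W x + s - \<theta> \<and> (\<forall>z\<in>X. R x z \<longrightarrow> W y + W z \<ge> 2 * W x - \<theta>)"
    proof (cases "x \<in> G")
      case True
      have "\<exists>c. ?P x c \<and> W x - \<theta> < c"
      proof (rule ccontr)
        assume "\<not> ?thesis"
        then have "W x \<le> W x - \<theta>" using xX by (intro Wle) (auto simp: not_less)
        then show False using th by simp
      qed
      then obtain c where c: "?P x c" "W x - \<theta> < c" by blast
      obtain y c' where y: "R x y" "?P y c'" "c = c' - s"
        using c(1) True by (auto elim: patch_value.cases)
      have yX: "y \<in> X" using y patch_value_in by metis
      have 1: "W y \<ge> W x + s - \<theta>" using Wge[OF y(2)] y c by linarith
      have 2: "W y + W z \<ge> 2 * W x - \<theta>" if "z \<in> X" "R x z" for z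
        using Wlow[OF True that] 1 by linarith
      show ?thesis using y(1) yX 1 2 by auto
    next
      case False
      obtain y where y: "y \<in> X" "R x y" and y1: "\<And>z. z \<in> X \<Longrightarrow> R x z \<Longrightarrow> U z \<le> U y"
        and y2: "\<And>z. z \<in> X \<Longrightarrow> R x z \<Longrightarrow> U y + U z \<ge> 2 * U x" using sub[OF xI] by blast
      obtain z0 where "z0 \<in> X" "R x z0" "U z0 \<ge> U x + s" using False xI by (auto simp: G_def not_less)
      then have ys: "U y \<ge> U x + s" using y1 by fastforce
      have yG: "y \<notin> G"
      proof
        assume "y \<in> G"
        then have "U x > U y - s" using low[of y x] y xX sym by auto
        moreover have "y \<in> I" using \<open>y \<in> G\<close> GX by auto
        ultimately show False using ys low[of y x] 
          by (metis \<open>y \<in> G\<close> add.commute diff_less_eq linorder_not_less add_le_cancel_left le_diff_eq)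
      qed
      have Wx: "W x = U x" using Wout xX False by auto
      have Wy: "W y = U y" using Wout y yG by auto
      have "W y + W z \<ge> 2 * W x" if z: "z \<in> X" "R x z" for z
      proof (cases "z \<in> G")
        case False
        then show ?thesis using y2[OF z] Wout[of z] z Wx Wy by auto
      next
        case True
        have "?P x (U x)" using False xX by (intro patch_value.stop) auto
        then have "?P z (U x - s)" using True z sym xX by (intro patch_value.step[of _ _ _ _ x]) auto
        then show ?thesis using Wge[of z] Wx Wy ys by fastforce
      qed
      then show ?thesis using y ys Wx Wy th by (intro bexI[of _ y]) fastforce+
    qed
  qed
qed

lemma comparison_patched:
  fixes U V :: "'b \<Rightarrow> real" and R :: "'b \<Rightarrow> 'b \<Rightarrow> bool"
  assumes sym: "\<And>x y. x \<in> X \<Longrightarrow> y \<in> X \<Longrightarrow> R x y \<Longrightarrow> R y x" and I: "I \<subseteq> X"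
    and U: "\<And>x. x \<in> X \<Longrightarrow> \<bar>U x\<bar> \<le> M" and V: "\<And>x. x \<in> X \<Longrightarrow> \<bar>V x\<bar> \<le> M"
    and sub: "\<And>x. x \<in> I \<Longrightarrow> \<exists>y\<in>X. R x y \<and> (\<forall>z\<in>X. R x z \<longrightarrow> U z \<le> U y) \<and>
                (\<forall>z\<in>X. R x z \<longrightarrow> U y + U z \<ge> 2 * U x)"
    and super: "\<And>x. x \<in> I \<Longrightarrow> \<exists>z\<in>X. R x z \<and> (\<forall>y\<in>X. R x y \<longrightarrow> V y + V z \<le> 2 * V x + e)"
    and chain: "\<And>x. x \<in> X \<Longrightarrow> \<exists>k\<le>N. \<exists>f. f 0 = x \<and> f k \<in> X - I \<and> (\<forall>i<k. f i \<in> X \<and> R (f i) (f (Suc i)))"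
    and bdry: "\<And>x. x \<in> X - I \<Longrightarrow> U x - V x \<le> B"
    and s: "s > 0" and e: "e > 0" and x: "x \<in> X"
  shows "U x - V x \<le> B + 2 * real N * s + 8 * e * (M + 2 * real N * s)\<^sup>2 / s\<^sup>2"
proof -
  obtain W where W: "\<And>x. x \<in> X - I \<Longrightarrow> W x = U x" "\<And>x. x \<in> X \<Longrightarrow> W x \<le> U x"
    "\<And>x. x \<in> X \<Longrightarrow> W x \<ge> U x - 2 * real N * s"
    "\<And>x \<theta>. x \<in> I \<Longrightarrow> \<theta> > 0 \<Longrightarrow> \<exists>y\<in>X. R x y \<and> W y \<ge> W x + s - \<theta> \<and>
                (\<forall>z\<in>X. R x z \<longrightarrow> W y + W z \<ge> 2 * W x - \<theta>)"
    using patching[of X R I U N s, OF sym I sub chain s] by blast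
  have "W x - V x \<le> B + 8 * e * (M + 2 * real N * s)\<^sup>2 / s\<^sup>2"
  proof (rule comparison_strict[of X W "M + 2 * real N * s" V I R s e B x])
    fix y assume y: "y \<in> X"
    have "0 \<le> real N * s" using s by simp
    then show "\<bar>W y\<bar> \<le> M + 2 * real N * s" "\<bar>V y\<bar> \<le> M + 2 * real N * s"
      using W(2,3)[OF y] U[OF y] V[OF y] by linarith+
  next
    fix y assume "y \<in> X - I" then show "W y - V y \<le> B" using bdry W(1) by auto
  qed (use W(4) super s e x in auto)
  then show ?thesis using W(3)[OF x] by linarith
qed

section \<open>The geodesic distance\<close>

text \<open>The derivative of the polynomial \<open>3 t\<^sup>2 - 2 t\<^sup>3\<close>, cut off outside the unit interval. It vanishes at both ends, so
  curves run through with this speed profile can be joined continuously differentiably.\<close>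

definition bump :: "real \<Rightarrow> real" where "bump t = max 0 (6 * t * (1 - t))"

lemma bump_nonneg: "0 \<le> bump t" by (simp add: bump_def)
lemma bump_cont: "continuous_on A bump"
  unfolding bump_def by (intro continuous_intros)
lemma bump_zero: "t \<le> 0 \<or> t \<ge> 1 \<Longrightarrow> bump t = 0"
proof -
  assume t: "t \<le> 0 \<or> t \<ge> 1"
  have "t * (1 - t) \<le> 0" using t by (auto simp: mult_le_0_iff)
  then show ?thesis by (simp add: bump_def max_def mult.assoc)
qed
lemma bump_eq: "0 \<le> t \<Longrightarrow> t \<le> 1 \<Longrightarrow> bump t = 6 * t * (1 - t)"
  by (auto simp: bump_def max_def mult_nonneg_nonneg)
lemma bump_le: "bump t \<le> 3/2"
proof -
  have "0 \<le> 6 * (t - 1/2)\<^sup>2" by simp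
  also have "\<dots> = 3/2 - 6 * t * (1 - t)" by (simp add: power2_eq_square algebra_simps)
  finally show ?thesis by (simp add: bump_def)
qed

lemma antiderivative_on_reals:
  fixes f :: "real \<Rightarrow> 'a::euclidean_space"
  assumes "continuous_on UNIV f"
  obtains G where "\<And>t. (G has_vector_derivative f t) (at t)"
proof -
  have "\<exists>F. \<forall>x :: real. -\<infinity> < ereal x \<longrightarrow> ereal x < \<infinity> \<longrightarrow> (F has_vector_derivative f x) (at x)"
    using assms by (intro einterval_antiderivative) (auto simp: continuous_on_eq_continuous_at)
  then show thesis using that by auto
qed

lemma ease_exists:
  obtains P :: "real \<Rightarrow> real" where "\<And>t. (P has_real_derivative bump t) (at t)"
    "\<And>t. t \<le> 0 \<Longrightarrow> P t = 0" "\<And>t. t \<ge> 1 \<Longrightarrow> P t = 1" "\<And>t. P t \<in> {0..1}"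
proof -
  obtain G where G: "\<And>t. (G has_vector_derivative bump t) (at t)"
    using antiderivative_on_reals[OF bump_cont] by blast
  define P where "P t = G t - G 0" for t
  have P: "(P has_real_derivative bump t) (at t)" for t
    using G[of t] unfolding P_def has_real_derivative_iff_has_vector_derivative
    by (auto intro!: derivative_eq_intros)
  have "\<exists>c. \<forall>t\<in>{..0}. P t = c"
  proof (intro has_field_derivative_zero_constant)
    show "(P has_real_derivative 0) (at t within {..0})" if "t \<in> {..0}" for t
      using P[of t] bump_zero[of t] that by (auto intro: has_field_derivative_at_within)
  qed auto
  then have P0: "P t = 0" if "t \<le> 0" for t
    using that by (metis P_def atMost_iff diff_self order_refl)
  have "\<exists>c. \<forall>t\<in>{0..1}. P t - (3*t\<^sup>2 - 2*t^3) = c"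
  proof (intro has_field_derivative_zero_constant)
    fix t :: real assume t: "t \<in> {0..1}"
    have "((\<lambda>t. P t - (3*t\<^sup>2 - 2*t^3)) has_real_derivative bump t - (6*t - 6*t\<^sup>2)) (at t)"
      by (auto intro!: derivative_eq_intros P)
    also have "bump t - (6*t - 6*t\<^sup>2) = 0" using t by (simp add: bump_eq power2_eq_square algebra_simps)
    finally show "((\<lambda>t. P t - (3*t\<^sup>2 - 2*t^3)) has_real_derivative 0) (at t within {0..1})"
      by (rule has_field_derivative_at_within)
  qed auto
  then obtain c where c: "\<And>t. 0 \<le> t \<Longrightarrow> t \<le> 1 \<Longrightarrow> P t - (3*t\<^sup>2 - 2*t^3) = c" by auto
  have "P 1 = 1" using c[of 0] c[of 1] P0[of 0] by simp
  moreover have "\<exists>c. \<forall>t\<in>{1..}. P t = c"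
  proof (intro has_field_derivative_zero_constant)
    show "(P has_real_derivative 0) (at t within {1..})" if "t \<in> {1..}" for t
      using P[of t] bump_zero[of t] that by (auto intro: has_field_derivative_at_within)
  qed auto
  ultimately have P1: "P t = 1" if "t \<ge> 1" for t
    using that by (metis atLeast_iff order_refl)
  have mono: "P s \<le> P t" if "s \<le> t" for s t
    using that P bump_nonneg by (intro DERIV_nonneg_imp_nondecreasing[of s t P]) auto
  have "P t \<in> {0..1}" for t
    using mono[of 0 t] mono[of t 1] P0[of t] P1[of t] P0[of 0] P1[of 1] by (cases "t \<le> 0"; cases "t \<ge> 1") auto
  then show thesis using that P P0 P1 by blast
qed

text \<open>A curve that rests at both ends, with speed at most \<open>c * bump\<close> and hence length at most \<open>c\<close>. Being defined on
  the whole line, constant outside the unit interval, such curves are concatenated by adding them, without case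
  distinctions at the joints.\<close>

definition eased_curve :: "'a::euclidean_space set \<Rightarrow> 'a \<Rightarrow> 'a \<Rightarrow> real \<Rightarrow> (real \<Rightarrow> 'a) \<Rightarrow> (real \<Rightarrow> 'a) \<Rightarrow> bool" where
  "eased_curve S x y c F F' \<longleftrightarrow>
     (\<forall>t. (F has_vector_derivative F' t) (at t)) \<and> continuous_on UNIV F' \<and> range F \<subseteq> S \<and>
     (\<forall>t\<le>0. F t = x) \<and> (\<forall>t\<ge>1. F t = y) \<and> (\<forall>t. norm (F' t) \<le> c * bump t)"

text \<open>Reparametrize by the strictly increasing function with derivative \<open>norm \<xi>' + (c - L)\<close>, where \<open>L\<close> is the length;
  the positive constant makes its inverse continuously differentiable even where \<open>\<xi>'\<close> vanishes. The
  resulting speed is below \<open>c\<close>; then compose with the function whose derivative is \<open>bump\<close>.\<close>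

lemma eased_curve_exists:
  fixes S :: "'a::euclidean_space set"
  assumes curve: "(\<xi>, \<xi>') \<in> C1_curves S x y" and c: "integral {0..1} (\<lambda>t. norm (\<xi>' t)) < c"
  obtains F F' where "eased_curve S x y c F F'"
proof -
  define L where "L = integral {0..1} (\<lambda>t. norm (\<xi>' t))"
  have der: "\<And>t. t \<in> {0..1} \<Longrightarrow> (\<xi> has_vector_derivative \<xi>' t) (at t within {0..1})"
    and cont: "continuous_on {0..1} \<xi>'" and im: "\<xi> ` {0..1} \<subseteq> S" and ends: "\<xi> 0 = x" "\<xi> 1 = y"
    using curve by (auto simp: C1_curves_def)
  define clamp01 where "clamp01 t = max 0 (min 1 t)" for t :: real
  have cl: "clamp01 t \<in> {0..1}" "continuous_on A clamp01" for t A
    unfolding clamp01_def by (auto intro!: continuous_intros)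
  define q where "q t = norm (\<xi>' (clamp01 t)) + (c - L)" for t
  have \<kappa>: "c - L > 0" using c by (simp add: L_def)
  have qpos: "q t > 0" for t using \<kappa> by (auto simp: q_def intro: add_nonneg_pos)
  have qcont: "continuous_on A q" for A
    unfolding q_def by (intro continuous_intros continuous_on_compose2[OF cont] cl) (use cl in auto)
  obtain G where G: "\<And>t. (G has_vector_derivative q t) (at t)"
    using antiderivative_on_reals[OF qcont] by blast
  then have Gd: "\<And>t. DERIV G t :> q t" by (simp add: has_real_derivative_iff_has_vector_derivative)
  have Gless: "G s < G t" if "s < t" for s t
    using that by (intro DERIV_pos_imp_increasing[of s t G]) (use Gd qpos in blast)+
  then have Ginj: "inj G" by (metis injI less_irrefl linorder_neqE_linordered_idom)
  have Gcont: "isCont G t" for t using Gd DERIV_isCont by blast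
  have "(q has_integral (G 1 - G 0)) {0..1}"
    by (intro fundamental_theorem_of_calculus has_vector_derivative_at_within[OF G]) simp
  moreover have "(q has_integral c) {0..1}"
  proof -
    have "((\<lambda>t. norm (\<xi>' t) + (c - L)) has_integral L + (c - L)) {0..1}"
      using has_integral_const_real[of "c - L" 0 1] unfolding L_def
      by (intro has_integral_add integrable_integral integrable_continuous_interval continuous_intros cont) auto
    moreover have "norm (\<xi>' t) + (c - L) = q t" if "t \<in> {0..1}" for t
      using that by (simp add: q_def clamp01_def)
    ultimately have "(q has_integral L + (c - L)) {0..1}"
      using has_integral_cong[of "{0..1}" "\<lambda>t. norm (\<xi>' t) + (c - L)" q] by blast
    then show ?thesis by simp
  qed
  ultimately have G01: "G 1 - G 0 = c" using has_integral_unique by blast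
  define g where "g = inv G"
  have gG: "g (G t) = t" for t using Ginj by (simp add: g_def)
  have Gg: "G (g p) = p" if "G (-1) \<le> p" "p \<le> G 2" for p
  proof -
    have "\<exists>t\<ge>-1. t \<le> 2 \<and> G t = p" using that Gcont by (intro IVT) auto
    then obtain t where "G t = p" by blast
    then show ?thesis using gG[of t] by simp
  qed
  have gcont: "isCont g (G t)" for t
    by (rule isCont_inverse_function[of 1]) (use gG Gcont in auto)
  have gd: "DERIV g p :> inverse (q (g p))" if p: "G 0 \<le> p" "p \<le> G 1" for p
  proof -
    have 1: "G (-1) < p" "p < G 2" using p Gless[of "-1" 0] Gless[of 1 2] by auto
    have "isCont g p" using gcont[of "g p"] Gg 1 by simp
    then show ?thesis
      using 1 Gg Gd qpos[of "g p"] by (intro DERIV_inverse_function[where f=G and a="G (-1)" and b="G 2"]) auto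
  qed
  obtain P where P: "\<And>t. (P has_real_derivative bump t) (at t)" "\<And>t. t \<le> 0 \<Longrightarrow> P t = 0"
    "\<And>t. t \<ge> 1 \<Longrightarrow> P t = 1" and P01: "\<And>t. P t \<in> {0..1}" using ease_exists by blast
  have c0: "c > 0" using G01 Gless[of 0 1] by simp
  define p where "p t = G 0 + c * P t" for t
  have pr: "G 0 \<le> p t" "p t \<le> G 1" for t
  proof -
    have "0 \<le> c * P t" "c * P t \<le> c * 1" using P01[of t] c0 by (auto intro!: mult_left_mono)
    then show "G 0 \<le> p t" "p t \<le> G 1" using G01 by (auto simp: p_def)
  qed
  have pd: "DERIV p t :> c * bump t" for t unfolding p_def by (auto intro!: derivative_eq_intros P)
  define \<tau> where "\<tau> t = g (p t)" for t
  have \<tau>01: "\<tau> t \<in> {0..1}" for t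
  proof -
    have "G (\<tau> t) = p t" using Gg[of "p t"] pr[of t] Gless[of "-1" 0] Gless[of 1 2] by (simp add: \<tau>_def)
    then have "\<not> \<tau> t < 0" "\<not> \<tau> t > 1" using Gless[of "\<tau> t" 0] Gless[of 1 "\<tau> t"] pr[of t] by auto
    then show ?thesis by auto
  qed
  have \<tau>d: "DERIV \<tau> t :> inverse (q (\<tau> t)) * (c * bump t)" for t
    unfolding \<tau>_def using gd[OF pr, of t] pd by (rule DERIV_chain2)
  define F where "F = \<xi> \<circ> \<tau>"
  define F' where "F' t = (inverse (q (\<tau> t)) * (c * bump t)) *\<^sub>R \<xi>' (\<tau> t)" for t
  have "(F has_vector_derivative F' t) (at t)" for t
    unfolding F_def F'_def
  proof (rule vector_diff_chain_within)
    show "(\<tau> has_vector_derivative inverse (q (\<tau> t)) * (c * bump t)) (at t)"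
      using \<tau>d by (simp add: has_real_derivative_iff_has_vector_derivative)
    show "(\<xi> has_vector_derivative \<xi>' (\<tau> t)) (at (\<tau> t) within range \<tau>)"
      by (rule has_vector_derivative_within_subset[OF der[OF \<tau>01]]) (use \<tau>01 in auto)
  qed
  moreover have "continuous_on UNIV F'"
  proof -
    have \<tau>c: "continuous_on UNIV \<tau>" using \<tau>d DERIV_isCont by (meson continuous_at_imp_continuous_on)
    show ?thesis unfolding F'_def
      by (intro continuous_intros continuous_on_compose2[OF cont \<tau>c] continuous_on_compose2[OF qcont \<tau>c] bump_cont)
         (use \<tau>01 qpos in \<open>auto simp: less_imp_neq[OF qpos, symmetric]\<close>)
  qed
  moreover have "range F \<subseteq> S" using im \<tau>01 by (auto simp: F_def)
  moreover have "F t = x" if "t \<le> 0" for t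
    using P(2)[OF that] gG[of 0] ends by (simp add: F_def \<tau>_def p_def)
  moreover have "F t = y" if "t \<ge> 1" for t
    using P(3)[OF that] gG[of 1] ends G01 by (simp add: F_def \<tau>_def p_def add.commute[of "G 0"] flip: G01)
  moreover have "norm (F' t) \<le> c * bump t" for t
  proof -
    have qq: "norm (\<xi>' (\<tau> t)) \<le> q (\<tau> t)" using \<tau>01[of t] \<kappa> by (auto simp: q_def clamp01_def)
    have "norm (F' t) = (norm (\<xi>' (\<tau> t)) / q (\<tau> t)) * (c * bump t)"
      using qpos[of "\<tau> t"] c0 bump_nonneg[of t] by (simp add: F'_def divide_inverse abs_mult)
    also have "\<dots> \<le> 1 * (c * bump t)"
      using qq qpos[of "\<tau> t"] c0 bump_nonneg[of t] by (intro mult_right_mono) auto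
    finally show ?thesis by simp
  qed
  ultimately have "eased_curve S x y c F F'" by (simp add: eased_curve_def)
  then show thesis by (rule that)
qed

lemma C1_curves_length:
  assumes "(\<xi>, \<xi>') \<in> C1_curves S x y"
  shows "(\<lambda>t. norm (\<xi>' t)) integrable_on {0..1}" "0 \<le> integral {0..1} (\<lambda>t. norm (\<xi>' t))"
proof -
  have "continuous_on {0..1} \<xi>'" using assms by (simp add: C1_curves_def)
  then show i: "(\<lambda>t. norm (\<xi>' t)) integrable_on {0..1}"
    by (intro integrable_continuous_interval continuous_on_norm)
  show "0 \<le> integral {0..1} (\<lambda>t. norm (\<xi>' t))"
    by (rule integral_nonneg[OF i]) simp
qed

lemma geo_dist_less_iff_curve:
  "geo_dist \<Omega> x y < ennreal c \<longleftrightarrow>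
     (\<exists>\<xi> \<xi>'. (\<xi>, \<xi>') \<in> C1_curves (closure \<Omega>) x y \<and> integral {0..1} (\<lambda>t. norm (\<xi>' t)) < c)"
proof -
  have eq: "ennreal (integral {0..1} (\<lambda>t. norm (\<xi>' t))) < ennreal c \<longleftrightarrow> integral {0..1} (\<lambda>t. norm (\<xi>' t)) < c"
    if "(\<xi>, \<xi>') \<in> C1_curves (closure \<Omega>) x y" for \<xi> \<xi>'
    by (rule ennreal_less_iff[OF C1_curves_length(2)[OF that]])
  have "geo_dist \<Omega> x y < ennreal c \<longleftrightarrow> (\<exists>p\<in>C1_curves (closure \<Omega>) x y.
      (case p of (\<xi>, \<xi>') \<Rightarrow> ennreal (integral {0..1} (\<lambda>t. norm (\<xi>' t)))) < ennreal c)"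
    unfolding geo_dist_def INF_less_iff ..
  also have "\<dots> \<longleftrightarrow> (\<exists>\<xi> \<xi>'. (\<xi>, \<xi>') \<in> C1_curves (closure \<Omega>) x y \<and> ennreal (integral {0..1} (\<lambda>t. norm (\<xi>' t))) < ennreal c)"
    by force
  also have "\<dots> \<longleftrightarrow> (\<exists>\<xi> \<xi>'. (\<xi>, \<xi>') \<in> C1_curves (closure \<Omega>) x y \<and> integral {0..1} (\<lambda>t. norm (\<xi>' t)) < c)"
    using eq by meson
  finally show ?thesis .
qed

lemma geo_dist_less_eased_curve:
  assumes "geo_dist \<Omega> x y < ennreal c"
  obtains F F' where "eased_curve (closure \<Omega>) x y c F F'"
proof -
  obtain \<xi> \<xi>' where "(\<xi>, \<xi>') \<in> C1_curves (closure \<Omega>) x y" "integral {0..1} (\<lambda>t. norm (\<xi>' t)) < c"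
    using assms unfolding geo_dist_less_iff_curve by blast
  then show thesis by (rule eased_curve_exists) (rule that)
qed

lemma geo_dist_le_curve:
  assumes C: "(\<xi>, \<xi>') \<in> C1_curves (closure \<Omega>) x y" and f: "\<And>t. t \<in> {0..1} \<Longrightarrow> norm (\<xi>' t) \<le> f t"
    and i: "(f has_integral c) {0..1}"
  shows "geo_dist \<Omega> x y \<le> ennreal c"
proof -
  have "integral {0..1} (\<lambda>t. norm (\<xi>' t)) \<le> c"
    by (rule has_integral_le[OF integrable_integral[OF C1_curves_length(1)[OF C]] i f])
  then have "ennreal (integral {0..1} (\<lambda>t. norm (\<xi>' t))) \<le> ennreal c" by (rule ennreal_leI)
  then show ?thesis unfolding geo_dist_def
    by (intro INF_lower2[OF C]) simp
qed

lemma geo_dist_triangle: "geo_dist \<Omega> x z \<le> geo_dist \<Omega> x y + geo_dist \<Omega> y z"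
proof -
  have main: "geo_dist \<Omega> x z \<le> ennreal (a + b)"
    if ab: "geo_dist \<Omega> x y < ennreal a" "geo_dist \<Omega> y z < ennreal b" for a b
  proof -
    obtain F1 F1' where 1: "eased_curve (closure \<Omega>) x y a F1 F1'"
      by (rule geo_dist_less_eased_curve[OF ab(1)])
    obtain F2 F2' where 2: "eased_curve (closure \<Omega>) y z b F2 F2'"
      by (rule geo_dist_less_eased_curve[OF ab(2)])
    obtain P where P: "\<And>t. (P has_real_derivative bump t) (at t)" "\<And>t. t \<le> 0 \<Longrightarrow> P t = 0"
      "\<And>t. t \<ge> 1 \<Longrightarrow> P t = 1" "\<And>t. P t \<in> {0..1}" by (rule ease_exists) blast
    define F where "F t = F1 (2*t) + F2 (2*t - 1) - y" for t
    define F' where "F' t = 2 *\<^sub>R F1' (2*t) + 2 *\<^sub>R F2' (2*t - 1)" for t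
    have lin: "((\<lambda>t. 2*t) has_vector_derivative 2) (at t)" "((\<lambda>t. 2*t-1) has_vector_derivative 2) (at t)" for t :: real
      by (auto simp flip: has_real_derivative_iff_has_vector_derivative intro!: derivative_eq_intros)
    have d1: "((F1 \<circ> (\<lambda>t. 2*t)) has_vector_derivative 2 *\<^sub>R F1' (2*t)) (at t)" for t
      by (rule vector_diff_chain_at[OF lin(1)]) (use 1 in \<open>simp add: eased_curve_def\<close>)
    have d2: "((F2 \<circ> (\<lambda>t. 2*t-1)) has_vector_derivative 2 *\<^sub>R F2' (2*t-1)) (at t)" for t
      by (rule vector_diff_chain_at[OF lin(2)]) (use 2 in \<open>simp add: eased_curve_def\<close>)
    have d: "(F has_vector_derivative F' t) (at t)" for t
      using has_vector_derivative_diff[OF has_vector_derivative_add[OF d1[of t] d2[of t]] has_vector_derivative_const[of y]]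
      unfolding F_def[abs_def] F'_def by (simp add: o_def)
    have ct: "continuous_on UNIV F1'" "continuous_on UNIV F2'" using 1 2 by (auto simp: eased_curve_def)
    have cF: "continuous_on {0..1} F'" unfolding F'_def
      by (intro continuous_intros continuous_on_compose2[OF ct(1)] continuous_on_compose2[OF ct(2)]) auto
    have im: "F t \<in> closure \<Omega>" for t
    proof (cases "2*t \<le> 1")
      case True
      then have "F2 (2*t-1) = y" using 2 by (simp add: eased_curve_def)
      then show ?thesis using 1 by (auto simp: F_def eased_curve_def)
    next
      case False
      then have "F1 (2*t) = y" using 1 by (simp add: eased_curve_def)
      then show ?thesis using 2 by (auto simp: F_def eased_curve_def)
    qed
    have "F 0 = x" "F 1 = z" using 1 2 by (auto simp: F_def eased_curve_def)
    then have C: "(F, F') \<in> C1_curves (closure \<Omega>) x z"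
      using d cF im by (auto simp: C1_curves_def intro: has_vector_derivative_at_within)
    show ?thesis
    proof (rule geo_dist_le_curve[OF C])
      fix t :: real
      have "norm (F1' (2*t)) \<le> a * bump (2*t)" "norm (F2' (2*t-1)) \<le> b * bump (2*t-1)"
        using 1 2 by (auto simp: eased_curve_def)
      then show "norm (F' t) \<le> a * (2 * bump (2*t)) + b * (2 * bump (2*t-1))"
        unfolding F'_def by (intro norm_triangle_le) auto
    next
      have "((\<lambda>t. a * (2 * bump (2*t)) + b * (2 * bump (2*t-1))) has_integral
              (a * P (2*1) + b * P (2*1-1)) - (a * P (2*0) + b * P (2*0-1))) {0..1}"
      proof (intro fundamental_theorem_of_calculus)
        fix t :: real
        have "((\<lambda>t. a * P (2*t) + b * P (2*t-1)) has_real_derivative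
            a * (2 * bump (2*t)) + b * (2 * bump (2*t-1))) (at t within {0..1})"
          by (auto intro!: derivative_eq_intros DERIV_chain2[OF P(1)])
        then show "((\<lambda>t. a * P (2*t) + b * P (2*t-1)) has_vector_derivative
            a * (2 * bump (2*t)) + b * (2 * bump (2*t-1))) (at t within {0..1})"
          by (simp add: has_real_derivative_iff_has_vector_derivative)
      qed auto
      then show "((\<lambda>t. a * (2 * bump (2*t)) + b * (2 * bump (2*t-1))) has_integral (a + b)) {0..1}"
        using P(2,3) by simp
    qed
  qed
  show ?thesis
  proof (cases "geo_dist \<Omega> x y = \<infinity> \<or> geo_dist \<Omega> y z = \<infinity>")
    case True then show ?thesis by auto
  next
    case False
    define a b where "a = enn2real (geo_dist \<Omega> x y)" and "b = enn2real (geo_dist \<Omega> y z)"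
    have ab: "geo_dist \<Omega> x y = ennreal a" "geo_dist \<Omega> y z = ennreal b" "a \<ge> 0" "b \<ge> 0"
      using False unfolding a_def b_def infinity_ennreal_def
      by (simp_all only: ennreal_enn2real_if enn2real_nonneg if_False de_Morgan_disj)
    have "geo_dist \<Omega> x z \<le> ennreal (a + b) + ennreal e" if "e > 0" for e
    proof -
      have "geo_dist \<Omega> x z \<le> ennreal ((a + e/2) + (b + e/2))"
        using that ab by (intro main) (simp_all add: ennreal_less_iff)
      also have "(a + e/2) + (b + e/2) = (a + b) + e" by simp
      also have "ennreal \<dots> = ennreal (a + b) + ennreal e" using ab that by (intro ennreal_plus) auto
      finally show ?thesis .
    qed
    then have "geo_dist \<Omega> x z \<le> ennreal (a + b)"
      by (rule ennreal_le_epsilon)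
    then show ?thesis using ab by simp
  qed
qed

lemma has_integral_bump: "(bump has_integral 1) {0..1}"
proof -
  obtain P where P: "\<And>t. (P has_real_derivative bump t) (at t)" "\<And>t. t \<le> 0 \<Longrightarrow> P t = 0"
      "\<And>t. t \<ge> 1 \<Longrightarrow> P t = 1" "\<And>t. P t \<in> {0..1}" by (rule ease_exists) blast
  have "(bump has_integral P 1 - P 0) {0..1}"
  proof (rule fundamental_theorem_of_calculus)
    show "(P has_vector_derivative bump t) (at t within {0..1})" for t
      using P(1)[of t] by (simp add: has_real_derivative_iff_has_vector_derivative has_vector_derivative_at_within)
  qed simp
  then show ?thesis using P(2)[of 0] P(3)[of 1] by simp
qed

lemma eased_curve_geo_dist:
  assumes "eased_curve (closure \<Omega>) x y c F F'"
  shows "geo_dist \<Omega> x y \<le> ennreal c"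
proof (rule geo_dist_le_curve)
  show "(F, F') \<in> C1_curves (closure \<Omega>) x y"
    using assms by (auto simp: C1_curves_def eased_curve_def intro: has_vector_derivative_at_within continuous_on_subset)
  show "norm (F' t) \<le> c * bump t" for t using assms by (simp add: eased_curve_def)
  show "((\<lambda>t. c * bump t) has_integral c) {0..1}"
    using has_integral_mult_right[OF has_integral_bump, of c] by simp
qed

lemma geo_dist_le_flip: "geo_dist \<Omega> y x \<le> geo_dist \<Omega> x y"
proof (rule dense_ge)
  fix e assume e: "geo_dist \<Omega> x y < e"
  show "geo_dist \<Omega> y x \<le> e"
  proof (cases e)
    case (real c)
    then obtain F F' where F: "eased_curve (closure \<Omega>) x y c F F'"
      using e geo_dist_less_eased_curve by metis
    have lin: "((\<lambda>t. 1 - t) has_vector_derivative -1) (at t)" for t :: real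
      by (auto simp flip: has_real_derivative_iff_has_vector_derivative intro!: derivative_eq_intros)
    have "((F \<circ> (\<lambda>t. 1 - t)) has_vector_derivative (-1) *\<^sub>R F' (1 - t)) (at t)" for t
      by (rule vector_diff_chain_at[OF lin]) (use F in \<open>simp add: eased_curve_def\<close>)
    moreover have ct: "continuous_on UNIV F'" using F by (simp add: eased_curve_def)
    have "continuous_on UNIV (\<lambda>t. (-1) *\<^sub>R F' (1 - t))"
      by (intro continuous_intros continuous_on_compose2[OF ct]) auto
    moreover have "norm ((-1) *\<^sub>R F' (1 - t)) \<le> c * bump t" for t
    proof -
      have "bump (1 - t) = bump t" by (simp add: bump_def algebra_simps)
      then show ?thesis using F by (auto simp: eased_curve_def dest!: spec[of _ "1 - t"])
    qed
    ultimately have "eased_curve (closure \<Omega>) y x c (F \<circ> (\<lambda>t. 1 - t)) (\<lambda>t. (-1) *\<^sub>R F' (1 - t))"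
      using F unfolding eased_curve_def by auto
    then show ?thesis using real eased_curve_geo_dist by simp
  qed simp
qed

lemma geo_dist_sym: "geo_dist \<Omega> x y = geo_dist \<Omega> y x"
  by (intro antisym geo_dist_le_flip)

lemma geo_dist_ge_norm: "ennreal (norm (x - y)) \<le> geo_dist \<Omega> x y"
  unfolding geo_dist_def
proof (rule INF_greatest, clarify)
  fix \<xi> \<xi>' assume C: "(\<xi>, \<xi>') \<in> C1_curves (closure \<Omega>) x y"
  have "(\<xi>' has_integral \<xi> 1 - \<xi> 0) {0..1}"
    using C by (intro fundamental_theorem_of_calculus) (auto simp: C1_curves_def)
  then have "integral {0..1} \<xi>' = y - x" "\<xi>' integrable_on {0..1}"
    using C by (auto simp: C1_curves_def integral_unique)
  then have "norm (y - x) \<le> integral {0..1} (\<lambda>t. norm (\<xi>' t))"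
    using integral_norm_bound_integral[of \<xi>' "{0..1}" "\<lambda>t. norm (\<xi>' t)"] C1_curves_length[OF C] by simp
  then show "ennreal (norm (x - y)) \<le> ennreal (integral {0..1} (\<lambda>t. norm (\<xi>' t)))"
    by (intro ennreal_leI) (simp add: norm_minus_commute)
qed

lemma geo_dist_segment:
  assumes "closed_segment x y \<subseteq> closure \<Omega>"
  shows "geo_dist \<Omega> x y \<le> ennreal (norm (x - y))"
proof (rule geo_dist_le_curve)
  show "(\<lambda>t. x + t *\<^sub>R (y - x), \<lambda>t. y - x) \<in> C1_curves (closure \<Omega>) x y"
  proof -
    have "x + t *\<^sub>R (y - x) \<in> closed_segment x y" if "0 \<le> t" "t \<le> 1" for t
      using that unfolding closed_segment_def by (auto intro!: exI[of _ t] simp: algebra_simps)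
    then show ?thesis using assms
      by (auto simp: C1_curves_def intro!: derivative_eq_intros continuous_intros)
  qed
  show "norm (y - x) \<le> norm (x - y)" by (simp add: norm_minus_commute)
  show "((\<lambda>t::real. norm (x - y)) has_integral norm (x - y)) {0..1}"
    using has_integral_const_real[of "norm (x - y)" 0 1] by simp
qed

lemma geo_dist_path:
  assumes "geo_dist \<Omega> x y < ennreal c"
  obtains \<gamma> l where "continuous_on {0..1} \<gamma>" "\<gamma> 0 = x" "\<gamma> 1 = y" "\<gamma> ` {0..1} \<subseteq> closure \<Omega>"
    "continuous_on {0..1} l" "l 0 = 0" "l 1 < c"
    "\<And>s t :: real. 0 \<le> s \<Longrightarrow> s \<le> t \<Longrightarrow> t \<le> 1 \<Longrightarrow> geo_dist \<Omega> (\<gamma> s) (\<gamma> t) \<le> ennreal (l t - l s) \<and> l s \<le> l t"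
proof -
  obtain \<xi> \<xi>' where C: "(\<xi>, \<xi>') \<in> C1_curves (closure \<Omega>) x y" and len: "integral {0..1} (\<lambda>t. norm (\<xi>' t)) < c"
    using assms unfolding geo_dist_less_iff_curve by blast
  have der: "\<And>t. t \<in> {0..1} \<Longrightarrow> (\<xi> has_vector_derivative \<xi>' t) (at t within {0..1})"
    and cont: "continuous_on {0..1} \<xi>'" and im: "\<xi> ` {0..1} \<subseteq> closure \<Omega>" and ends: "\<xi> 0 = x" "\<xi> 1 = y"
    using C by (auto simp: C1_curves_def)
  define l where "l t = integral {0..t} (\<lambda>t. norm (\<xi>' t))" for t
  have ld: "(l has_vector_derivative norm (\<xi>' t)) (at t within {0..1})" if "t \<in> {0..1}" for t
    unfolding l_def using that by (intro integral_has_vector_derivative continuous_on_norm cont)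
  have lc: "continuous_on {0..1} l"
    using ld by (meson continuous_on_eq_continuous_within has_vector_derivative_continuous)
  have \<xi>c: "continuous_on {0..1} \<xi>"
    using der by (meson continuous_on_eq_continuous_within has_vector_derivative_continuous)
  have sub: "geo_dist \<Omega> (\<xi> s) (\<xi> t) \<le> ennreal (l t - l s) \<and> l s \<le> l t" if st: "0 \<le> s" "s \<le> t" "t \<le> 1" for s t
  proof -
    define a where "a u = s + u * (t - s)" for u
    have a01: "a u \<in> {0..1}" if "u \<in> {0..1}" for u
    proof -
      have "0 \<le> u * (t - s)" "u * (t - s) \<le> t - s" using that st by (auto intro: mult_left_le_one_le)
      then show ?thesis using st by (auto simp: a_def)
    qed
    have aim: "a ` {0..1} \<subseteq> {0..1}" using a01 by blast
    have ad: "(a has_vector_derivative (t - s)) (at u within {0..1})" for u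
      unfolding a_def by (auto simp flip: has_real_derivative_iff_has_vector_derivative intro!: derivative_eq_intros)
    have 1: "((\<xi> \<circ> a) has_vector_derivative (t - s) *\<^sub>R \<xi>' (a u)) (at u within {0..1})" if "u \<in> {0..1}" for u
      by (rule vector_diff_chain_within[OF ad has_vector_derivative_within_subset[OF der[OF a01[OF that]] aim]])
    have 2: "((l \<circ> a) has_vector_derivative (t - s) *\<^sub>R norm (\<xi>' (a u))) (at u within {0..1})" if "u \<in> {0..1}" for u
      by (rule vector_diff_chain_within[OF ad has_vector_derivative_within_subset[OF ld[OF a01[OF that]] aim]])
    have ac: "continuous_on {0..1} a" unfolding a_def by (intro continuous_intros)
    have "continuous_on {0..1} (\<lambda>u. (t - s) *\<^sub>R \<xi>' (a u))"
      by (intro continuous_intros continuous_on_compose2[OF cont ac]) (use a01 in auto)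
    then have C2: "(\<xi> \<circ> a, \<lambda>u. (t - s) *\<^sub>R \<xi>' (a u)) \<in> C1_curves (closure \<Omega>) (\<xi> s) (\<xi> t)"
      using 1 im a01 by (auto simp: C1_curves_def a_def image_subset_iff)
    have hi: "((\<lambda>u. (t - s) *\<^sub>R norm (\<xi>' (a u))) has_integral (l \<circ> a) 1 - (l \<circ> a) 0) {0..1}"
      by (rule fundamental_theorem_of_calculus[OF _ 2]) simp_all
    have al: "(l \<circ> a) 1 - (l \<circ> a) 0 = l t - l s" by (simp add: a_def)
    have "geo_dist \<Omega> (\<xi> s) (\<xi> t) \<le> ennreal (l t - l s)"
      by (rule geo_dist_le_curve[OF C2 _ hi[unfolded al]]) (use st in simp)
    moreover have "0 \<le> l t - l s" using has_integral_nonneg[OF hi[unfolded al]] st by simp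
    ultimately show ?thesis by simp
  qed
  show thesis by (rule that[of \<xi> l]) (use \<xi>c ends im lc len sub in \<open>simp_all add: l_def[of 0] l_def[of 1]\<close>)
qed

text \<open>Infinitely many curves are concatenated, the \<open>k\<close>-th one in a time interval of length \<open>2\<^sup>-\<^sup>k\<^sup>-\<^sup>1\<close>. Their lengths decay like
  \<open>8\<^sup>-\<^sup>k\<close>, so that the speeds are summable and the series of derivatives converges uniformly; the limit curve is
  continuously differentiable up to its end point. This is what makes boundary points accessible by curves of finite length.\<close>

lemma geo_dist_limit:
  fixes x :: "nat \<Rightarrow> 'a::euclidean_space"
  assumes lim: "x \<longlonglongrightarrow> z" and z: "z \<in> closure \<Omega>" and \<eta>: "\<eta> > 0"
    and step: "\<And>k. geo_dist \<Omega> (x k) (x (Suc k)) < ennreal (\<eta> / 8 ^ k)"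
  shows "geo_dist \<Omega> (x 0) z \<le> ennreal (4 * \<eta>)"
proof -
  have "\<exists>F F'. eased_curve (closure \<Omega>) (x k) (x (Suc k)) (\<eta> / 8 ^ k) F F'" for k
    using geo_dist_less_eased_curve[OF step[of k]] by blast
  then obtain F F' where E: "\<And>k. eased_curve (closure \<Omega>) (x k) (x (Suc k)) (\<eta> / 8 ^ k) (F k) (F' k)"
    by metis
  \<comment> \<open>\<open>a k\<close> maps the interval from \<open>1 - 2\<^sup>-\<^sup>k\<close> to \<open>1 - 2\<^sup>-\<^sup>k\<^sup>-\<^sup>1\<close> onto the unit interval; \<open>f k\<close> vanishes before and is constant after it.\<close>
  define a where "a k t = 2 ^ Suc k * (t - 1) + 2" for k :: nat and t :: real
  define f where "f k t = F k (a k t) - x k" for k t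
  define f' where "f' k t = 2 ^ Suc k *\<^sub>R F' k (a k t)" for k t
  have ad: "(a k has_vector_derivative 2 ^ Suc k) (at t)" for k t
    unfolding a_def by (auto simp flip: has_real_derivative_iff_has_vector_derivative intro!: derivative_eq_intros)
  have fd: "(f k has_vector_derivative f' k t) (at t)" for k t
  proof -
    have "((F k \<circ> a k) has_vector_derivative 2 ^ Suc k *\<^sub>R F' k (a k t)) (at t)"
      by (rule vector_diff_chain_at[OF ad]) (use E[of k] in \<open>simp add: eased_curve_def\<close>)
    from has_vector_derivative_diff[OF this has_vector_derivative_const[of "x k"]]
    show ?thesis by (simp add: f_def[abs_def] f'_def o_def)
  qed
  have f'b: "norm (f' k t) \<le> 3 * \<eta> * (1/4) ^ k" for k t
  proof -
    have "norm (F' k (a k t)) \<le> \<eta> / 8 ^ k * bump (a k t)" using E[of k] by (simp add: eased_curve_def)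
    also have "\<dots> \<le> \<eta> / 8 ^ k * (3/2)" using \<eta> bump_le by (intro mult_left_mono) auto
    finally have "2 ^ Suc k * norm (F' k (a k t)) \<le> 2 ^ Suc k * (\<eta> / 8 ^ k * (3/2))" by (intro mult_left_mono) auto
    also have "\<dots> = 3 * \<eta> * (2 ^ k / 8 ^ k)" by simp
    also have "(2::real) ^ k / 8 ^ k = (1/4) ^ k" by (simp flip: power_divide)
    finally show ?thesis by (simp add: f'_def)
  qed
  have summ: "summable (\<lambda>k. 3 * \<eta> * (1/4) ^ k)" by (intro summable_mult summable_geometric) simp
  define g' where "g' t = (\<Sum>k. f' k t)" for t
  have ul: "uniform_limit UNIV (\<lambda>n t. \<Sum>k<n. f' k t) g' sequentially"
    unfolding g'_def by (rule Weierstrass_m_test[OF f'b summ])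
  have cf: "continuous_on UNIV (f' k)" for k
  proof -
    have ct: "continuous_on UNIV (F' k)" using E[of k] by (simp add: eased_curve_def)
    show ?thesis unfolding f'_def a_def by (intro continuous_intros continuous_on_compose2[OF ct]) auto
  qed
  have cg: "continuous_on UNIV g'"
    by (rule uniform_limit_theorem[OF always_eventually ul]) (auto intro!: continuous_on_sum cf)
  have f1: "f k t = x (Suc k) - x k" if "a k t \<ge> 1" for k t
    using that E[of k] by (simp add: f_def eased_curve_def)
  have f0: "f k t = 0" if "a k t \<le> 0" for k t
    using that E[of k] by (simp add: f_def eased_curve_def)
  have s1: "(\<lambda>k. f k t) sums (z - x 0)" if "t \<ge> 1" for t
  proof -
    have "a k t \<ge> 1" for k using that by (simp add: a_def)
    then have "f k t = x (Suc k) - x k" for k by (rule f1)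
    then show ?thesis using telescope_sums[OF lim] by simp
  qed
  have "\<exists>g. \<forall>t\<in>UNIV. (\<lambda>n. f n t) sums (g t) \<and> (g has_derivative (\<lambda>h. h *\<^sub>R g' t)) (at t within UNIV)"
  proof (rule has_derivative_series[where f' = "\<lambda>n t h. h *\<^sub>R f' n t" and x = 1 and l = "z - x 0"])
    show "(f n has_derivative (\<lambda>h. h *\<^sub>R f' n t)) (at t within UNIV)" for n t
      using fd[of n t] by (simp add: has_vector_derivative_def)
    fix e :: real assume "e > 0"
    then have "\<forall>\<^sub>F n in sequentially. \<forall>t\<in>UNIV. dist (\<Sum>k<n. f' k t) (g' t) < e"
      using ul by (auto simp: uniform_limit_iff)
    then show "\<forall>\<^sub>F n in sequentially. \<forall>t\<in>UNIV. \<forall>h. norm ((\<Sum>i<n. h *\<^sub>R f' i t) - h *\<^sub>R g' t) \<le> e * norm h"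
    proof (rule eventually_mono, safe)
      fix n t and h :: real assume "\<forall>t\<in>UNIV. dist (\<Sum>k<n. f' k t) (g' t) < e"
      then have "norm ((\<Sum>k<n. f' k t) - g' t) \<le> e" by (auto simp: dist_norm less_imp_le)
      then have "norm h * norm ((\<Sum>k<n. f' k t) - g' t) \<le> norm h * e" by (intro mult_left_mono) auto
      then show "norm ((\<Sum>i<n. h *\<^sub>R f' i t) - h *\<^sub>R g' t) \<le> e * norm h"
        by (simp add: scaleR_sum_right[symmetric] scaleR_diff_right[symmetric] mult.commute)
    qed
  qed (use s1[of 1] in auto)
  then obtain g where g: "\<And>t. (\<lambda>n. f n t) sums (g t)" "\<And>t. (g has_vector_derivative g' t) (at t)"
    by (auto simp: has_vector_derivative_def)
  define \<Xi> where "\<Xi> t = x 0 + g t" for t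
  have \<Xi>d: "(\<Xi> has_vector_derivative g' t) (at t)" for t
    using has_vector_derivative_add[OF has_vector_derivative_const[of "x 0"] g(2)[of t]] by (simp add: \<Xi>_def[abs_def])
  have \<Xi>1: "\<Xi> t = z" if "t \<ge> 1" for t using sums_unique2[OF g(1) s1[OF that]] by (simp add: \<Xi>_def)
  have \<Xi>n: "\<Xi> t = F n (a n t)" if n: "a n t < 1" "\<And>k. k < n \<Longrightarrow> a k t \<ge> 1" for n t
  proof -
    have late: "a (Suc n + j) t \<le> 0" for j
    proof -
      have "t - 1 \<le> 0" using n(1) by (simp add: a_def) (smt (verit) mult_nonneg_nonneg zero_le_power)
      then have "2 ^ j * (2 ^ Suc (Suc n) * (t - 1)) \<le> 1 * (2 ^ Suc (Suc n) * (t - 1))"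
        by (intro mult_right_mono_neg) (auto simp: mult_nonneg_nonpos)
      moreover have "2 ^ Suc (Suc n) * (t - 1) + 2 \<le> 0" using n(1) by (simp add: a_def)
      ultimately show ?thesis by (simp add: a_def power_add mult_ac)
    qed
    have "f k t = 0" if "k \<notin> {..n}" for k
      using f0 late[of "k - Suc n"] that by auto
    then have "(\<lambda>k. f k t) sums (\<Sum>k\<le>n. f k t)" by (intro sums_finite) auto
    then have "g t = (\<Sum>k\<le>n. f k t)" using g(1) sums_unique2 by blast
    also have "\<dots> = (\<Sum>k<n. f k t) + f n t" by (simp add: lessThan_Suc_atMost[symmetric])
    also have "(\<Sum>k<n. f k t) = (\<Sum>k<n. x (Suc k) - x k)" using n(2) f1 by (intro sum.cong) auto
    also have "\<dots> = x n - x 0" by (rule sum_lessThan_telescope)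
    finally show ?thesis by (simp add: \<Xi>_def f_def)
  qed
  have im: "\<Xi> t \<in> closure \<Omega>" for t
  proof (cases "t \<ge> 1")
    case True then show ?thesis using \<Xi>1 z by simp
  next
    case False
    have "\<exists>n. a n t < 1"
    proof -
      obtain n where "1 / (1 - t) < real n" using reals_Archimedean2 by blast
      also have "real n < 2 ^ n" by (rule of_nat_less_two_power)
      also have "(2::real) ^ n \<le> 2 ^ Suc n" by simp
      finally have "1 < 2 ^ Suc n * (1 - t)" using False by (simp add: field_simps)
      then have "a n t < 1" by (simp add: a_def algebra_simps)
      then show ?thesis ..
    qed
    then have "a (LEAST n. a n t < 1) t < 1" by (rule LeastI_ex)
    moreover have "a k t \<ge> 1" if "k < (LEAST n. a n t < 1)" for k using not_less_Least[OF that] by simp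
    ultimately have "\<Xi> t = F (LEAST n. a n t < 1) (a (LEAST n. a n t < 1) t)" by (rule \<Xi>n)
    moreover have "range (F k) \<subseteq> closure \<Omega>" for k using E[of k] by (simp add: eased_curve_def)
    ultimately show ?thesis by (metis rangeI subsetD)
  qed
  have "\<Xi> 0 = x 0" using \<Xi>n[of 0 0] E[of 0] by (simp add: a_def eased_curve_def)
  then have C: "(\<Xi>, g') \<in> C1_curves (closure \<Omega>) (x 0) z"
    using \<Xi>d im \<Xi>1[of 1] cg by (auto simp: C1_curves_def intro: has_vector_derivative_at_within continuous_on_subset)
  show ?thesis
  proof (rule geo_dist_le_curve[OF C])
    fix t
    have "norm (g' t) \<le> (\<Sum>k. 3 * \<eta> * (1/4) ^ k)"
      unfolding g'_def by (rule norm_suminf_le[OF f'b summ])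
    also have "\<dots> = 4 * \<eta>" by (simp add: suminf_mult suminf_geometric summable_geometric)
    finally show "norm (g' t) \<le> 4 * \<eta>" .
  next
    show "((\<lambda>t::real. 4 * \<eta>) has_integral 4 * \<eta>) {0..1}" using has_integral_const_real[of "4*\<eta>" 0 1] by simp
  qed
qed

text \<open>All that is used of the geodesic distance: it is a length metric on a compact set, above the Euclidean
  distance, and at small scales at most slightly longer. The factor \<open>103/100\<close> is any number close enough to
  \<open>1\<close> for the argument with overlapping windows below. In \<open>path\<close>, \<open>l\<close> is the arc length along \<open>\<gamma>\<close>.\<close>

locale length_domain =
  fixes X :: "'a::euclidean_space set" and d :: "'a \<Rightarrow> 'a \<Rightarrow> real" and r0 :: real
  assumes compact: "compact X"
    and norm_le_d: "x \<in> X \<Longrightarrow> y \<in> X \<Longrightarrow> norm (x - y) \<le> d x y"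
    and d_refl [simp]: "x \<in> X \<Longrightarrow> d x x = 0"
    and d_sym: "d x y = d y x"
    and d_triangle: "x \<in> X \<Longrightarrow> y \<in> X \<Longrightarrow> z \<in> X \<Longrightarrow> d x z \<le> d x y + d y z"
    and path: "x \<in> X \<Longrightarrow> y \<in> X \<Longrightarrow> d x y < c \<Longrightarrow> \<exists>\<gamma> l. continuous_on {0..1} \<gamma> \<and> \<gamma> 0 = x \<and> \<gamma> 1 = y \<and>
       \<gamma> ` {0..1} \<subseteq> X \<and> continuous_on {0..1} l \<and> l 0 = 0 \<and> l 1 < c \<and>
       (\<forall>s t. 0 \<le> s \<and> s \<le> t \<and> t \<le> 1 \<longrightarrow> d (\<gamma> s) (\<gamma> t) \<le> l t - l (s::real))"
    and r0: "r0 > 0"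
    and local_d: "x \<in> X \<Longrightarrow> y \<in> X \<Longrightarrow> norm (x - y) \<le> r0 \<Longrightarrow> d x y \<le> 103/100 * norm (x - y)"

definition real_geo_dist :: "'a::euclidean_space set \<Rightarrow> 'a \<Rightarrow> 'a \<Rightarrow> real" where
  "real_geo_dist \<Omega> x y = enn2real (geo_dist \<Omega> x y)"

text \<open>Points of \<open>\<Omega>\<close> tending to \<open>z\<close> at a geometric rate are joined successively by short curves.\<close>

lemma closure_approach:
  fixes \<Omega> :: "'a::euclidean_space set"
  assumes r: "r > 0" and loc: "\<And>x y. x \<in> \<Omega> \<Longrightarrow> y \<in> \<Omega> \<Longrightarrow> norm (x - y) \<le> r \<Longrightarrow> geo_dist \<Omega> x y \<le> ennreal (103/100 * norm (x - y))"
    and z: "z \<in> closure \<Omega>" and e: "e > 0"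
  obtains x where "x \<in> \<Omega>" "norm (x - z) \<le> e" "geo_dist \<Omega> x z \<le> ennreal e"
proof -
  define \<theta> where "\<theta> = min e r / 10"
  have \<theta>: "\<theta> > 0" "\<theta> \<le> e / 10" "\<theta> \<le> r / 10" using r e by (auto simp: \<theta>_def)
  have "\<exists>x\<in>\<Omega>. norm (x - z) < \<theta> / 8 ^ k" for k :: nat
    using z \<theta>(1) by (metis closure_approachable dist_norm divide_pos_pos zero_less_numeral zero_less_power)
  then obtain x where x: "\<And>k. x k \<in> \<Omega>" "\<And>k. norm (x k - z) < \<theta> / 8 ^ k" by metis
  have le1: "\<theta> / 8 ^ k \<le> \<theta>" for k :: nat using \<theta>(1) by (simp add: field_simps)
  have "(\<lambda>k. \<theta> / 8 ^ k) \<longlonglongrightarrow> 0" by real_asymp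
  then have "(\<lambda>k. x k - z) \<longlonglongrightarrow> 0"
    by (rule Lim_null_comparison[rotated]) (use x(2) in \<open>auto intro!: always_eventually less_imp_le\<close>)
  then have lim: "x \<longlonglongrightarrow> z" by (simp add: LIM_zero_iff)
  have "geo_dist \<Omega> (x k) (x (Suc k)) < ennreal (5/2 * \<theta> / 8 ^ k)" for k
  proof -
    have "norm (x k - x (Suc k)) \<le> norm (x k - z) + norm (x (Suc k) - z)"
      by (metis norm_triangle_ineq4 diff_diff_eq2 diff_add_cancel)
    also have "\<dots> < \<theta> / 8 ^ k + \<theta> / 8 ^ Suc k" using x(2)[of k] x(2)[of "Suc k"] by linarith
    finally have 1: "norm (x k - x (Suc k)) < 9/8 * (\<theta> / 8 ^ k)" by simp
    have "geo_dist \<Omega> (x k) (x (Suc k)) \<le> ennreal (103/100 * norm (x k - x (Suc k)))"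
      using x 1 le1[of k] \<theta> by (intro loc) auto
    also have "\<dots> < ennreal (5/2 * \<theta> / 8 ^ k)"
    proof (rule ennreal_lessI)
      have "\<theta> / 8 ^ k > 0" using \<theta> by simp
      then show "103/100 * norm (x k - x (Suc k)) < 5/2 * \<theta> / 8 ^ k" using 1 by simp
      show "0 < 5/2 * \<theta> / 8 ^ k" using \<theta> by simp
    qed
    finally show ?thesis .
  qed
  then have "geo_dist \<Omega> (x 0) z \<le> ennreal (4 * (5/2 * \<theta>))"
    using geo_dist_limit[OF lim z, of "5/2 * \<theta>"] \<theta> by simp
  also have "\<dots> \<le> ennreal e" using \<theta> by (intro ennreal_leI) simp
  finally show thesis using that[of "x 0"] x(1)[of 0] x(2)[of 0] \<theta> by simp
qed

lemma geo_dist_local_closure: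
  fixes \<Omega> :: "'a::euclidean_space set"
  assumes r: "r > 0" and loc: "\<And>x y. x \<in> \<Omega> \<Longrightarrow> y \<in> \<Omega> \<Longrightarrow> norm (x - y) \<le> r \<Longrightarrow> geo_dist \<Omega> x y \<le> ennreal (103/100 * norm (x - y))"
    and xy: "x \<in> closure \<Omega>" "y \<in> closure \<Omega>" "norm (x - y) \<le> r / 2"
  shows "geo_dist \<Omega> x y \<le> ennreal (103/100 * norm (x - y))"
proof (rule ennreal_le_epsilon)
  fix e :: real assume e: "e > 0"
  define e' where "e' = min (e / 5) (r / 4)"
  have e': "e' > 0" "e' \<le> e / 5" "e' \<le> r / 4" using e r by (auto simp: e'_def)
  obtain x' where x': "x' \<in> \<Omega>" "norm (x' - x) \<le> e'" "geo_dist \<Omega> x' x \<le> ennreal e'"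
    using closure_approach[OF r loc xy(1) e'(1)] by blast
  obtain y' where y': "y' \<in> \<Omega>" "norm (y' - y) \<le> e'" "geo_dist \<Omega> y' y \<le> ennreal e'"
    using closure_approach[OF r loc xy(2) e'(1)] by blast
  have "norm (x' - y') \<le> norm (x - y) + (norm (x' - x) + norm (y' - y))"
    by norm
  then have n: "norm (x' - y') \<le> norm (x - y) + 2 * e'" using x' y' by linarith
  have "geo_dist \<Omega> x y \<le> geo_dist \<Omega> x x' + (geo_dist \<Omega> x' y' + geo_dist \<Omega> y' y)"
    by (meson geo_dist_triangle add_left_mono order_trans)
  also have "\<dots> \<le> ennreal e' + (ennreal (103/100 * norm (x' - y')) + ennreal e')"
    using x' y' n e' xy(3) by (intro add_mono loc) (auto simp: geo_dist_sym[of \<Omega> x x'])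
  also have "\<dots> = ennreal (e' + (103/100 * norm (x' - y') + e'))"
    using e' by (simp add: ennreal_plus[symmetric] del: ennreal_plus)
  also have "\<dots> \<le> ennreal (103/100 * norm (x - y) + e)"
    using n e' by (intro ennreal_leI) simp
  also have "\<dots> = ennreal (103/100 * norm (x - y)) + ennreal e" using e by (simp add: ennreal_plus)
  finally show "geo_dist \<Omega> x y \<le> ennreal (103/100 * norm (x - y)) + ennreal e" .
qed

lemma domain_assumption_local:
  assumes "domain_assumption \<Omega> \<phi> r"
  obtains r1 where "r1 > 0" "\<And>x y. x \<in> \<Omega> \<Longrightarrow> y \<in> \<Omega> \<Longrightarrow> norm (x - y) \<le> r1 \<Longrightarrow> geo_dist \<Omega> x y \<le> ennreal (103/100 * norm (x - y))"
proof -
  have r: "r > 0" and lim: "((\<lambda>s. \<phi> s / s) \<longlongrightarrow> 0) (at_right 0)"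
    and D: "\<And>x y. x \<in> \<Omega> \<Longrightarrow> y \<in> \<Omega> \<Longrightarrow> norm (x - y) \<le> r \<Longrightarrow> geo_dist \<Omega> x y \<le> ennreal (norm (x - y) + \<phi> (norm (x - y)))"
    using assms by (auto simp: domain_assumption_def)
  have "\<forall>\<^sub>F s in at_right 0. \<phi> s / s < 3/100" using lim by (rule order_tendstoD) simp
  then obtain b where b: "b > 0" "\<And>s. 0 < s \<Longrightarrow> s < b \<Longrightarrow> \<phi> s / s < 3/100"
    unfolding eventually_at_right_field by auto
  show thesis
  proof (rule that[of "min r (b/2)"])
    show "0 < min r (b/2)" using r b by simp
    fix x y assume xy: "x \<in> \<Omega>" "y \<in> \<Omega>" "norm (x - y) \<le> min r (b/2)"
    show "geo_dist \<Omega> x y \<le> ennreal (103/100 * norm (x - y))"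
    proof (cases "x = y")
      case True
      have "x \<in> closure \<Omega>" using xy closure_subset by blast
      then show ?thesis using geo_dist_segment[of x x \<Omega>] True by simp
    next
      case False
      then have "\<phi> (norm (x - y)) / norm (x - y) < 3/100" using b xy by (intro b(2)) auto
      then have "\<phi> (norm (x - y)) \<le> 3/100 * norm (x - y)" using False by (simp add: field_simps)
      then have "ennreal (norm (x - y) + \<phi> (norm (x - y))) \<le> ennreal (103/100 * norm (x - y))" by (intro ennreal_leI) simp
      then show ?thesis using D[of x y] xy by (meson min.boundedE order_trans)
    qed
  qed
qed

text \<open>Finiteness of the distance spreads from a point to its neighbourhood in either direction, so it holds on the
  connected set \<open>closure \<Omega>\<close>.\<close>

lemma domain_length_domain:
  fixes \<Omega> :: "'a::euclidean_space set"
  assumes dom: "domain_assumption \<Omega> \<phi> r" and "bounded \<Omega>" "connected \<Omega>"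
  obtains r0 where "length_domain (closure \<Omega>) (real_geo_dist \<Omega>) r0"
    "\<And>x y. x \<in> closure \<Omega> \<Longrightarrow> y \<in> closure \<Omega> \<Longrightarrow> geo_dist \<Omega> x y = ennreal (real_geo_dist \<Omega> x y)"
proof -
  obtain r1 where r1: "r1 > 0" "\<And>x y. x \<in> \<Omega> \<Longrightarrow> y \<in> \<Omega> \<Longrightarrow> norm (x - y) \<le> r1 \<Longrightarrow> geo_dist \<Omega> x y \<le> ennreal (103/100 * norm (x - y))"
    using domain_assumption_local[OF dom] by blast
  have loc: "geo_dist \<Omega> x y \<le> ennreal (103/100 * norm (x - y))"
    if "x \<in> closure \<Omega>" "y \<in> closure \<Omega>" "norm (x - y) \<le> r1/2" for x y
    using geo_dist_local_closure[OF r1 that] .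
  have fin: "geo_dist \<Omega> x y < \<infinity>" if xy: "x \<in> closure \<Omega>" "y \<in> closure \<Omega>" for x y
  proof (rule connected_induction_simple[where S = "closure \<Omega>" and P = "\<lambda>y. geo_dist \<Omega> x y < \<infinity>" and a = x and b = y])
    show "connected (closure \<Omega>)" using assms by (simp add: connected_imp_connected_closure)
    show "geo_dist \<Omega> x x < \<infinity>" using loc[OF xy(1) xy(1)] r1 by simp
    fix a assume a: "a \<in> closure \<Omega>"
    define T where "T = closure \<Omega> \<inter> ball a (r1/4)"
    have "geo_dist \<Omega> x w < \<infinity>" if "z \<in> T" "w \<in> T" "geo_dist \<Omega> x z < \<infinity>" for z w
    proof -
      have "norm (z - w) \<le> norm (a - z) + norm (a - w)" by norm
      then have "norm (z - w) \<le> r1/2" using that by (auto simp: T_def dist_norm)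
      then have "geo_dist \<Omega> z w \<le> ennreal (103/100 * norm (z - w))" using that by (intro loc) (auto simp: T_def)
      also have "\<dots> < \<infinity>" by simp
      finally have "geo_dist \<Omega> x z + geo_dist \<Omega> z w < \<infinity>" using that by simp
      then show ?thesis using geo_dist_triangle order_le_less_trans by metis
    qed
    moreover have "openin (top_of_set (closure \<Omega>)) T" "a \<in> T" using a r1 by (auto simp: T_def)
    ultimately show "\<exists>T. openin (top_of_set (closure \<Omega>)) T \<and> a \<in> T \<and>
      (\<forall>x'\<in>T. \<forall>y\<in>T. geo_dist \<Omega> x x' < \<infinity> \<longrightarrow> geo_dist \<Omega> x y < \<infinity>)" by blast
  qed (use xy in auto)
  have eq: "geo_dist \<Omega> x y = ennreal (real_geo_dist \<Omega> x y)" if "x \<in> closure \<Omega>" "y \<in> closure \<Omega>" for x y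
    using fin[OF that] by (simp add: real_geo_dist_def)
  have nn: "0 \<le> real_geo_dist \<Omega> x y" for x y by (simp add: real_geo_dist_def)
  have le: "real_geo_dist \<Omega> x y \<le> c" if "x \<in> closure \<Omega>" "y \<in> closure \<Omega>" "geo_dist \<Omega> x y \<le> ennreal c" "0 \<le> c" for x y c
    using that eq[OF that(1,2)] by simp
  have "length_domain (closure \<Omega>) (real_geo_dist \<Omega>) (r1/2)"
  proof
    show "compact (closure \<Omega>)" using assms by (simp add: compact_eq_bounded_closed bounded_closure)
    show "norm (x - y) \<le> real_geo_dist \<Omega> x y" if "x \<in> closure \<Omega>" "y \<in> closure \<Omega>" for x y
      using geo_dist_ge_norm[of x y \<Omega>] eq[OF that] nn by simp
    show "real_geo_dist \<Omega> x x = 0" if "x \<in> closure \<Omega>" for x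
      using le[OF that that, of 0] loc[OF that that] r1 nn[of x x] by simp
    show "real_geo_dist \<Omega> x y = real_geo_dist \<Omega> y x" for x y unfolding real_geo_dist_def using geo_dist_sym by metis
    show "real_geo_dist \<Omega> x z \<le> real_geo_dist \<Omega> x y + real_geo_dist \<Omega> y z" if "x \<in> closure \<Omega>" "y \<in> closure \<Omega>" "z \<in> closure \<Omega>" for x y z
      using geo_dist_triangle[of \<Omega> x z y] that nn by (intro le) (auto simp: eq)
    show "r1/2 > 0" using r1 by simp
    show "real_geo_dist \<Omega> x y \<le> 103/100 * norm (x - y)" if "x \<in> closure \<Omega>" "y \<in> closure \<Omega>" "norm (x - y) \<le> r1/2" for x y
      using loc[OF that] that by (intro le) auto
    fix x y c assume xy: "x \<in> closure \<Omega>" "y \<in> closure \<Omega>" and c: "real_geo_dist \<Omega> x y < c"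
    have lt: "geo_dist \<Omega> x y < ennreal c" using c nn[of x y] eq[OF xy] by (simp add: ennreal_less_iff)
    obtain \<gamma> l where p: "continuous_on {0..1} \<gamma>" "\<gamma> 0 = x" "\<gamma> 1 = y" "\<gamma> ` {0..1} \<subseteq> closure \<Omega>"
      "continuous_on {0..1} l" "l 0 = 0" "l 1 < c"
      and sub: "\<And>s t :: real. 0 \<le> s \<Longrightarrow> s \<le> t \<Longrightarrow> t \<le> 1 \<Longrightarrow> geo_dist \<Omega> (\<gamma> s) (\<gamma> t) \<le> ennreal (l t - l s) \<and> l s \<le> l t"
      by (rule geo_dist_path[OF lt]) blast
    have "real_geo_dist \<Omega> (\<gamma> s) (\<gamma> t) \<le> l t - l s" if "0 \<le> s" "s \<le> t" "t \<le> 1" for s t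
      using sub[OF that] that p(4) by (intro le) (auto simp: image_subset_iff)
    then show "\<exists>\<gamma> l. continuous_on {0..1} \<gamma> \<and> \<gamma> 0 = x \<and> \<gamma> 1 = y \<and> \<gamma> ` {0..1} \<subseteq> closure \<Omega> \<and>
       continuous_on {0..1} l \<and> l 0 = 0 \<and> l 1 < c \<and>
       (\<forall>s t. 0 \<le> s \<and> s \<le> t \<and> t \<le> 1 \<longrightarrow> real_geo_dist \<Omega> (\<gamma> s) (\<gamma> t) \<le> l t - l (s::real))"
      using p by blast
  qed
  then show thesis using that eq by blast
qed

lemma (in length_domain) topology_eq:
  assumes "closure \<Omega> = X" "\<And>x y. enn2real (geo_dist \<Omega> x y) = d x y"
  shows "geo_topology \<Omega> = top_of_set X"
proof -
  have zero: "x = y" if "x \<in> X" "y \<in> X" "d x y = 0" for x y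
    using norm_le_d[OF that(1,2)] that(3) by simp
  have nn: "0 \<le> d x y" for x y using assms(2)[of x y] enn2real_nonneg by metis
  interpret M: Metric_space X d
    by unfold_locales (use nn d_sym zero d_triangle in auto)
  have "openin M.mtopology U \<longleftrightarrow> openin (top_of_set X) U" for U
    unfolding M.openin_mtopology openin_euclidean_subtopology_iff
  proof (intro iffI conjI; elim conjE; safe?)
    fix x assume H: "U \<subseteq> X" "\<forall>x. x \<in> U \<longrightarrow> (\<exists>r>0. M.mball x r \<subseteq> U)" and x: "x \<in> U"
    then obtain e where e: "e > 0" "M.mball x e \<subseteq> U" by blast
    have "y \<in> U" if "y \<in> X" "dist y x < min r0 (e/2)" for y
    proof -
      have "d x y \<le> 103/100 * norm (x - y)" using that H x by (intro local_d) (auto simp: dist_norm norm_minus_commute)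
      also have "\<dots> < e" using that e by (auto simp: dist_norm norm_minus_commute)
      finally have "y \<in> M.mball x e" using that H x by auto
      then show ?thesis using e(2) by blast
    qed
    then show "\<exists>e>0. \<forall>x'\<in>X. dist x' x < e \<longrightarrow> x' \<in> U" using e r0 by (intro exI[of _ "min r0 (e/2)"]) auto
  next
    fix x assume H: "U \<subseteq> X" "\<forall>x\<in>U. \<exists>e>0. \<forall>x'\<in>X. dist x' x < e \<longrightarrow> x' \<in> U" and x: "x \<in> U"
    then obtain e where e: "e > 0" "\<And>x'. x' \<in> X \<Longrightarrow> dist x' x < e \<Longrightarrow> x' \<in> U" by blast
    have "M.mball x e \<subseteq> U"
    proof
      fix y assume y: "y \<in> M.mball x e"
      then have "y \<in> X" "x \<in> X" "d x y < e" by (auto simp: M.in_mball)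
      then show "y \<in> U" using norm_le_d[of x y] by (intro e) (auto simp: dist_norm norm_minus_commute)
    qed
    then show "\<exists>r>0. M.mball x r \<subseteq> U" using e by blast
  qed
  then have "M.mtopology = top_of_set X" by (simp add: topology_eq)
  then show ?thesis unfolding geo_topology_def assms by simp
qed

section \<open>Comparison with cones for absolute minimizers\<close>

context length_domain
begin

lemma d_nonneg: "x \<in> X \<Longrightarrow> y \<in> X \<Longrightarrow> 0 \<le> d x y"
  using norm_le_d[of x y] norm_ge_zero[of "x - y"] by linarith

lemma d_diff_le: "x \<in> X \<Longrightarrow> y \<in> X \<Longrightarrow> z \<in> X \<Longrightarrow> \<bar>d x y - d x z\<bar> \<le> d y z"
  using d_triangle[of x y z] d_triangle[of x z y] d_sym[of y z] by linarith

lemma continuous_d: assumes x: "x \<in> X" shows "continuous_on X (d x)"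
  unfolding continuous_on_iff
proof (intro ballI allI impI)
  fix y e assume y: "y \<in> X" and e: "(0::real) < e"
  have "dist (d x z) (d x y) < e" if z: "z \<in> X" "dist z y < min r0 (e/2)" for z
  proof -
    have "norm (y - z) \<le> r0" "norm (y - z) < e/2" using z by (auto simp: dist_norm norm_minus_commute)
    then have "d y z < e" using local_d[OF y z(1)] e by linarith
    moreover have "\<bar>d x y - d x z\<bar> \<le> d y z" using d_diff_le x y z by blast
    ultimately show ?thesis by (simp add: dist_real_def abs_minus_commute)
  qed
  then show "\<exists>\<delta>>0. \<forall>z\<in>X. dist z y < \<delta> \<longrightarrow> dist (d x z) (d x y) < e"
    using e r0 by (intro exI[of _ "min r0 (e/2)"]) auto
qed

lemma compact_ball: "x \<in> X \<Longrightarrow> compact {y\<in>X. d x y \<le> r}"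
  using continuous_closed_preimage[OF continuous_d compact_imp_closed[OF compact], of x "{..r}"]
  by (intro compact_Int_closed[OF compact, of "{y\<in>X. d x y \<le> r}", THEN back_subst[of compact]])
     (auto simp: vimage_def Int_def conj_commute)

lemma openin_ball: "x \<in> X \<Longrightarrow> openin (top_of_set X) {y\<in>X. d x y < r}"
  using continuous_openin_preimage_gen[OF continuous_d, of x "{..<r}"]
  by (auto simp: vimage_def Int_def)

lemma split_less:
  assumes xz: "x \<in> X" "z \<in> X" and less: "d x z < a + b" and ab: "a > 0" "b > 0"
  obtains y where "y \<in> X" "d x y < a" "d y z < b"
proof -
  obtain \<gamma> l where p: "\<gamma> 0 = x" "\<gamma> 1 = z" "\<gamma> ` {0..1} \<subseteq> X" "continuous_on {0..1} l" "l 0 = 0" "l 1 < a + b"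
    and sub: "\<And>s t. 0 \<le> s \<Longrightarrow> s \<le> t \<Longrightarrow> t \<le> 1 \<Longrightarrow> d (\<gamma> s) (\<gamma> t) \<le> l t - l (s::real)"
    using path[OF xz less] by blast
  have l1: "0 \<le> l 1" using sub[of 0 1] d_nonneg[OF xz] p by simp
  define c where "c = a * l 1 / (a + b)"
  have c: "0 \<le> c" "c \<le> l 1" using l1 ab by (auto simp: c_def field_simps)
  obtain t where t: "0 \<le> t" "t \<le> 1" "l t = c"
    using IVT'[of l 0 c 1] c p by auto
  have "d x (\<gamma> t) \<le> c" "d (\<gamma> t) z \<le> l 1 - c" using sub[of 0 t] sub[of t 1] t p by auto
  moreover have "c < a" "l 1 - c < b"
  proof -
    have "a * l 1 < a * (a + b)" "b * l 1 < b * (a + b)" using ab p by simp_all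
    then show "c < a" "l 1 - c < b" using ab by (auto simp: c_def field_simps)
  qed
  moreover have "\<gamma> t \<in> X" using p t by auto
  ultimately show thesis using that[of "\<gamma> t"] by linarith
qed

text \<open>Geodesics exist by compactness; only their points at a given distance from the ends are needed.\<close>

lemma between:
  assumes xz: "x \<in> X" "z \<in> X" and le: "d x z \<le> a + b" and ab: "a \<ge> 0" "b \<ge> 0"
  obtains y where "y \<in> X" "d x y \<le> a" "d y z \<le> b"
proof -
  define e where "e n = inverse (real (Suc n))" for n
  have e: "e n > 0" for n by (simp add: e_def)
  have "\<exists>y. y \<in> X \<and> d x y < a + e n \<and> d z y < b + e n" for n
  proof -
    have "d x z < (a + e n) + (b + e n)" "a + e n > 0" "b + e n > 0" using le ab e[of n] by linarith+
    then obtain y where "y \<in> X" "d x y < a + e n" "d y z < b + e n" by (rule split_less[OF xz])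
    then show ?thesis using d_sym[of z y] by auto
  qed
  then obtain y where y: "\<And>n. y n \<in> X" "\<And>n. d x (y n) < a + e n" "\<And>n. d z (y n) < b + e n" by metis
  obtain p r where p: "p \<in> X" "strict_mono r" "(y \<circ> r) \<longlonglongrightarrow> p"
    using compact y(1) unfolding compact_def by metis
  have e0: "(\<lambda>n. e (r n)) \<longlonglongrightarrow> 0"
    using LIMSEQ_subseq_LIMSEQ[OF LIMSEQ_inverse_real_of_nat p(2)] by (simp add: e_def o_def)
  have lim: "(\<lambda>n. d w (y (r n))) \<longlonglongrightarrow> d w p" if "w \<in> X" for w
    using continuous_on_tendsto_compose[OF continuous_d[OF that] p(3) p(1)] y(1) by (simp add: o_def)
  have "d x p \<le> a + 0"
    by (rule LIMSEQ_le[OF lim[OF xz(1)] tendsto_add[OF tendsto_const e0]]) (use y(2) less_imp_le in blast)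
  moreover have "d z p \<le> b + 0"
    by (rule LIMSEQ_le[OF lim[OF xz(2)] tendsto_add[OF tendsto_const e0]]) (use y(3) less_imp_le in blast)
  ultimately show thesis using that[of p] p d_sym[of z p] by simp
qed

lemma diameter_bound: obtains D where "D > 0" "\<And>x y. x \<in> X \<Longrightarrow> y \<in> X \<Longrightarrow> d x y \<le> D"
proof (cases "X = {}")
  case True then show thesis using that[of 1] by auto
next
  case False
  then obtain x where x: "x \<in> X" by blast
  have "bounded (d x ` X)" using compact_imp_bounded[OF compact_continuous_image[OF continuous_d[OF x] compact]] .
  then obtain B where B: "\<And>y. y \<in> X \<Longrightarrow> \<bar>d x y\<bar> \<le> B" unfolding bounded_iff by auto
  have B0: "B \<ge> 0" using B[OF x] by simp
  show thesis
  proof (rule that[of "2 * B + 1"])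
    fix y z assume yz: "y \<in> X" "z \<in> X"
    show "d y z \<le> 2 * B + 1"
      using d_triangle[OF yz(1) x yz(2)] B[OF yz(1)] B[OF yz(2)] d_sym[of x y] by linarith
  qed (use B0 in simp)
qed

lemma d_le_norm: obtains A where "A \<ge> 1" "\<And>x y. x \<in> X \<Longrightarrow> y \<in> X \<Longrightarrow> d x y \<le> A * norm (x - y)"
proof -
  obtain D where D: "D > 0" "\<And>x y. x \<in> X \<Longrightarrow> y \<in> X \<Longrightarrow> d x y \<le> D" using diameter_bound by blast
  define A where "A = 103/100 + D / r0"
  have A: "A \<ge> 103/100" "A \<ge> D / r0" using D r0 by (auto simp: A_def)
  show thesis
  proof (rule that[of A])
    fix x y assume xy: "x \<in> X" "y \<in> X"
    show "d x y \<le> A * norm (x - y)"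
    proof (cases "norm (x - y) \<le> r0")
      case True
      have "103/100 * norm (x - y) \<le> A * norm (x - y)" using A by (intro mult_right_mono) auto
      then show ?thesis using local_d[OF xy True] by linarith
    next
      case False
      have "d x y \<le> D / r0 * r0" using D xy r0 by simp
      also have "\<dots> \<le> A * norm (x - y)" using A False r0 D by (intro mult_mono) auto
      finally show ?thesis .
    qed
  qed (use A in simp)
qed

text \<open>Metric balls are connected, since a path of length less than the radius stays in the ball.\<close>

lemma locally_connected_X: "locally connected X"
  unfolding locally_connected
proof (intro allI impI, elim conjE)
  fix V x assume V: "openin (top_of_set X) V" and x: "x \<in> V"
  then have xX: "x \<in> X" using openin_imp_subset by blast
  obtain e where e: "e > 0" "\<And>y. y \<in> X \<Longrightarrow> dist y x < e \<Longrightarrow> y \<in> V"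
    using V x unfolding openin_euclidean_subtopology_iff by metis
  let ?B = "{y\<in>X. d x y < e}"
  have "connected ?B"
    unfolding connected_iff_connected_component
  proof -
    have "\<forall>y\<in>?B. connected_component ?B x y"
    proof
      fix y assume y: "y \<in> ?B"
      then obtain \<gamma> l where p: "continuous_on {0..1} \<gamma>" "\<gamma> 0 = x" "\<gamma> 1 = y" "\<gamma> ` {0..1} \<subseteq> X" "l 0 = 0" "l 1 < e"
        and sub: "\<And>s t. 0 \<le> s \<Longrightarrow> s \<le> t \<Longrightarrow> t \<le> 1 \<Longrightarrow> d (\<gamma> s) (\<gamma> t) \<le> l t - l (s::real)"
        using path[OF xX, of y e] by auto
      have "\<gamma> t \<in> ?B" if t: "0 \<le> t" "t \<le> 1" for t
      proof -
        have "\<gamma> t \<in> X" "\<gamma> 1 \<in> X" using p t by auto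
        then show ?thesis using sub[of 0 t] sub[of t 1] t p d_nonneg[of "\<gamma> t" "\<gamma> 1"] by auto
      qed
      then have "\<gamma> ` {0..1} \<subseteq> ?B" by auto
      moreover have "connected (\<gamma> ` {0..1})" using p connected_continuous_image connected_Icc by blast
      ultimately show "connected_component ?B x y"
        unfolding connected_component_def using p by (intro exI[of _ "\<gamma> ` {0..1}"]) force
    qed
    then show "\<forall>x\<in>?B. \<forall>y\<in>?B. connected_component ?B x y"
      by (meson connected_component_sym connected_component_trans)
  qed
  moreover have "?B \<subseteq> V"
  proof
    fix y assume y: "y \<in> ?B"
    then show "y \<in> V" using norm_le_d[OF xX, of y] by (intro e) (auto simp: dist_norm norm_minus_commute)
  qed
  moreover have "x \<in> ?B" using xX e by simp
  ultimately show "\<exists>U. openin (top_of_set X) U \<and> connected U \<and> x \<in> U \<and> U \<subseteq> V"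
    using openin_ball[OF xX] by blast
qed

lemma openin_component:
  assumes "openin (top_of_set X) W"
  shows "openin (top_of_set X) (connected_component_set W y)"
  using openin_connected_component_locally_connected[OF locally_open_subset[OF locally_connected_X assms]] assms
  by (rule openin_trans)

text \<open>The defining property of an absolute minimizer in the form of an implication between real Lipschitz bounds;
  \<open>closure V - V\<close> is the relative boundary, as \<open>V\<close> is relatively open in a closed set.\<close>

definition absmin :: "'a set \<Rightarrow> ('a \<Rightarrow> real) \<Rightarrow> bool" where
  "absmin S u \<longleftrightarrow> continuous_on X u \<and>
     (\<forall>V \<kappa>. openin (top_of_set X) V \<and> connected V \<and> V \<subseteq> X - S \<and> \<kappa> \<ge> 0 \<and>
        (\<forall>x\<in>closure V - V. \<forall>y\<in>closure V - V. \<bar>u x - u y\<bar> \<le> \<kappa> * d x y) \<longrightarrow>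
        (\<forall>x\<in>closure V. \<forall>y\<in>closure V. \<bar>u x - u y\<bar> \<le> \<kappa> * d x y))"

lemma absmin_minus: "absmin S u \<Longrightarrow> absmin S (\<lambda>x. - u x)"
  unfolding absmin_def by (auto intro: continuous_on_minus simp: abs_minus_commute)

text \<open>Suppose that \<open>u\<close> exceeds the cone at \<open>y\<close>, and let \<open>C\<close> be the component of \<open>y\<close> in the set where it does. On the
  boundary of \<open>C\<close> the two agree, so \<open>u\<close> has Lipschitz constant \<open>\<kappa>\<close> there and, by minimality, on \<open>C\<close>. A near
  geodesic from \<open>y\<close> to the vertex leaves \<open>C\<close> at a boundary point, and along it the cone falls as fast as \<open>u\<close> can:
  so \<open>u\<close> was not above the cone at \<open>y\<close>. The argument needs \<open>\<kappa> \<ge> 0\<close>, for a near geodesic leads to the vertex but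
  need not extend beyond \<open>y\<close>.\<close>

lemma cone_comparison:
  assumes u: "absmin S u" and V: "openin (top_of_set X) V" "V \<subseteq> X - S"
    and x: "x \<in> X" "x \<notin> V" and \<kappa>: "\<kappa> \<ge> 0"
    and bd: "\<And>y. y \<in> closure V - V \<Longrightarrow> u y \<le> c + \<kappa> * d x y" and y: "y \<in> V"
  shows "u y \<le> c + \<kappa> * d x y"
proof (rule ccontr)
  assume neg: "\<not> ?thesis"
  have cu: "continuous_on X u" using u by (simp add: absmin_def)
  have clX: "closure A \<subseteq> X" if "A \<subseteq> X" for A using that compact compact_imp_closed closure_minimal by blast
  define f where "f z = u z - (c + \<kappa> * d x z)" for z
  have cf: "continuous_on X f" unfolding f_def by (intro continuous_intros cu continuous_d x)
  have VX: "V \<subseteq> X" using V by auto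
  define W where "W = {z\<in>V. f z > 0}"
  have W: "openin (top_of_set X) W"
  proof -
    have "openin (top_of_set X) (X \<inter> f -` {0<..})" using cf by (intro continuous_openin_preimage_gen) auto
    moreover have "W = V \<inter> (X \<inter> f -` {0<..})" using VX by (auto simp: W_def)
    ultimately show ?thesis using V by (metis openin_Int)
  qed
  have yW: "y \<in> W" using y neg by (simp add: W_def f_def)
  define C where "C = connected_component_set W y"
  have CW: "C \<subseteq> W" "connected C" "y \<in> C" using yW by (auto simp: C_def connected_component_subset)
  have C: "openin (top_of_set X) C"
    unfolding C_def using W by (rule openin_component)
  have CX: "C \<subseteq> X" using CW VX by (auto simp: W_def)
  have fr: "f z = 0" if z: "z \<in> closure C - C" for z
  proof (rule antisym)
    have zX: "z \<in> X" using z clX[OF CX] by auto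
    have "f ` closure C \<subseteq> {0..}"
    proof (rule image_closure_subset)
      show "continuous_on (closure C) f" using cf clX[OF CX] continuous_on_subset by blast
      show "f ` C \<subseteq> {0..}" using CW by (force simp: W_def)
    qed simp
    then show "0 \<le> f z" using z by auto
    show "f z \<le> 0"
    proof (rule ccontr)
      assume fz: "\<not> f z \<le> 0"
      have "z \<in> V"
      proof (rule ccontr)
        assume "z \<notin> V"
        moreover have "z \<in> closure V" using z CW closure_mono[of C V] by (auto simp: W_def)
        ultimately show False using bd[of z] fz by (simp add: f_def)
      qed
      then have zW: "z \<in> W" using fz by (simp add: W_def)
      define E where "E = connected_component_set W z"
      have E: "openin (top_of_set X) E"
        unfolding E_def using W by (rule openin_component)
      have zE: "z \<in> E" using zW by (simp add: E_def)
      obtain T where T: "open T" "E = X \<inter> T" using E by (auto simp: openin_open)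
      have "T \<inter> C \<noteq> {}" using T z zE by (metis DiffD1 IntD2 closure_iff_nhds_not_empty disjoint_iff subset_refl open_Int_closure_eq_empty)
      then have "E \<inter> C \<noteq> {}" using T CX by auto
      then have "E = C" unfolding E_def C_def by (metis connected_component_nonoverlap)
      then show False using zE z by auto
    qed
  qed
  have eq: "u z = c + \<kappa> * d x z" if "z \<in> closure C - C" for z using fr[OF that] by (simp add: f_def)
  have lip: "\<bar>u z - u w\<bar> \<le> \<kappa> * d z w" if zw: "z \<in> closure C" "w \<in> closure C" for z w
  proof -
    have "\<bar>u z - u w\<bar> \<le> \<kappa> * d z w" if zw: "z \<in> closure C - C" "w \<in> closure C - C" for z w
    proof -
      have "\<bar>d x z - d x w\<bar> \<le> d z w" using d_diff_le x zw clX[OF CX] by blast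
      then have "\<kappa> * \<bar>d x z - d x w\<bar> \<le> \<kappa> * d z w" using \<kappa> by (intro mult_left_mono)
      moreover have "u z - u w = \<kappa> * (d x z - d x w)" using eq[OF zw(1)] eq[OF zw(2)] by (simp add: algebra_simps)
      ultimately show ?thesis using \<kappa> by (simp add: abs_mult)
    qed
    moreover have "C \<subseteq> X - S" using CW V by (auto simp: W_def)
    ultimately show ?thesis using u C CW(2) \<kappa> zw unfolding absmin_def by blast
  qed
  have yX: "y \<in> X" using y VX by auto
  have "f y \<le> \<kappa> * \<tau>" if \<tau>: "\<tau> > 0" for \<tau>
  proof -
    obtain \<gamma> l where p: "continuous_on {0..1} \<gamma>" "\<gamma> 0 = y" "\<gamma> 1 = x" "\<gamma> ` {0..1} \<subseteq> X" "l 0 = 0" "l 1 < d y x + \<tau>"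
      and sub: "\<And>s t. 0 \<le> s \<Longrightarrow> s \<le> t \<Longrightarrow> t \<le> 1 \<Longrightarrow> d (\<gamma> s) (\<gamma> t) \<le> l t - l (s::real)"
      using path[OF yX x(1), of "d y x + \<tau>"] \<tau> by auto
    have conn: "connected (\<gamma> ` {0..1})" using p connected_continuous_image connected_Icc by blast
    have "\<exists>t\<in>{0..1}. \<gamma> t \<in> closure C - C"
    proof (rule ccontr)
      assume no: "\<not> ?thesis"
      obtain T where T: "open T" "C = X \<inter> T" using C by (auto simp: openin_open)
      have "T \<inter> \<gamma> ` {0..1} = {} \<or> (- closure C) \<inter> \<gamma> ` {0..1} = {}"
      proof (rule connectedD[OF conn T(1)])
        show "open (- closure C)" by (intro open_Compl closed_closure)
        show "T \<inter> (- closure C) \<inter> \<gamma> ` {0..1} = {}" using T p(4) closure_subset[of C] by auto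
        show "\<gamma> ` {0..1} \<subseteq> T \<union> (- closure C)" using no T by auto
      qed
      moreover have "y \<in> T \<inter> \<gamma> ` {0..1}" using CW T p(2) by force
      moreover have "x \<in> (- closure C) \<inter> \<gamma> ` {0..1}"
      proof -
        have "x = \<gamma> 1" "x \<notin> C" using p x CW by (auto simp: W_def)
        then show ?thesis using no by (metis Compl_iff DiffI IntI atLeastAtMost_iff imageI order_refl zero_le_one)
      qed
      ultimately show False by blast
    qed
    then obtain t where t: "0 \<le> t" "t \<le> 1" "\<gamma> t \<in> closure C - C" by auto
    have zX: "\<gamma> t \<in> X" using p t by auto
    have "d y (\<gamma> t) + d (\<gamma> t) x \<le> d y x + \<tau>" using sub[of 0 t] sub[of t 1] t p by auto
    then have "\<kappa> * (d y (\<gamma> t) + d x (\<gamma> t)) \<le> \<kappa> * (d x y + \<tau>)"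
      using \<kappa> by (intro mult_left_mono) (auto simp: d_sym)
    moreover have "u y - u (\<gamma> t) \<le> \<kappa> * d y (\<gamma> t)"
      using lip[of y "\<gamma> t"] t CW(3) closure_subset[of C] by force
    ultimately show ?thesis using eq[OF t(3)] by (simp add: f_def algebra_simps)
  qed
  moreover have fy: "f y > 0" using yW by (simp add: W_def)
  ultimately have "f y \<le> \<kappa> * (f y / (2 * (\<kappa> + 1)))" using \<kappa> by (smt (verit) divide_pos_pos)
  also have "\<dots> \<le> f y / 2" using \<kappa> fy by (simp add: field_simps)
  finally show False using fy by simp
qed

end

context length_domain
begin

definition ball_max :: "('a \<Rightarrow> real) \<Rightarrow> real \<Rightarrow> 'a \<Rightarrow> real" where
  "ball_max u r x = (SUP y\<in>{y\<in>X. d x y \<le> r}. u y)"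

lemma ball_max_attained:
  assumes "continuous_on X u" "x \<in> X" "r \<ge> 0"
  obtains y where "y \<in> X" "d x y \<le> r" "ball_max u r x = u y" "\<And>z. z \<in> X \<Longrightarrow> d x z \<le> r \<Longrightarrow> u z \<le> ball_max u r x"
proof -
  have "\<exists>y\<in>{y\<in>X. d x y \<le> r}. \<forall>z\<in>{y\<in>X. d x y \<le> r}. u z \<le> u y"
    by (rule continuous_attains_sup[OF compact_ball[OF assms(2)]])
      (use assms in \<open>auto intro: continuous_on_subset\<close>)
  then obtain y where y: "y \<in> X" "d x y \<le> r" "\<And>z. z \<in> X \<Longrightarrow> d x z \<le> r \<Longrightarrow> u z \<le> u y" by auto
  have "ball_max u r x = u y"
    unfolding ball_max_def by (intro cSup_eq_maximum) (use y in auto)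
  then show thesis using that[of y] y by simp
qed

lemma ball_max_ge: "continuous_on X u \<Longrightarrow> x \<in> X \<Longrightarrow> y \<in> X \<Longrightarrow> d x y \<le> r \<Longrightarrow> u y \<le> ball_max u r x"
  by (rule ball_max_attained[of u x r]) (use d_nonneg[of x y] in auto)

text \<open>Comparison with the cone of slope \<open>c\<close> in the punctured ball.\<close>

lemma slope_bound:
  assumes u: "absmin S u" and x: "x \<in> X" and R: "R > 0" and S: "\<And>y. y \<in> X \<Longrightarrow> d x y < R \<Longrightarrow> y \<notin> S"
    and c: "\<And>y. y \<in> X \<Longrightarrow> d x y \<le> R \<Longrightarrow> u y \<le> u x + c * R"
    and y: "y \<in> X" "d x y \<le> R"
  shows "u y \<le> u x + c * d x y"
proof -
  have "u x \<le> u x + c * R" using c[OF x] x R by simp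
  then have c0: "c \<ge> 0" using R by (simp add: zero_le_mult_iff)
  define V where "V = {y\<in>X. d x y < R} - {x}"
  have oV: "openin (top_of_set X) V"
    unfolding V_def by (intro openin_diff openin_ball x) (use x in \<open>auto intro: closedin_subset_trans[of UNIV]\<close>)
  show ?thesis
  proof (cases "y \<in> V")
    case False
    then have "y = x \<or> d x y = R" using y by (auto simp: V_def)
    then show ?thesis using c[OF y] x by auto
  next
    case True
    show ?thesis
    proof (rule cone_comparison[OF u oV _ x _ c0 _ True])
      show "V \<subseteq> X - S" using S by (auto simp: V_def)
      show "x \<notin> V" by (simp add: V_def)
      fix z assume z: "z \<in> closure V - V"
      have "closure V \<subseteq> {y\<in>X. d x y \<le> R}"
        by (intro closure_minimal compact_imp_closed compact_ball x) (auto simp: V_def)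
      then have zX: "z \<in> X" "d x z \<le> R" using z by auto
      then have "z = x \<or> d x z = R" using z by (auto simp: V_def)
      then show "u z \<le> u x + c * d x z" using c[OF zX] x by auto
    qed
  qed
qed

text \<open>Two cone comparisons on the complement of \<open>S\<close>: first with a vertex in \<open>S\<close>, which estimates \<open>u\<close> against its
  boundary values, then with an arbitrary vertex, for which the first step supplies the boundary inequality.\<close>

lemma absmin_Lipschitz:
  assumes u: "absmin S u" and S: "closed S" "S \<subseteq> X" and \<kappa>: "\<kappa> \<ge> 0"
    and lip: "\<And>z w. z \<in> S \<Longrightarrow> w \<in> S \<Longrightarrow> \<bar>u z - u w\<bar> \<le> \<kappa> * d z w"
    and xy: "x \<in> X" "y \<in> X"
  shows "\<bar>u x - u y\<bar> \<le> \<kappa> * d x y"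
proof -
  have clX: "closure A \<subseteq> X" if "A \<subseteq> X" for A using that compact compact_imp_closed closure_minimal by blast
  have oS: "openin (top_of_set X) (X - S)" using S by (simp add: openin_diff closed_subset)
  have step1: "v y \<le> v z + \<kappa> * d z y"
    if v: "absmin S v" "\<And>z w. z \<in> S \<Longrightarrow> w \<in> S \<Longrightarrow> v z \<le> v w + \<kappa> * d w z" and z: "z \<in> S" and y: "y \<in> X" for v y z
  proof (cases "y \<in> S")
    case True then show ?thesis using v(2)[OF True z] by simp
  next
    case False
    show ?thesis
    proof (rule cone_comparison[OF v(1) oS _ _ _ \<kappa>])
      show "v w \<le> v z + \<kappa> * d z w" if "w \<in> closure (X - S) - (X - S)" for w
        using that clX[of "X - S"] v(2)[OF _ z, of w] by auto
    qed (use z S False y in auto)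
  qed
  have up: "u y \<le> u z + \<kappa> * d z y" if "z \<in> S" "y \<in> X" for y z
    by (rule step1[OF u _ that]) (use lip d_sym in \<open>force simp: abs_le_iff\<close>)
  have lo: "- u y \<le> - u z + \<kappa> * d z y" if "z \<in> S" "y \<in> X" for y z
    by (rule step1[OF absmin_minus[OF u] _ that]) (use lip d_sym in \<open>force simp: abs_le_iff\<close>)
  have step2: "u y \<le> u x + \<kappa> * d x y" if x: "x \<in> X" and y: "y \<in> X" for x y
  proof (cases "x \<in> S \<or> y \<in> S \<or> x = y")
    case True
    then show ?thesis using up[of x y] lo[of y x] x y d_sym[of x y] by auto
  next
    case False
    have o: "openin (top_of_set X) (X - S - {x})"
      by (intro openin_diff oS) (use x in \<open>auto intro: closedin_subset_trans[of UNIV]\<close>)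
    show ?thesis
    proof (rule cone_comparison[OF u o _ x _ \<kappa>])
      fix w assume w: "w \<in> closure (X - S - {x}) - (X - S - {x})"
      then have "w \<in> X" using clX[of "X - S - {x}"] by auto
      then have "w \<in> S \<or> w = x" using w by auto
      then show "u w \<le> u x + \<kappa> * d x w" using lo[of w x] x d_sym[of x w] by auto
    qed (use False x y in auto)
  qed
  show ?thesis using step2[OF xy] step2[OF xy(2,1)] d_sym[of x y] by (simp add: abs_le_iff)
qed

text \<open>The maximum \<open>y\<close> is taken half way between \<open>x\<close> and a point \<open>w\<close> that maximizes \<open>u\<close> over the ball of radius
  \<open>2 \<epsilon>\<close>. By \<open>slope_bound\<close> at radius \<open>2 \<epsilon>\<close>, the increase of \<open>u\<close> from \<open>x\<close> to the \<open>\<epsilon>\<close>-ball is at most half of its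
  increase to \<open>w\<close>; and the maximum over an \<open>\<epsilon>\<close>-ball around a neighbour of \<open>x\<close> is at least \<open>u x\<close>.\<close>

lemma ball_max_subsolution:
  assumes u: "absmin S u" and x: "x \<in> X" and \<epsilon>: "\<epsilon> > 0" and S: "\<And>y. y \<in> X \<Longrightarrow> d x y < 2 * \<epsilon> \<Longrightarrow> y \<notin> S"
  obtains y where "y \<in> X" "d x y \<le> \<epsilon>" "\<And>z. z \<in> X \<Longrightarrow> d x z \<le> \<epsilon> \<Longrightarrow> ball_max u \<epsilon> z \<le> ball_max u \<epsilon> y"
    "\<And>z. z \<in> X \<Longrightarrow> d x z \<le> \<epsilon> \<Longrightarrow> ball_max u \<epsilon> y + ball_max u \<epsilon> z \<ge> 2 * ball_max u \<epsilon> x"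
    "ball_max u \<epsilon> y + u x \<ge> 2 * ball_max u \<epsilon> x"
proof -
  have cu: "continuous_on X u" using u by (simp add: absmin_def)
  obtain w where w: "w \<in> X" "d x w \<le> 2 * \<epsilon>" "ball_max u (2 * \<epsilon>) x = u w"
    "\<And>z. z \<in> X \<Longrightarrow> d x z \<le> 2 * \<epsilon> \<Longrightarrow> u z \<le> ball_max u (2 * \<epsilon>) x"
    by (rule ball_max_attained[OF cu x, of "2 * \<epsilon>"]) (use \<epsilon> in auto)
  obtain y where y: "y \<in> X" "d x y \<le> \<epsilon>" "d y w \<le> \<epsilon>"
    by (rule between[OF x w(1), of \<epsilon> \<epsilon>]) (use w \<epsilon> in auto)
  have Uy: "u w \<le> ball_max u \<epsilon> y" by (rule ball_max_ge[OF cu y(1) w(1) y(3)])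
  have Uz: "ball_max u \<epsilon> z \<le> u w" if z: "z \<in> X" "d x z \<le> \<epsilon>" for z
  proof -
    obtain p where p: "p \<in> X" "d z p \<le> \<epsilon>" "ball_max u \<epsilon> z = u p"
      by (rule ball_max_attained[OF cu z(1), of \<epsilon>]) (use \<epsilon> in auto)
    have "d x p \<le> 2 * \<epsilon>" using d_triangle[OF x z(1) p(1)] z p by linarith
    then show ?thesis using w p by auto
  qed
  have half: "2 * ball_max u \<epsilon> x \<le> u w + u x"
  proof -
    obtain p where p: "p \<in> X" "d x p \<le> \<epsilon>" "ball_max u \<epsilon> x = u p"
      by (rule ball_max_attained[OF cu x, of \<epsilon>]) (use \<epsilon> in auto)
    define c where "c = (u w - u x) / (2 * \<epsilon>)"
    have c: "c * (2 * \<epsilon>) = u w - u x" using \<epsilon> by (simp add: c_def)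
    have c0: "c \<ge> 0" using w(4)[OF x] x \<epsilon> w(3) by (simp add: c_def)
    have "u p \<le> u x + c * d x p"
      by (rule slope_bound[OF u x, where R = "2 * \<epsilon>"]) (use S \<epsilon> c w p in auto)
    also have "c * d x p \<le> c * \<epsilon>" using c0 p by (intro mult_left_mono)
    also have "c * \<epsilon> = (u w - u x) / 2" using c by simp
    finally show ?thesis using p by (simp add: field_simps)
  qed
  show thesis
  proof (rule that[OF y(1,2)])
    fix z assume z: "z \<in> X" "d x z \<le> \<epsilon>"
    show "ball_max u \<epsilon> z \<le> ball_max u \<epsilon> y" using Uz[OF z] Uy by simp
    have "u x \<le> ball_max u \<epsilon> z" using z x d_sym[of x z] by (intro ball_max_ge cu) auto
    then show "ball_max u \<epsilon> y + ball_max u \<epsilon> z \<ge> 2 * ball_max u \<epsilon> x" using half Uy by linarith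
  next
    show "ball_max u \<epsilon> y + u x \<ge> 2 * ball_max u \<epsilon> x" using half Uy by linarith
  qed
qed

text \<open>The slope at radius \<open>R\<close> bounds the slope at slightly shifted centres, up to an arbitrarily small loss, and slopes
  at smaller radii are smaller.\<close>

lemma slope_local_Lipschitz:
  assumes u: "absmin S u" and x0: "x0 \<in> X" and R: "R > 0" and S: "\<And>y. y \<in> X \<Longrightarrow> d x0 y < R \<Longrightarrow> y \<notin> S"
    and c: "\<And>y. y \<in> X \<Longrightarrow> d x0 y \<le> R \<Longrightarrow> u y \<le> u x0 + c * R" and c': "c < c'"
  obtains \<rho> where "\<rho> > 0" "\<And>x y. x \<in> X \<Longrightarrow> y \<in> X \<Longrightarrow> d x0 x < \<rho> \<Longrightarrow> d x0 y < \<rho> \<Longrightarrow> \<bar>u x - u y\<bar> \<le> c' * d x y"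
proof -
  have "u x0 \<le> u x0 + c * R" using c[OF x0] x0 R by simp
  then have c0: "c \<ge> 0" using R by (simp add: zero_le_mult_iff)
  have cu: "continuous_on X u" using u by (simp add: absmin_def)
  define \<eta> where "\<eta> = (c' - c) * R / 2"
  have \<eta>: "\<eta> > 0" using c' R by (simp add: \<eta>_def)
  obtain \<rho>1 where \<rho>1: "\<rho>1 > 0" "\<And>x. x \<in> X \<Longrightarrow> dist x x0 < \<rho>1 \<Longrightarrow> dist (u x) (u x0) < \<eta>"
    using cu x0 \<eta> unfolding continuous_on_iff by meson
  define \<rho> where "\<rho> = min (min \<rho>1 (R/3)) (\<eta> / c')"
  have \<rho>': "\<rho> \<le> min \<rho>1 (R/3)" "\<rho> \<le> \<eta> / c'" unfolding \<rho>_def by (rule min.cobounded1, rule min.cobounded2)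
  have \<rho>: "\<rho> > 0" "\<rho> \<le> \<rho>1" "\<rho> \<le> R/3" "\<rho> \<le> \<eta> / c'"
  proof -
    show "\<rho> > 0" using \<rho>1 R \<eta> c0 c' by (simp add: \<rho>_def)
    show "\<rho> \<le> \<rho>1" using \<rho>'(1) by (rule order_trans) (rule min.cobounded1)
    show "\<rho> \<le> R/3" using \<rho>'(1) by (rule order_trans) (rule min.cobounded2)
    show "\<rho> \<le> \<eta> / c'" by (rule \<rho>'(2))
  qed
  have one: "u y \<le> u x + c' * d x y" if xy: "x \<in> X" "y \<in> X" "d x0 x < \<rho>" "d x0 y < \<rho>" for x y
  proof (rule slope_bound[OF u xy(1), of "R - \<rho>"])
    show "R - \<rho> > 0" using \<rho> R by linarith
    show "y \<in> X" by fact
    show "d x y \<le> R - \<rho>" using d_triangle[OF xy(1) x0 xy(2)] d_sym[of x x0] xy \<rho> by linarith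
    show "w \<notin> S" if "w \<in> X" "d x w < R - \<rho>" for w
      using S[OF that(1)] d_triangle[OF x0 xy(1) that(1)] that xy by linarith
    fix w assume w: "w \<in> X" "d x w \<le> R - \<rho>"
    have "d x0 w \<le> R" using d_triangle[OF x0 xy(1) w(1)] w xy by linarith
    then have "u w \<le> u x0 + c * R" using c w by blast
    moreover have "dist x x0 < \<rho>1" using norm_le_d[OF x0 xy(1)] xy \<rho> by (simp add: dist_norm norm_minus_commute)
    then have "u x0 < u x + \<eta>" using \<rho>1(2)[OF xy(1)] by (simp add: dist_real_def)
    moreover have "c' * \<rho> \<le> \<eta>" using \<rho> c0 c' by (simp add: field_simps)
    moreover have "c' * (R - \<rho>) = c' * R - c' * \<rho>" "2 * \<eta> = c' * R - c * R" by (simp_all add: \<eta>_def field_simps)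
    ultimately show "u w \<le> u x + c' * (R - \<rho>)" by linarith
  qed
  show thesis
    by (rule that[OF \<rho>(1)]) (use one d_sym in \<open>metis abs_le_iff minus_diff_eq diff_le_eq add.commute\<close>)
qed

lemma chain_exists:
  assumes "x \<in> X" "z \<in> X" "d x z \<le> real k * \<epsilon>" "\<epsilon> > 0"
  shows "\<exists>f. f 0 = x \<and> f k = z \<and> (\<forall>i<k. f i \<in> X \<and> d (f i) (f (Suc i)) \<le> \<epsilon>)"
  using assms(1,3)
proof (induction k arbitrary: x)
  case 0
  then have "d x z \<le> 0" by simp
  then have "norm (x - z) \<le> 0" by (rule order_trans[OF norm_le_d[OF 0(1) assms(2)]])
  then show ?case by (intro exI[of _ "\<lambda>_. x"]) auto
next
  case (Suc k)
  have le: "d x z \<le> \<epsilon> + real k * \<epsilon>" using Suc by (simp add: algebra_simps)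
  obtain y where y: "y \<in> X" "d x y \<le> \<epsilon>" "d y z \<le> real k * \<epsilon>"
    by (rule between[OF Suc(2) assms(2) le]) (use assms(4) in auto)
  obtain f where f: "f 0 = y" "f k = z" "\<forall>i<k. f i \<in> X \<and> d (f i) (f (Suc i)) \<le> \<epsilon>"
    using Suc.IH[OF y(1,3)] by blast
  have "(\<lambda>i. case i of 0 \<Rightarrow> x | Suc j \<Rightarrow> f j) 0 = x \<and> (\<lambda>i. case i of 0 \<Rightarrow> x | Suc j \<Rightarrow> f j) (Suc k) = z \<and>
     (\<forall>i<Suc k. (\<lambda>i. case i of 0 \<Rightarrow> x | Suc j \<Rightarrow> f j) i \<in> X \<and>
        d ((\<lambda>i. case i of 0 \<Rightarrow> x | Suc j \<Rightarrow> f j) i) ((\<lambda>i. case i of 0 \<Rightarrow> x | Suc j \<Rightarrow> f j) (Suc i)) \<le> \<epsilon>)"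
    using f y Suc(2) by (auto split: nat.splits)
  then show ?case by blast
qed

text \<open>The margin \<open>3 \<epsilon>\<close> keeps balls of radius \<open>2 \<epsilon>\<close>, enlarged by the resolution of the labels, away from \<open>S\<close>.\<close>

definition inner_part :: "'a set \<Rightarrow> real \<Rightarrow> 'a set" where
  "inner_part S \<epsilon> = {x\<in>X. \<forall>z\<in>S. d x z > 3 * \<epsilon>}"

text \<open>The patched comparison for the maxima of \<open>u\<close> over balls, with slope threshold \<open>\<alpha> \<epsilon>\<close> and chains of \<open>D / \<epsilon>\<close> steps.\<close>

lemma one_sided_comparison:
  assumes u: "absmin S u" and S: "S \<noteq> {}" "S \<subseteq> X" and \<epsilon>: "0 < \<epsilon>" "\<epsilon> \<le> 1" and \<alpha>: "0 < \<alpha>" "\<alpha> \<le> 1" and e: "e > 0"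
    and D: "\<And>x y. x \<in> X \<Longrightarrow> y \<in> X \<Longrightarrow> d x y \<le> D"
    and uM: "\<And>x. x \<in> X \<Longrightarrow> \<bar>u x\<bar> \<le> M" and VM: "\<And>x. x \<in> X \<Longrightarrow> \<bar>V x\<bar> \<le> M"
    and super: "\<And>x. x \<in> inner_part S \<epsilon> \<Longrightarrow> \<exists>z\<in>X. d x z \<le> \<epsilon> \<and> (\<forall>y\<in>X. d x y \<le> \<epsilon> \<longrightarrow> V y + V z \<le> 2 * V x + e)"
    and bdry: "\<And>x. x \<in> X - inner_part S \<epsilon> \<Longrightarrow> ball_max u \<epsilon> x - V x \<le> B"
    and x: "x \<in> X"
  shows "u x - V x \<le> B + 2 * (D + 1) * \<alpha> + 8 * e * (M + 2 * (D + 1))\<^sup>2 / (\<alpha> * \<epsilon>)\<^sup>2"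
proof -
  have cu: "continuous_on X u" using u by (simp add: absmin_def)
  have D0: "D \<ge> 0" using D[OF x x] x by simp
  \<comment> \<open>the number of steps of length \<open>\<epsilon>\<close> that lead from any point to \<open>S\<close>\<close>
  define N where "N = nat \<lceil>D / \<epsilon>\<rceil>"
  have N: "D \<le> real N * \<epsilon>" "real N * \<epsilon> \<le> D + 1"
  proof -
    have "real N = of_int \<lceil>D / \<epsilon>\<rceil>" using D0 \<epsilon> by (simp add: N_def)
    then have "D / \<epsilon> \<le> real N" "real N \<le> D / \<epsilon> + 1" by linarith+
    then show "D \<le> real N * \<epsilon>" "real N * \<epsilon> \<le> D + 1" using \<epsilon> by (auto simp: field_simps)
  qed
  define s where "s = \<alpha> * \<epsilon>"
  have s: "s > 0" using \<alpha> \<epsilon> by (simp add: s_def)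
  have Ns: "2 * real N * s \<le> 2 * (D + 1) * \<alpha>"
    using mult_right_mono[OF N(2), of \<alpha>] \<alpha> by (simp add: s_def mult_ac)
  have Ns1: "2 * real N * s \<le> 2 * (D + 1)"
  proof -
    have "2 * (D + 1) * \<alpha> \<le> 2 * (D + 1) * 1" using \<alpha> D0 by (intro mult_left_mono) auto
    then show ?thesis using Ns by simp
  qed
  have UM: "\<bar>ball_max u \<epsilon> y\<bar> \<le> M" if y: "y \<in> X" for y
    by (rule ball_max_attained[OF cu y, of \<epsilon>]) (use \<epsilon> uM in auto)
  have M0: "M \<ge> 0" using uM[OF x] by linarith
  let ?R = "\<lambda>x y. d x y \<le> \<epsilon>"
  have "ball_max u \<epsilon> x - V x \<le> B + 2 * real N * s + 8 * e * (M + 2 * real N * s)\<^sup>2 / s\<^sup>2"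
  proof (rule comparison_patched[where R = ?R and X = X and I = "inner_part S \<epsilon>"])
    show "d y x \<le> \<epsilon>" if "d x y \<le> \<epsilon>" for x y using that by (simp add: d_sym)
    show "inner_part S \<epsilon> \<subseteq> X" by (auto simp: inner_part_def)
    fix y assume y: "y \<in> inner_part S \<epsilon>"
    then have yX: "y \<in> X" and yS: "\<And>z. z \<in> S \<Longrightarrow> d y z > 3 * \<epsilon>" by (auto simp: inner_part_def)
    show "\<exists>z\<in>X. d y z \<le> \<epsilon> \<and> (\<forall>w\<in>X. d y w \<le> \<epsilon> \<longrightarrow> ball_max u \<epsilon> w \<le> ball_max u \<epsilon> z) \<and>
       (\<forall>w\<in>X. d y w \<le> \<epsilon> \<longrightarrow> 2 * ball_max u \<epsilon> y \<le> ball_max u \<epsilon> z + ball_max u \<epsilon> w)"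
      by (rule ball_max_subsolution[OF u yX \<epsilon>(1)]) (use yS \<epsilon> in fastforce, blast)
  next
    fix y assume y: "y \<in> X"
    obtain z where z: "z \<in> S" using S by blast
    have zX: "z \<in> X - inner_part S \<epsilon>" using z S \<epsilon> by (force simp: inner_part_def)
    have "d y z \<le> real N * \<epsilon>" using D[OF y, of z] N zX by auto
    then show "\<exists>k\<le>N. \<exists>f. f 0 = y \<and> f k \<in> X - inner_part S \<epsilon> \<and> (\<forall>i<k. f i \<in> X \<and> d (f i) (f (Suc i)) \<le> \<epsilon>)"
      using chain_exists[OF y _ _ \<epsilon>(1), of z N] zX by (intro exI[of _ N]) auto
  qed (use UM VM super bdry s e x in auto)
  moreover have "u x \<le> ball_max u \<epsilon> x" using x \<epsilon> by (intro ball_max_ge cu) auto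
  moreover have "8 * e * (M + 2 * real N * s)\<^sup>2 / s\<^sup>2 \<le> 8 * e * (M + 2 * (D + 1))\<^sup>2 / s\<^sup>2"
    using Ns1 e M0 s by (intro divide_right_mono mult_left_mono power_mono) auto
  ultimately show ?thesis using Ns by (simp add: s_def)
qed

lemma one_sided_comparison_steep:
  assumes u: "absmin S u" and \<epsilon>: "0 < \<epsilon>" and s: "s > 0" and e: "e > 0"
    and steep: "\<And>x. x \<in> inner_part S \<epsilon> \<Longrightarrow> ball_max u \<epsilon> x \<ge> u x + s"
    and uM: "\<And>x. x \<in> X \<Longrightarrow> \<bar>u x\<bar> \<le> M" and VM: "\<And>x. x \<in> X \<Longrightarrow> \<bar>V x\<bar> \<le> M"
    and super: "\<And>x. x \<in> inner_part S \<epsilon> \<Longrightarrow> \<exists>z\<in>X. d x z \<le> \<epsilon> \<and> (\<forall>y\<in>X. d x y \<le> \<epsilon> \<longrightarrow> V y + V z \<le> 2 * V x + e)"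
    and bdry: "\<And>x. x \<in> X - inner_part S \<epsilon> \<Longrightarrow> ball_max u \<epsilon> x - V x \<le> B"
    and x: "x \<in> X"
  shows "u x - V x \<le> B + 8 * e * M\<^sup>2 / s\<^sup>2"
proof -
  have cu: "continuous_on X u" using u by (simp add: absmin_def)
  have UM: "\<bar>ball_max u \<epsilon> y\<bar> \<le> M" if y: "y \<in> X" for y
    by (rule ball_max_attained[OF cu y, of \<epsilon>]) (use \<epsilon> uM in auto)
  have "ball_max u \<epsilon> x - V x \<le> B + 8 * e * M\<^sup>2 / s\<^sup>2"
  proof (rule comparison_strict[where R = "\<lambda>x y. d x y \<le> \<epsilon>" and X = X and I = "inner_part S \<epsilon>"])
    fix y and \<theta> :: real assume y: "y \<in> inner_part S \<epsilon>" and th: "\<theta> > 0"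
    then have yX: "y \<in> X" and yS: "\<And>z. z \<in> X \<Longrightarrow> d y z < 2 * \<epsilon> \<Longrightarrow> z \<notin> S" using \<epsilon> by (fastforce simp: inner_part_def)+
    obtain z where z: "z \<in> X" "d y z \<le> \<epsilon>" 
      "\<And>w. w \<in> X \<Longrightarrow> d y w \<le> \<epsilon> \<Longrightarrow> ball_max u \<epsilon> w \<le> ball_max u \<epsilon> z"
      "\<And>w. w \<in> X \<Longrightarrow> d y w \<le> \<epsilon> \<Longrightarrow> ball_max u \<epsilon> z + ball_max u \<epsilon> w \<ge> 2 * ball_max u \<epsilon> y"
      "ball_max u \<epsilon> z + u y \<ge> 2 * ball_max u \<epsilon> y"
      by (rule ball_max_subsolution[OF u yX \<epsilon> yS]) blast+
    have "ball_max u \<epsilon> y + s - \<theta> \<le> ball_max u \<epsilon> z" using z(5) steep[OF y] th by linarith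
    moreover have "2 * ball_max u \<epsilon> y - \<theta> \<le> ball_max u \<epsilon> z + ball_max u \<epsilon> w" if "w \<in> X" "d y w \<le> \<epsilon>" for w
      using z(4)[OF that] th by linarith
    ultimately show "\<exists>z\<in>X. d y z \<le> \<epsilon> \<and> ball_max u \<epsilon> y + s - \<theta> \<le> ball_max u \<epsilon> z \<and>
       (\<forall>w\<in>X. d y w \<le> \<epsilon> \<longrightarrow> 2 * ball_max u \<epsilon> y - \<theta> \<le> ball_max u \<epsilon> z + ball_max u \<epsilon> w)"
      using z(1,2) by blast
  qed (use UM VM super bdry s e x in auto)
  moreover have "u x \<le> ball_max u \<epsilon> x" using x \<epsilon> by (intro ball_max_ge cu) auto
  ultimately show ?thesis by simp
qed

end

section \<open>Geodesics are nearly straight at the length scale\<close>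

text \<open>If two consecutive corners of a three-segment polygon are nearly straight, the polygon is nearly straight. By the
  first two hypotheses the outer segments have almost maximal inner product with the middle one, so the projection of the polygon to the direction of
  the middle segment is almost its full length.\<close>

lemma nearly_straight_three:
  fixes P Q R :: "'a::real_inner"
  assumes 1: "norm P + norm Q \<le> norm (P + Q) + e" and 2: "norm Q + norm R \<le> norm (Q + R) + e"
    and e: "e \<ge> 0" and Q: "norm Q > 0"
  shows "norm P + norm Q + norm R \<le> norm (P + Q + R) + e * (norm P + 2 * norm Q + norm R) / norm Q"
proof -
  have gen: "norm A * norm B - e * (norm A + norm B) \<le> A \<bullet> B" if "norm A + norm B \<le> norm (A + B) + e" for A B :: 'a
  proof (cases "norm A + norm B \<ge> e")
    case True
    have "(norm A + norm B - e)\<^sup>2 \<le> (norm (A + B))\<^sup>2" using that True by (intro power_mono) auto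
    also have "\<dots> = (norm A)\<^sup>2 + (norm B)\<^sup>2 + 2 * (A \<bullet> B)"
      by (simp add: power2_norm_eq_inner inner_add inner_commute)
    finally have "2 * (norm A * norm B) - 2 * (e * (norm A + norm B)) + e\<^sup>2 \<le> 2 * (A \<bullet> B)"
      by (simp add: power2_eq_square algebra_simps)
    then show ?thesis using zero_le_power2[of e] by linarith
  next
    case False
    have "- (norm A * norm B) \<le> A \<bullet> B" using Cauchy_Schwarz_ineq2[of A B] by linarith
    moreover have "(norm A + norm B) * (norm A + norm B) \<le> e * (norm A + norm B)"
      using False by (intro mult_right_mono) auto
    moreover have "(norm A + norm B) * (norm A + norm B) = norm A * norm A + norm B * norm B + 2 * (norm A * norm B)"
      by (simp add: algebra_simps)
    ultimately show ?thesis using zero_le_square[of "norm A"] zero_le_square[of "norm B"] by linarith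
  qed
  have "norm P * norm Q + norm Q * norm Q + norm R * norm Q - e * (norm P + 2 * norm Q + norm R) \<le> (P + Q + R) \<bullet> Q"
    using gen[OF 1] gen[OF 2]
    by (simp add: inner_add_left inner_commute[of Q R] power2_norm_eq_inner[unfolded power2_eq_square] algebra_simps)
  also have "\<dots> \<le> norm (P + Q + R) * norm Q" by (rule norm_cauchy_schwarz)
  finally have "(norm P + norm Q + norm R) * norm Q \<le> (norm (P + Q + R) + e * (norm P + 2 * norm Q + norm R) / norm Q) * norm Q"
  proof -
    assume *: "norm P * norm Q + norm Q * norm Q + norm R * norm Q - e * (norm P + 2 * norm Q + norm R) \<le> norm (P + Q + R) * norm Q"
    have "(norm (P + Q + R) + e * (norm P + 2 * norm Q + norm R) / norm Q) * norm Q
        = norm (P + Q + R) * norm Q + e * (norm P + 2 * norm Q + norm R)"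
      using Q by (simp add: distrib_right)
    moreover have "(norm P + norm Q + norm R) * norm Q = norm P * norm Q + norm Q * norm Q + norm R * norm Q"
      by (simp add: distrib_right)
    ultimately show ?thesis using * by linarith
  qed
  then show ?thesis using Q by (rule mult_right_le_imp_le)
qed

context length_domain
begin

text \<open>Points \<open>C\<close> and \<open>B\<close> on a near geodesic from \<open>x\<close> to \<open>y\<close> are chosen at Euclidean distance \<open>H\<close> from \<open>x\<close> and \<open>y\<close>. The windows
  from \<open>x\<close> to \<open>C\<close> and from \<open>B\<close> to \<open>y\<close> have length at most \<open>H + E\<close> up to \<open>\<tau>\<close>, and they overlap in at least
  \<open>4/10 H\<close> because the whole curve is shorter than \<open>152/100 H\<close>. Hence the polygon \<open>x, B, C, y\<close> is nearly straight at both corners.\<close>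

lemma two_windows_interior:
  assumes H: "H > 0" "2 * H \<le> r0" and E: "0 \<le> E" "E \<le> H / 10" and \<Omega>: "\<Omega> \<subseteq> X"
    and base: "\<And>a b. a \<in> \<Omega> \<Longrightarrow> b \<in> X \<Longrightarrow> norm (a - b) = H \<Longrightarrow> d a b \<le> H + E"
    and xy: "x \<in> \<Omega>" "y \<in> \<Omega>" "H < norm (x - y)" "norm (x - y) \<le> 146/100 * H"
    and \<tau>: "0 < \<tau>" "\<tau> \<le> H / 100"
  shows "d x y \<le> norm (x - y) + 8 * (E + \<tau>)"
proof -
  have xyX: "x \<in> X" "y \<in> X" using xy \<Omega> by auto
  obtain \<gamma> l where p: "continuous_on {0..1} \<gamma>" "\<gamma> 0 = x" "\<gamma> 1 = y" "\<gamma> ` {0..1} \<subseteq> X" "l 0 = 0" "l 1 < d x y + \<tau>"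
    and sub: "\<And>s t. 0 \<le> s \<Longrightarrow> s \<le> t \<Longrightarrow> t \<le> 1 \<Longrightarrow> d (\<gamma> s) (\<gamma> t) \<le> l t - l (s::real)"
    using path[OF xyX, of "d x y + \<tau>"] \<tau> by auto
  have gX: "\<gamma> t \<in> X" if "0 \<le> t" "t \<le> 1" for t using p that by auto
  have Dup: "d x y \<le> 103/100 * norm (x - y)" using local_d[OF xyX] xy H by simp
  have "\<exists>t\<ge>0. t \<le> 1 \<and> norm (x - \<gamma> t) = H"
    by (rule IVT') (use p xy H in \<open>auto intro!: continuous_intros\<close>)
  then obtain t1 where t1: "0 \<le> t1" "t1 \<le> 1" "norm (x - \<gamma> t1) = H" by blast
  have "\<exists>t\<ge>0. t \<le> 1 \<and> norm (\<gamma> t - y) = H"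
    by (rule IVT2') (use p xy H in \<open>auto intro!: continuous_intros\<close>)
  then obtain t2 where t2: "0 \<le> t2" "t2 \<le> 1" "norm (\<gamma> t2 - y) = H" by blast
  define B C where "B = \<gamma> t2" and "C = \<gamma> t1"
  have BC: "B \<in> X" "C \<in> X" using gX t1 t2 by (auto simp: B_def C_def)
  have dxC: "d x C \<le> H + E" using base[OF xy(1) BC(2)] t1 by (simp add: C_def)
  have dBy: "d B y \<le> H + E" using base[OF xy(2) BC(1)] t2 d_sym[of B y] by (simp add: B_def norm_minus_commute)
  have HxC: "H \<le> d x C" "H \<le> d B y" using norm_le_d[OF xyX(1) BC(2)] norm_le_d[OF BC(1) xyX(2)] t1 t2
    by (simp_all add: B_def C_def)
  have l1: "d x C \<le> l t1" "d C y \<le> l 1 - l t1" using sub[of 0 t1] sub[of t1 1] t1 p by (auto simp: C_def)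
  have l2: "d x B \<le> l t2" "d B y \<le> l 1 - l t2" using sub[of 0 t2] sub[of t2 1] t2 p by (auto simp: B_def)
  have "t2 \<le> t1"
  proof (rule ccontr)
    assume "\<not> t2 \<le> t1"
    then have "0 \<le> l t2 - l t1" using sub[of t1 t2] t1 t2 d_nonneg[of "\<gamma> t1" "\<gamma> t2"] gX by force
    then show False using l1 l2 HxC p(6) Dup xy(4) \<tau> H by linarith
  qed
  then have l3: "d B C \<le> l t1 - l t2" using sub[of t2 t1] t1 t2 by (simp add: B_def C_def)
  define e where "e = E + \<tau>"
  have tri: "d x y \<le> d x C + d C y" "d x y \<le> d x B + d B y" "d x C \<le> d x B + d B C" "d x B \<le> d x C + d C B"
    using d_triangle xyX BC by blast+
  have w1: "l t1 \<le> H + e" using tri(1) dxC l1(2) p(6) by (simp add: e_def)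
  have w2: "l 1 - l t2 \<le> H + e" using tri(2) dBy l2(1) p(6) by (simp add: e_def)
  define a b c where "a = norm (B - x)" and "b = norm (C - B)" and "c = norm (y - C)"
  have abc: "a \<le> d x B" "b \<le> d B C" "c \<le> d C y"
    using norm_le_d[of x B] norm_le_d[of B C] norm_le_d[of C y] xyX BC by (simp_all add: a_def b_def c_def norm_minus_commute)
  have PQ: "norm ((B - x) + (C - B)) = H" "norm ((C - B) + (y - C)) = H"
    using t1 t2 by (simp_all add: B_def C_def norm_minus_commute)
  have ab: "a + b \<le> H + e" "b + c \<le> H + e" using abc l1 l2 l3 w1 w2 by linarith+
  have Hab: "H \<le> a + b" "H \<le> b + c"
    using norm_triangle_ineq[of "B - x" "C - B"] norm_triangle_ineq[of "C - B" "y - C"] PQ by (simp_all add: a_def b_def c_def)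
  have eH: "0 \<le> e" "e \<le> 11/100 * H" using E \<tau> by (simp_all add: e_def)
  have bH: "b \<ge> 4/10 * H"
  proof -
    have "l t1 \<ge> H" "l 1 - l t2 \<ge> H" using l1 l2 HxC by linarith+
    then have L: "l t1 - l t2 \<ge> 2 * H - l 1" by linarith
    have "d x y \<le> d x B + (d B C + d C y)" using d_triangle[of x B y] d_triangle[of B C y] xyX BC by simp
    then have "d B C \<ge> (l t1 - l t2) - \<tau>" using l1 l2 p(6) by linarith
    then have "d B C \<ge> 47/100 * H" using L p(6) Dup xy(4) \<tau> by linarith
    moreover have "b \<le> r0" using ab(1) norm_ge_zero[of "B - x"] eH H unfolding a_def by linarith
    then have "d B C \<le> 103/100 * b"
      using local_d[OF BC] by (simp add: b_def norm_minus_commute)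
    ultimately show ?thesis using H(1) by linarith
  qed
  have b0: "b > 0" using bH H by linarith
  have "a + b + c \<le> norm ((B - x) + (C - B) + (y - C)) + e * (a + 2 * b + c) / b"
    unfolding a_def b_def c_def
    by (rule nearly_straight_three) (use PQ ab eH b0 in \<open>simp_all add: a_def b_def c_def\<close>)
  moreover have "e * (a + 2 * b + c) / b \<le> 6 * e"
  proof -
    have "a + 2 * b + c \<le> 6 * b" using ab eH bH by linarith
    then have "e * (a + 2 * b + c) \<le> e * (6 * b)" using eH by (intro mult_left_mono) auto
    then show ?thesis using b0 by (simp add: field_simps)
  qed
  moreover have "(B - x) + (C - B) + (y - C) = y - x" by simp
  ultimately have "a + b + c \<le> norm (x - y) + 6 * e" by (simp add: norm_minus_commute)
  moreover have "d x y \<le> a + b + c + 2 * e"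
  proof -
    have "l t1 \<le> a + b + e" using w1 Hab by linarith
    moreover have "l 1 - l t1 \<le> c + e" using w2 Hab abc l3 by linarith
    ultimately show ?thesis using tri(1) l1 by linarith
  qed
  ultimately show ?thesis by (simp add: e_def)
qed

text \<open>The strict inequality \<open>H < norm (x - y)\<close> survives the approximation of \<open>x\<close> and \<open>y\<close> from \<open>\<Omega>\<close>. It is essential: two
  boundary points at distance exactly \<open>H\<close> may be a local maximum of the distance, and then no pair in \<open>\<Omega>\<close> near them has distance \<open>H\<close>.\<close>

lemma two_windows:
  assumes H: "H > 0" "2 * H \<le> r0" and E: "0 \<le> E" "E \<le> H / 10" and \<Omega>: "X = closure \<Omega>"
    and base: "\<And>a b. a \<in> \<Omega> \<Longrightarrow> b \<in> X \<Longrightarrow> norm (a - b) = H \<Longrightarrow> d a b \<le> H + E"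
    and xy: "x \<in> X" "y \<in> X" "H < norm (x - y)" "norm (x - y) \<le> 145/100 * H"
  shows "d x y \<le> norm (x - y) + 8 * E"
proof (rule field_le_epsilon)
  fix e :: real assume e: "e > 0"
  \<comment> \<open>The three bounds absorb the perturbation in the conclusion, keep the distance above \<open>H\<close>, and keep it below \<open>146/100 H\<close>.\<close>
  define \<tau> where "\<tau> = Min {e / 13, (norm (x - y) - H) / 3, H / 1000}"
  have "\<tau> > 0" using e xy H by (simp add: \<tau>_def)
  moreover have "\<tau> \<le> q" if "q \<in> {e / 13, (norm (x - y) - H) / 3, H / 1000}" for q
    unfolding \<tau>_def using that by (intro Min_le) auto
  ultimately have \<tau>: "\<tau> > 0" "\<tau> \<le> e / 13" "\<tau> \<le> (norm (x - y) - H) / 3" "\<tau> \<le> H / 1000"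
    by blast+
  obtain x' where x': "x' \<in> \<Omega>" "norm (x - x') < \<tau>" using xy(1) \<tau>(1) unfolding \<Omega> closure_approachable
    by (metis dist_norm norm_minus_commute)
  obtain y' where y': "y' \<in> \<Omega>" "norm (y - y') < \<tau>" using xy(2) \<tau>(1) unfolding \<Omega> closure_approachable
    by (metis dist_norm norm_minus_commute)
  have sub: "\<Omega> \<subseteq> X" using \<Omega> closure_subset by auto
  have X': "x' \<in> X" "y' \<in> X" using x' y' sub by auto
  have n: "norm (x' - y') \<le> norm (x - y) + (norm (x - x') + norm (y - y'))"
    "norm (x - y) \<le> norm (x' - y') + (norm (x - x') + norm (y - y'))" by norm+
  have "d x' y' \<le> norm (x' - y') + 8 * (E + \<tau>)"
  proof (rule two_windows_interior[OF H E sub base x'(1) y'(1)])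
    show "H < norm (x' - y')" using n(2) x'(2) y'(2) \<tau>(3) xy(3) by argo
    show "norm (x' - y') \<le> 146/100 * H" using n(1) x'(2) y'(2) \<tau>(4) xy(4) H(1) by linarith
    show "0 < \<tau>" "\<tau> \<le> H / 100" using \<tau> H by simp_all
  qed
  moreover have "d x x' \<le> 103/100 * norm (x - x')" "d y' y \<le> 103/100 * norm (y - y')"
    using local_d[OF xy(1) X'(1)] local_d[OF xy(2) X'(2)] x' y' \<tau> H d_sym[of y y'] by auto
  moreover have "d x y \<le> d x x' + (d x' y' + d y' y)"
    using d_triangle[OF xy(1) X'(1) xy(2)] d_triangle[OF X' xy(2)] by linarith
  ultimately show "d x y \<le> norm (x - y) + 8 * E + e"
    using n(1) less_imp_le[OF x'(2)] less_imp_le[OF y'(2)] \<tau>(2) e by argo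
qed

text \<open>A point of \<open>\<Omega>\<close> near \<open>b\<close> has distance almost \<open>h\<close> from \<open>a\<close>, and \<open>a\<close> can be moved along the line through both to make the
  distance exactly \<open>h\<close>.\<close>

lemma exact_distance_base:
  assumes \<Omega>: "X = closure \<Omega>" "open \<Omega>" and h: "h > 0" "h \<le> r0"
    and base: "\<And>x y. x \<in> \<Omega> \<Longrightarrow> y \<in> \<Omega> \<Longrightarrow> norm (x - y) = h \<Longrightarrow> d x y \<le> h + E"
    and a: "a \<in> \<Omega>" and b: "b \<in> X" and ab: "norm (a - b) = h"
  shows "d a b \<le> h + E"
proof (rule field_le_epsilon)
  fix e :: real assume e: "e > 0"
  obtain \<rho> where \<rho>: "\<rho> > 0" "ball a \<rho> \<subseteq> \<Omega>" using \<Omega>(2) a open_contains_ball by blast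
  define \<theta> where "\<theta> = Min {e / 3, \<rho>, h / 2}"
  have \<theta>: "\<theta> > 0" "\<theta> \<le> e / 3" "\<theta> \<le> \<rho>" "\<theta> \<le> h / 2" using e \<rho> h by (auto simp: \<theta>_def)
  obtain b' where b': "b' \<in> \<Omega>" "norm (b - b') < \<theta>" using b \<theta>(1) unfolding \<Omega> closure_approachable
    by (metis dist_norm norm_minus_commute)
  define s where "s = norm (a - b')"
  have s: "\<bar>s - h\<bar> < \<theta>" using b' ab norm_triangle_ineq3[of "a - b'" "a - b"] by (simp add: s_def)
  have s0: "s > 0" using s \<theta> h by linarith
  define a' where "a' = b' + (h / s) *\<^sub>R (a - b')"
  have "a' - a = ((h - s) / s) *\<^sub>R (a - b')"
    using s0 by (simp add: a'_def algebra_simps diff_divide_distrib)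
  then have na: "norm (a - a') = \<bar>s - h\<bar>" using s0 by (simp add: norm_minus_commute[of a a'] s_def[symmetric] abs_minus_commute)
  have "a' \<in> \<Omega>" using \<rho> na s \<theta> by (auto simp: subset_iff dist_norm)
  moreover have "norm (a' - b') = h" using s0 h by (simp add: a'_def s_def[symmetric])
  ultimately have 1: "d a' b' \<le> h + E" using base b' by blast
  have sub: "\<Omega> \<subseteq> X" using \<Omega> closure_subset by auto
  have X: "a \<in> X" "a' \<in> X" "b' \<in> X" using sub a \<open>a' \<in> \<Omega>\<close> b' by auto
  have "d a a' \<le> 103/100 * norm (a - a')" "d b b' \<le> 103/100 * norm (b - b')"
    using local_d[OF X(1,2)] local_d[OF b X(3)] na s b' \<theta> h by auto
  moreover have "d a b \<le> d a a' + (d a' b' + d b' b)"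
    using d_triangle[OF X(1,2) b] d_triangle[OF X(2,3) b] by linarith
  ultimately show "d a b \<le> h + E + e" using 1 d_sym[of b b'] na s b' \<theta> by linarith
qed

text \<open>Two windows of length \<open>h\<close> cover distances up to \<open>145/100 h\<close>, and two windows of that length cover distances up to \<open>2 h\<close>.\<close>

lemma medium_distance:
  assumes \<Omega>: "X = closure \<Omega>" "open \<Omega>" and h: "h > 0" "3 * h \<le> r0" and E: "0 \<le> E" "E \<le> h / 100"
    and base: "\<And>x y. x \<in> \<Omega> \<Longrightarrow> y \<in> \<Omega> \<Longrightarrow> norm (x - y) = h \<Longrightarrow> d x y \<le> h + E"
    and xy: "x \<in> X" "y \<in> X" "h < norm (x - y)" "norm (x - y) \<le> 2 * h"
  shows "d x y \<le> norm (x - y) + 64 * E"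
proof -
  have base1: "d a b \<le> h + E" if "a \<in> \<Omega>" "b \<in> X" "norm (a - b) = h" for a b
    by (rule exact_distance_base[OF \<Omega> _ _ base that]) (use h in auto)
  have one: "d x y \<le> norm (x - y) + 8 * E" if "x \<in> X" "y \<in> X" "h < norm (x - y)" "norm (x - y) \<le> 145/100 * h" for x y
    by (rule two_windows[OF _ _ _ _ \<Omega>(1) base1 that]) (use h E in auto)
  show ?thesis
  proof (cases "norm (x - y) \<le> 145/100 * h")
    case True
    then show ?thesis using one[OF xy(1-3)] E by linarith
  next
    case False
    have "d x y \<le> norm (x - y) + 8 * (8 * E)"
    proof (rule two_windows[OF _ _ _ _ \<Omega>(1)])
      show "d a b \<le> 145/100 * h + 8 * E" if "a \<in> \<Omega>" "b \<in> X" "norm (a - b) = 145/100 * h" for a b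
        using one[of a b] that \<Omega> closure_subset[of \<Omega>] h by auto
    qed (use h E xy False in auto)
    then show ?thesis by simp
  qed
qed

text \<open>The polygon is followed with an anchor \<open>a\<close>, the start of the piece not yet accounted for. As soon as the distance from \<open>a\<close> to the current
  vertex exceeds \<open>h\<close>, it is still at most \<open>2 h\<close>, and \<open>medium_distance\<close> allows to move the anchor. Edges much
  shorter than \<open>h\<close> are thus never measured individually.\<close>

lemma polygon_length:
  fixes N :: nat and p :: "nat \<Rightarrow> 'a"
  assumes \<Omega>: "X = closure \<Omega>" "open \<Omega>" and h: "h > 0" "3 * h \<le> r0" and E: "0 \<le> E" "E \<le> h / 100"
    and base: "\<And>x y. x \<in> \<Omega> \<Longrightarrow> y \<in> \<Omega> \<Longrightarrow> norm (x - y) = h \<Longrightarrow> d x y \<le> h + E"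
    and p: "p ` {0..N} \<subseteq> X" "\<And>i. i \<in> {1..N} \<Longrightarrow> norm (p (i - 1) - p i) \<le> h"
  shows "d (p 0) (p N) \<le> (1 + 64 * E / h) * (\<Sum>i=1..N. norm (p (i - 1) - p i)) + 2 * h"
proof -
  define A where "A = 1 + 64 * E / h"
  have A: "A \<ge> 1" using E h by (simp add: A_def)
  have inv: "n \<le> N \<Longrightarrow> \<exists>a\<in>X. norm (a - p n) \<le> h \<and> d (p 0) a + A * norm (a - p n) \<le> A * (\<Sum>i=1..n. norm (p (i - 1) - p i))"
    for n
  proof (induction n)
    case 0
    have "p 0 \<in> X" using p(1) by auto
    then show ?case using h by (intro bexI[of _ "p 0"]) auto
  next
    case (Suc n)
    then obtain a where a: "a \<in> X" "norm (a - p n) \<le> h"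
      "d (p 0) a + A * norm (a - p n) \<le> A * (\<Sum>i=1..n. norm (p (i - 1) - p i))" by auto
    have pX: "p 0 \<in> X" "p n \<in> X" "p (Suc n) \<in> X" using p(1) Suc.prems by auto
    have edge: "norm (p n - p (Suc n)) \<le> h" using p(2)[of "Suc n"] Suc.prems by simp
    have t: "norm (a - p (Suc n)) \<le> norm (a - p n) + norm (p n - p (Suc n))" by norm
    then have "A * norm (a - p (Suc n)) \<le> A * (norm (a - p n) + norm (p n - p (Suc n)))" using A by (intro mult_left_mono) auto
    then have new: "d (p 0) a + A * norm (a - p (Suc n)) \<le> A * (\<Sum>i=1..Suc n. norm (p (i - 1) - p i))"
      using a(3) by (simp add: algebra_simps)
    show ?case
    proof (cases "norm (a - p (Suc n)) \<le> h")
      case True then show ?thesis using a(1) new by blast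
    next
      case False
      have "d a (p (Suc n)) \<le> norm (a - p (Suc n)) + 64 * E"
        by (rule medium_distance[OF \<Omega> h E base a(1) pX(3)]) (use False t a edge in auto)
      also have "64 * E \<le> 64 * E / h * norm (a - p (Suc n))"
      proof -
        have "64 * E / h * h \<le> 64 * E / h * norm (a - p (Suc n))" using False E h by (intro mult_left_mono) auto
        then show ?thesis using h by simp
      qed
      finally have "d a (p (Suc n)) \<le> A * norm (a - p (Suc n))" by (simp add: A_def algebra_simps)
      then have "d (p 0) (p (Suc n)) \<le> A * (\<Sum>i=1..Suc n. norm (p (i - 1) - p i))"
        using new d_triangle[OF pX(1) a(1) pX(3)] by linarith
      then show ?thesis using pX(3) h by (intro bexI[of _ "p (Suc n)"]) auto
    qed
  qed
  obtain a where a: "a \<in> X" "norm (a - p N) \<le> h"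
    "d (p 0) a + A * norm (a - p N) \<le> A * (\<Sum>i=1..N. norm (p (i - 1) - p i))" using inv[of N] by auto
  have pX: "p 0 \<in> X" "p N \<in> X" using p(1) by auto
  have "d a (p N) \<le> 103/100 * norm (a - p N)" using local_d[OF a(1) pX(2)] a h by simp
  moreover have "0 \<le> A * norm (a - p N)" using A by simp
  moreover have "d (p 0) (p N) \<le> d (p 0) a + d a (p N)" using d_triangle pX a by blast
  ultimately show ?thesis using a h unfolding A_def[symmetric] by linarith
qed

end

section \<open>Graph distances\<close>

lemma graph_weight_nonneg:
  assumes "kernel_assumption \<eta> t0" "h > 0"
  shows "0 \<le> graph_weight \<eta> h x y"
proof -
  have "0 \<le> \<eta> (norm (x - y) / h)" if "x \<noteq> y" using assms that by (simp add: kernel_assumption_def)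
  then show ?thesis using assms by (auto simp: graph_weight_def scaled_kernel_def kernel_assumption_def)
qed

lemma graph_weight_sym: "graph_weight \<eta> h x y = graph_weight \<eta> h y x"
  by (simp add: graph_weight_def norm_minus_commute)

text \<open>The cost of an edge is at least its length since \<open>t \<eta> t\<close> is at most \<open>kernel_sup \<eta>\<close>; equality for \<open>t = t0\<close> gives the reverse bound
  of the next lemma.\<close>

lemma graph_weight_posD:
  assumes K: "kernel_assumption \<eta> t0" and h: "h > 0" and w: "graph_weight \<eta> h x y > 0"
  shows "x \<noteq> y" "norm (x - y) \<le> h" "norm (x - y) \<le> 1 / graph_weight \<eta> h x y"
proof -
  show xy: "x \<noteq> y" using w by (auto simp: graph_weight_def)
  define t where "t = norm (x - y) / h"
  have t: "t > 0" using xy h by (simp add: t_def)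
  have \<sigma>: "kernel_sup \<eta> > 0" using K by (simp add: kernel_assumption_def)
  have weq: "graph_weight \<eta> h x y = \<eta> t / (kernel_sup \<eta> * h)" using xy by (simp add: graph_weight_def scaled_kernel_def t_def)
  have \<eta>t: "\<eta> t > 0" using w weq \<sigma> h by (simp add: zero_less_divide_iff mult_less_0_iff)
  have "t \<in> closure {t. t > 0 \<and> \<eta> t \<noteq> 0}" using t \<eta>t closure_subset by fastforce
  then have "t \<le> 1" using K by (auto simp: kernel_assumption_def)
  then show "norm (x - y) \<le> h" using h by (simp add: t_def field_simps)
  have "t * \<eta> t \<le> kernel_sup \<eta>" unfolding kernel_sup_def
    by (rule cSUP_upper) (use t K in \<open>auto simp: kernel_assumption_def\<close>)
  then have "t * h \<le> kernel_sup \<eta> * h / \<eta> t" using \<eta>t h by (simp add: field_simps)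
  then show "norm (x - y) \<le> 1 / graph_weight \<eta> h x y" using weq h by (simp add: t_def)
qed

lemma graph_weight_near:
  assumes K: "kernel_assumption \<eta> t0" and h: "h > 0" and xy: "x \<noteq> y" "norm (x - y) \<le> t0 * h"
  shows "graph_weight \<eta> h x y > 0" "1 / graph_weight \<eta> h x y \<le> t0 * h"
proof -
  define t where "t = norm (x - y) / h"
  have t: "t > 0" "t \<le> t0" using xy h by (auto simp: t_def field_simps)
  have \<sigma>: "kernel_sup \<eta> > 0" and t0: "t0 > 0" and \<sigma>0: "kernel_sup \<eta> = t0 * \<eta> t0" and anti: "antimono_on {0<..} \<eta>"
    using K by (auto simp: kernel_assumption_def)
  have \<eta>0: "\<eta> t0 > 0" using \<sigma> \<sigma>0 t0 by (simp add: zero_less_mult_iff)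
  have \<eta>t: "\<eta> t0 \<le> \<eta> t" using anti t t0 by (auto simp: monotone_on_def)
  have weq: "graph_weight \<eta> h x y = \<eta> t / (kernel_sup \<eta> * h)" using xy by (simp add: graph_weight_def scaled_kernel_def t_def)
  show pos: "graph_weight \<eta> h x y > 0" using weq \<eta>t \<eta>0 \<sigma> h by simp
  have "kernel_sup \<eta> * h / \<eta> t \<le> kernel_sup \<eta> * h / \<eta> t0" using \<eta>t \<eta>0 \<sigma> h by (intro divide_left_mono) auto
  also have "\<dots> = t0 * h" using \<sigma>0 \<eta>0 by simp
  finally show "1 / graph_weight \<eta> h x y \<le> t0 * h" using weq by simp
qed

lemma graph_dist_le_path:
  fixes N :: nat and p :: "nat \<Rightarrow> 'a::euclidean_space"
  assumes "N \<ge> 1" "p ` {0..N} \<subseteq> Z" "\<And>i. i \<in> {1..N} \<Longrightarrow> graph_weight \<eta> h (p (i - 1)) (p i) > 0"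
  shows "graph_dist \<eta> h Z (p 0) (p N) \<le> ennreal (\<Sum>i=1..N. 1 / graph_weight \<eta> h (p (i - 1)) (p i))"
proof (cases "p 0 = p N")
  case True then show ?thesis by (simp add: graph_dist_def)
next
  case False
  have "(\<Sum>i=1..N. inverse (ennreal (graph_weight \<eta> h (p (i - 1)) (p i))))
      = (\<Sum>i=1..N. ennreal (1 / graph_weight \<eta> h (p (i - 1)) (p i)))"
    using assms(3) by (intro sum.cong) (auto simp: inverse_ennreal inverse_eq_divide)
  also have "\<dots> = ennreal (\<Sum>i=1..N. 1 / graph_weight \<eta> h (p (i - 1)) (p i))"
    using assms(3) by (intro sum_ennreal) (auto intro: less_imp_le)
  finally have eq: "(\<Sum>i=1..N. inverse (ennreal (graph_weight \<eta> h (p (i - 1)) (p i)))) = ennreal (\<Sum>i=1..N. 1 / graph_weight \<eta> h (p (i - 1)) (p i))" .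
  show ?thesis using False unfolding graph_dist_def
    by (simp only: if_False) (rule INF_lower2[of "(N, p)"], use assms(1,2) eq in auto)
qed

lemma graph_dist_less_path:
  assumes K: "kernel_assumption \<eta> t0" "h > 0" and xy: "x \<noteq> y" and lt: "graph_dist \<eta> h Z x y < ennreal c"
  shows "\<exists>(N::nat) p. N \<ge> 1 \<and> p ` {0..N} \<subseteq> Z \<and> p 0 = x \<and> p N = y \<and>
    (\<forall>i\<in>{1..N}. graph_weight \<eta> h (p (i - 1)) (p i) > 0) \<and>
    (\<Sum>i=1..N. 1 / graph_weight \<eta> h (p (i - 1)) (p i)) < c"
proof -
  obtain N :: nat and p where Np: "N \<ge> 1" "p ` {0..N} \<subseteq> Z" "p 0 = x" "p N = y"
    and s: "(\<Sum>i=1..N. inverse (ennreal (graph_weight \<eta> h (p (i - 1)) (p i)))) < ennreal c"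
    using lt xy unfolding graph_dist_def by (auto simp: INF_less_iff)
  have pos: "graph_weight \<eta> h (p (i - 1)) (p i) > 0" if i: "i \<in> {1..N}" for i
  proof (rule ccontr)
    assume "\<not> ?thesis"
    then have "graph_weight \<eta> h (p (i - 1)) (p i) = 0" using graph_weight_nonneg[OF K] by (metis order_le_less)
    then have "inverse (ennreal (graph_weight \<eta> h (p (i - 1)) (p i))) = top" by simp
    moreover have "inverse (ennreal (graph_weight \<eta> h (p (i - 1)) (p i))) \<le> (\<Sum>i=1..N. inverse (ennreal (graph_weight \<eta> h (p (i - 1)) (p i))))"
      using i by (intro member_le_sum) auto
    ultimately show False using s by (metis ennreal_less_top less_le_trans not_less_iff_gr_or_eq order_less_trans top.not_eq_extremum)
  qed
  have "(\<Sum>i=1..N. inverse (ennreal (graph_weight \<eta> h (p (i - 1)) (p i))))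
      = (\<Sum>i=1..N. ennreal (1 / graph_weight \<eta> h (p (i - 1)) (p i)))"
    using pos by (intro sum.cong) (auto simp: inverse_ennreal inverse_eq_divide)
  also have "\<dots> = ennreal (\<Sum>i=1..N. 1 / graph_weight \<eta> h (p (i - 1)) (p i))"
    using pos by (intro sum_ennreal) (auto intro: less_imp_le)
  finally have "ennreal (\<Sum>i=1..N. 1 / graph_weight \<eta> h (p (i - 1)) (p i)) < ennreal c" using s by simp
  moreover have "0 \<le> (\<Sum>i=1..N. 1 / graph_weight \<eta> h (p (i - 1)) (p i))"
    using pos by (intro sum_nonneg) (auto intro: less_imp_le)
  ultimately have "(\<Sum>i=1..N. 1 / graph_weight \<eta> h (p (i - 1)) (p i)) < c" by (simp add: ennreal_less_iff)
  then show ?thesis using Np pos by blast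
qed

lemma graph_dist_step:
  assumes K: "kernel_assumption \<eta> t0" "h > 0" and Z: "p \<in> Z" "q \<in> Z" "q' \<in> Z" and w: "graph_weight \<eta> h q q' > 0"
  shows "graph_dist \<eta> h Z p q' \<le> graph_dist \<eta> h Z p q + ennreal (1 / graph_weight \<eta> h q q')"
proof (cases "p = q")
  case True
  have "graph_dist \<eta> h Z ((\<lambda>i. if i = (0::nat) then q else q') 0) ((\<lambda>i. if i = (0::nat) then q else q') 1)
     \<le> ennreal (\<Sum>i=1..1. 1 / graph_weight \<eta> h ((\<lambda>i. if i = (0::nat) then q else q') (i - 1)) ((\<lambda>i. if i = (0::nat) then q else q') i))"
    by (rule graph_dist_le_path) (use Z w in auto)
  then show ?thesis using True by (simp add: graph_dist_def[of \<eta> h Z q q])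
next
  case False
  show ?thesis
  proof (rule ennreal_le_epsilon)
    fix e :: real assume fin: "graph_dist \<eta> h Z p q + ennreal (1 / graph_weight \<eta> h q q') < top" and e: "e > 0"
    define c where "c = enn2real (graph_dist \<eta> h Z p q)"
    have c: "graph_dist \<eta> h Z p q = ennreal c" "c \<ge> 0" using fin by (auto simp: c_def)
    have lt: "graph_dist \<eta> h Z p q < ennreal (c + e)" using c e by (simp add: ennreal_less_iff)
    obtain N :: nat and f where f: "N \<ge> 1" "f ` {0..N} \<subseteq> Z" "f 0 = p" "f N = q"
      "\<forall>i\<in>{1..N}. graph_weight \<eta> h (f (i - 1)) (f i) > 0"
      "(\<Sum>i=1..N. 1 / graph_weight \<eta> h (f (i - 1)) (f i)) < c + e"
      using graph_dist_less_path[OF K False lt] by blast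
    define g where "g = f(Suc N := q')"
    have gi: "g (i - 1) = f (i - 1)" "g i = f i" if "i \<in> {1..N}" for i using that by (auto simp: g_def)
    have gN: "g N = q" "g (Suc N) = q'" "g 0 = p" using f by (auto simp: g_def)
    have g: "graph_dist \<eta> h Z (g 0) (g (Suc N)) \<le> ennreal (\<Sum>i=1..Suc N. 1 / graph_weight \<eta> h (g (i - 1)) (g i))"
    proof (rule graph_dist_le_path)
      show "g ` {0..Suc N} \<subseteq> Z" using f(2) Z by (auto simp: g_def)
      fix i assume i: "i \<in> {1..Suc N}"
      show "graph_weight \<eta> h (g (i - 1)) (g i) > 0"
      proof (cases "i = Suc N")
        case True then show ?thesis using gN w by simp
      next
        case False then have "i \<in> {1..N}" using i by auto
        then show ?thesis using f(5) gi by metis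
      qed
    qed simp
    have "(\<Sum>i=1..Suc N. 1 / graph_weight \<eta> h (g (i - 1)) (g i)) = (\<Sum>i=1..N. 1 / graph_weight \<eta> h (f (i - 1)) (f i)) + 1 / graph_weight \<eta> h q q'"
    proof -
      have "(\<Sum>i=1..N. 1 / graph_weight \<eta> h (g (i - 1)) (g i)) = (\<Sum>i=1..N. 1 / graph_weight \<eta> h (f (i - 1)) (f i))"
        by (rule sum.cong) (use gi in auto)
      then show ?thesis using gN by simp
    qed
    also have "\<dots> \<le> c + 1 / graph_weight \<eta> h q q' + e" using f(6) by linarith
    finally have "graph_dist \<eta> h Z p q' \<le> ennreal (c + 1 / graph_weight \<eta> h q q' + e)"
      using g gN by (metis ennreal_leI order_trans)
    also have "\<dots> = graph_dist \<eta> h Z p q + ennreal (1 / graph_weight \<eta> h q q') + ennreal e"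
      using c e w by (simp add: ennreal_plus)
    finally show "graph_dist \<eta> h Z p q' \<le> graph_dist \<eta> h Z p q + ennreal (1 / graph_weight \<eta> h q q') + ennreal e" .
  qed
qed

lemma graph_dist_le_flip:
  assumes K: "kernel_assumption \<eta> t0" "h > 0"
  shows "graph_dist \<eta> h Z y x \<le> graph_dist \<eta> h Z x y"
proof (cases "x = y")
  case False
  show ?thesis
  proof (rule dense_ge)
    fix e assume e: "graph_dist \<eta> h Z x y < e"
    show "graph_dist \<eta> h Z y x \<le> e"
    proof (cases e)
      case (real c)
      obtain N :: nat and f where f: "N \<ge> 1" "f ` {0..N} \<subseteq> Z" "f 0 = x" "f N = y"
        "\<forall>i\<in>{1..N}. graph_weight \<eta> h (f (i - 1)) (f i) > 0"
        "(\<Sum>i=1..N. 1 / graph_weight \<eta> h (f (i - 1)) (f i)) < c"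
        using graph_dist_less_path[OF K False e[unfolded real(2)]] by blast
      define g where "g i = f (N - i)" for i
      have gw: "graph_weight \<eta> h (g (i - 1)) (g i) = graph_weight \<eta> h (f (N + 1 - i - 1)) (f (N + 1 - i))" if "i \<in> {1..N}" for i
        using that graph_weight_sym[of \<eta> h "f (Suc (N - i))" "f (N - i)"] by (simp add: g_def Suc_diff_le)
      have "graph_dist \<eta> h Z (g 0) (g N) \<le> ennreal (\<Sum>i=1..N. 1 / graph_weight \<eta> h (g (i - 1)) (g i))"
      proof (rule graph_dist_le_path[OF f(1)])
        show "g ` {0..N} \<subseteq> Z" using f(2) by (auto simp: g_def)
        fix i assume i: "i \<in> {1..N}"
        then show "graph_weight \<eta> h (g (i - 1)) (g i) > 0" unfolding gw[OF i] by (intro bspec[OF f(5)]) auto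
      qed
      also have "(\<Sum>i=1..N. 1 / graph_weight \<eta> h (g (i - 1)) (g i)) = (\<Sum>i=1..N. 1 / graph_weight \<eta> h (f (i - 1)) (f i))"
        by (rule sum.reindex_bij_witness[of _ "\<lambda>i. N + 1 - i" "\<lambda>i. N + 1 - i"]) (auto simp: gw simp del: One_nat_def)
      finally have "graph_dist \<eta> h Z y x \<le> ennreal (\<Sum>i=1..N. 1 / graph_weight \<eta> h (f (i - 1)) (f i))"
        using f by (simp add: g_def)
      also have "\<dots> \<le> ennreal c" using f(6) by (intro ennreal_leI) simp
      finally show ?thesis using real by simp
    qed simp
  qed
qed simp

lemma graph_dist_sym: "kernel_assumption \<eta> t0 \<Longrightarrow> h > 0 \<Longrightarrow> graph_dist \<eta> h Z x y = graph_dist \<eta> h Z y x"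
  by (intro antisym graph_dist_le_flip)

text \<open>The infimum over paths is governed by the last edge, and there are finitely many choices for it.\<close>

lemma graph_dist_pred:
  assumes K: "kernel_assumption \<eta> t0" "h > 0" and Z: "finite Z" "q \<in> Z" and pq: "p \<noteq> q"
    and fin: "\<And>x y. x \<in> Z \<Longrightarrow> y \<in> Z \<Longrightarrow> graph_dist \<eta> h Z x y < \<infinity>" and p: "p \<in> Z"
  obtains q' where "q' \<in> Z" "graph_weight \<eta> h q' q > 0"
    "enn2real (graph_dist \<eta> h Z p q') + 1 / graph_weight \<eta> h q' q \<le> enn2real (graph_dist \<eta> h Z p q)"
proof -
  let ?d = "\<lambda>q. enn2real (graph_dist \<eta> h Z p q)"
  have eq: "graph_dist \<eta> h Z p x = ennreal (?d x)" if "x \<in> Z" for x using fin[OF p that] by simp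
  have "\<exists>q'\<in>Z. graph_weight \<eta> h q' q > 0 \<and> ?d q' + 1 / graph_weight \<eta> h q' q \<le> ?d q"
  proof (rule ccontr)
  assume no: "\<not> ?thesis"
  define A where "A = {q'\<in>Z. graph_weight \<eta> h q' q > 0}"
  have gt: "?d q' + 1 / graph_weight \<eta> h q' q > ?d q" if "q' \<in> A" for q'
    using no that by (auto simp: A_def not_le)
  have "finite A" using Z by (simp add: A_def)
  define c where "c = Min (insert (?d q + 1) ((\<lambda>q'. ?d q' + 1 / graph_weight \<eta> h q' q) ` A))"
  have c: "?d q < c" using gt \<open>finite A\<close> by (auto simp: c_def Min_gr_iff)
  have cA: "c \<le> ?d q' + 1 / graph_weight \<eta> h q' q" if "q' \<in> A" for q'
    unfolding c_def using that \<open>finite A\<close> by (intro Min_le) auto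
  have lt: "graph_dist \<eta> h Z p q < ennreal c" using c eq[OF Z(2)] by (metis ennreal_less_iff enn2real_nonneg)
  obtain N :: nat and f where f: "N \<ge> 1" "f ` {0..N} \<subseteq> Z" "f 0 = p" "f N = q"
    "\<forall>i\<in>{1..N}. graph_weight \<eta> h (f (i - 1)) (f i) > 0"
    "(\<Sum>i=1..N. 1 / graph_weight \<eta> h (f (i - 1)) (f i)) < c"
    using graph_dist_less_path[OF K pq lt] by blast
  have q': "f (N - 1) \<in> A" using f(1,2,4) bspec[OF f(5), of N] by (auto simp: A_def)
  have "?d (f (N - 1)) \<le> (\<Sum>i=1..N-1. 1 / graph_weight \<eta> h (f (i - 1)) (f i))"
  proof (cases "N = 1")
    case True
    then show ?thesis using f by (simp add: graph_dist_def)
  next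
    case False
    have "graph_dist \<eta> h Z (f 0) (f (N - 1)) \<le> ennreal (\<Sum>i=1..N-1. 1 / graph_weight \<eta> h (f (i - 1)) (f i))"
      using False f(1,2,5) by (intro graph_dist_le_path) auto
    moreover have "0 \<le> (\<Sum>i=1..N-1. 1 / graph_weight \<eta> h (f (i - 1)) (f i))"
      using graph_weight_nonneg[OF K] by (intro sum_nonneg) auto
    ultimately show ?thesis using f(3) by (metis enn2real_leI)
  qed
  moreover have "(\<Sum>i=1..N. 1 / graph_weight \<eta> h (f (i - 1)) (f i)) = (\<Sum>i=1..N-1. 1 / graph_weight \<eta> h (f (i - 1)) (f i)) + 1 / graph_weight \<eta> h (f (N - 1)) q"
    using f(1,4) by (cases N) auto
  ultimately show False using f(6) cA[OF q'] by linarith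
  qed
  then show thesis using that by blast
qed

section \<open>Steepest ascent on a graph\<close>

text \<open>The two rules characterize a shortest path distance with edge costs \<open>1 / w\<close>: an edge can be appended to a path, and every vertex has a
  predecessor on a shortest path.\<close>

locale graph_metric =
  fixes Z :: "'v set" and w :: "'v \<Rightarrow> 'v \<Rightarrow> real" and dn :: "'v \<Rightarrow> 'v \<Rightarrow> real"
  assumes finite_Z: "finite Z"
    and w_sym: "w x y = w y x"
    and dn_refl: "dn x x = 0" and dn_sym: "dn x y = dn y x" and dn_nonneg: "dn x y \<ge> 0"
    and dn_step: "\<lbrakk>p \<in> Z; q \<in> Z; q' \<in> Z; w q q' > 0\<rbrakk> \<Longrightarrow> dn p q' \<le> dn p q + 1 / w q q'"
    and dn_pred: "\<lbrakk>p \<in> Z; q \<in> Z; p \<noteq> q\<rbrakk> \<Longrightarrow> \<exists>q'\<in>Z. w q' q > 0 \<and> dn p q' + 1 / w q' q \<le> dn p q"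
begin

text \<open>One half of the graph equation: away from \<open>Y\<close>, some edge ascends at least as steeply as any edge descends. The other half
  is this property for \<open>- v\<close>.\<close>

definition steep_ascent :: "'v set \<Rightarrow> ('v \<Rightarrow> real) \<Rightarrow> bool" where
  "steep_ascent Y v \<longleftrightarrow> (\<forall>x\<in>Z - Y. \<forall>y\<in>Z. w x y > 0 \<and> v y < v x \<longrightarrow>
     (\<exists>y'\<in>Z. w x y' > 0 \<and> w x y * (v x - v y) \<le> w x y' * (v y' - v x)))"

text \<open>Let \<open>q\<close> beat its predecessor on a shortest path from \<open>p\<close> in the function \<open>v - \<kappa> * dn p\<close>. Then \<open>v\<close> descends towards the predecessor with slope at
  least \<open>\<kappa>\<close>, so it ascends with slope at least \<open>\<kappa>\<close> to another neighbour, while the cone grows with slope at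
  most \<open>\<kappa>\<close>.\<close>

lemma ascent_step:
  assumes v: "steep_ascent Y v" and pq: "p \<in> Z" "q \<in> Z - Y" "p \<noteq> q" and \<kappa>: "\<kappa> > 0"
    and max: "\<And>r. r \<in> Z \<Longrightarrow> dn p r < dn p q \<Longrightarrow> v r - \<kappa> * dn p r \<le> v q - \<kappa> * dn p q"
  shows "\<exists>q'\<in>Z. w q q' > 0 \<and> v q < v q' \<and> v q - \<kappa> * dn p q \<le> v q' - \<kappa> * dn p q'"
proof -
  obtain r where r: "r \<in> Z" "w r q > 0" "dn p r + 1 / w r q \<le> dn p q" using dn_pred[of p q] pq by auto
  have pos: "1 / w r q > 0" using r by simp
  have "dn p r < dn p q" using r(3) pos by linarith
  then have "v r - \<kappa> * dn p r \<le> v q - \<kappa> * dn p q" by (rule max[OF r(1)])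
  moreover have "\<kappa> * (dn p r + 1 / w r q) \<le> \<kappa> * dn p q" using \<kappa> r by (intro mult_left_mono) auto
  ultimately have drop: "\<kappa> * (1 / w r q) \<le> v q - v r" by (simp add: algebra_simps)
  have slope: "\<kappa> \<le> w q r * (v q - v r)" using drop r(2) w_sym[of q r] by (simp add: field_simps)
  have "v r < v q" using drop \<kappa> pos mult_pos_pos[OF \<kappa> pos] by linarith
  moreover have "q \<in> Z - Y" "w q r > 0" using pq r w_sym[of q r] by auto
  ultimately obtain q' where q': "q' \<in> Z" "w q q' > 0" "w q r * (v q - v r) \<le> w q q' * (v q' - v q)"
    using v r(1) unfolding steep_ascent_def by blast
  have up: "\<kappa> \<le> w q q' * (v q' - v q)" using slope q' by linarith
  then have "w q q' * (v q' - v q) > 0" using \<kappa> by linarith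
  then have lt: "v q < v q'" using q' by (simp add: zero_less_mult_iff)
  have "\<kappa> * (1 / w q q') \<le> v q' - v q" using up q' by (simp add: field_simps)
  moreover have "\<kappa> * dn p q' \<le> \<kappa> * (dn p q + 1 / w q q')"
    using dn_step[of p q q'] pq q' \<kappa> by (intro mult_left_mono) auto
  ultimately have "v q - \<kappa> * dn p q \<le> v q' - \<kappa> * dn p q'" by (simp add: algebra_simps)
  then show ?thesis using q'(1,2) lt by blast
qed

text \<open>Breaking ties by \<open>v\<close> excludes that an ascent from the maximizer leads to another maximizer.\<close>

lemma lexicographic_max:
  fixes f v :: "'v \<Rightarrow> real"
  assumes "finite A" "A \<noteq> {}"
  obtains q where "q \<in> A" "\<And>r. r \<in> A \<Longrightarrow> f r \<le> f q" "\<And>r. r \<in> A \<Longrightarrow> f q \<le> f r \<Longrightarrow> v r \<le> v q"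
proof -
  define B where "B = {q\<in>A. f q = Max (f ` A)}"
  have "Max (f ` A) \<in> f ` A" using assms by (intro Max_in) auto
  then obtain q0 where "q0 \<in> A" "f q0 = Max (f ` A)" by (metis imageE)
  then have B: "finite B" "B \<noteq> {}" using assms by (auto simp: B_def)
  have "Max (v ` B) \<in> v ` B" using B by (intro Max_in) auto
  then obtain q where q: "q \<in> B" "v q = Max (v ` B)" by auto
  have mx: "f r \<le> f q" if "r \<in> A" for r using that q assms by (auto simp: B_def)
  show thesis
  proof (rule that[of q])
    show "q \<in> A" using q by (simp add: B_def)
    fix r assume r: "r \<in> A"
    show "f r \<le> f q" using mx r .
    assume "f q \<le> f r"
    then have "r \<in> B" using r mx[OF r] q by (auto simp: B_def)
    then show "v r \<le> v q" using q B by simp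
  qed
qed

text \<open>By \<open>ascent_step\<close> the maximum of \<open>v - \<kappa> * dn p\<close> is taken at \<open>p\<close> or at a label. For a label \<open>p\<close> this bounds \<open>v\<close> against
  the labels on both sides, and these bounds treat an arbitrary \<open>p\<close>.\<close>

lemma Lipschitz_bound:
  assumes v: "steep_ascent Y v" and v': "steep_ascent Y (\<lambda>x. - v x)" and Y: "Y \<subseteq> Z" and \<kappa>: "\<kappa> > 0"
    and lip: "\<And>z z'. z \<in> Y \<Longrightarrow> z' \<in> Y \<Longrightarrow> \<bar>v z - v z'\<bar> \<le> \<kappa> * dn z z'"
    and pq: "p \<in> Z" "q \<in> Z"
  shows "\<bar>v p - v q\<bar> \<le> \<kappa> * dn p q"
proof -
  have gen: "u q \<le> u p + \<kappa> * dn p q"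
    if u: "steep_ascent Y u" and lab: "\<And>z. z \<in> Y \<Longrightarrow> u z \<le> u p + \<kappa> * dn p z" and p: "p \<in> Z" and q: "q \<in> Z" for u p q
  proof -
    obtain m where m: "m \<in> Z" "\<And>r. r \<in> Z \<Longrightarrow> u r - \<kappa> * dn p r \<le> u m - \<kappa> * dn p m"
      "\<And>r. r \<in> Z \<Longrightarrow> u m - \<kappa> * dn p m \<le> u r - \<kappa> * dn p r \<Longrightarrow> u r \<le> u m"
      by (rule lexicographic_max[OF finite_Z, where f = "\<lambda>r. u r - \<kappa> * dn p r" and v = u]) (use p in blast)+
    have "m = p \<or> m \<in> Y"
    proof (rule ccontr)
      assume nm: "\<not> ?thesis"
      have mY: "m \<in> Z - Y" "p \<noteq> m" using m(1) nm by auto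
      obtain q' where "q' \<in> Z" "u m < u q'" "u m - \<kappa> * dn p m \<le> u q' - \<kappa> * dn p q'"
        using ascent_step[OF u p mY \<kappa> m(2)] by blast
      then show False using m(3) by fastforce
    qed
    then have "u m - \<kappa> * dn p m \<le> u p" using lab dn_refl by fastforce
    then show ?thesis using m(2)[OF q] by linarith
  qed
  have 1: "v q \<le> v z + \<kappa> * dn z q" if "z \<in> Y" "q \<in> Z" for z q
    by (rule gen[OF v]) (use that Y lip dn_sym in \<open>force simp: abs_le_iff\<close>)+
  have 2: "- v q \<le> - v z + \<kappa> * dn z q" if "z \<in> Y" "q \<in> Z" for z q
    by (rule gen[OF v']) (use that Y lip dn_sym in \<open>force simp: abs_le_iff\<close>)+
  have 3: "v q \<le> v p + \<kappa> * dn p q" if "p \<in> Z" "q \<in> Z" for p q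
    by (rule gen[OF v]) (use that 2 dn_sym in force)+
  show ?thesis using 3[OF pq] 3[OF pq(2,1)] dn_sym[of p q] by (simp add: abs_le_iff)
qed

text \<open>The discrete form of \<open>slope_bound\<close>: if \<open>v\<close> rises with average slope \<open>\<kappa>\<close> from \<open>p\<close> to some \<open>p1\<close>, it continues to do so up to
  distance \<open>\<rho>\<close>. A maximizer of \<open>v - \<kappa> * dn p\<close> in the ball, with ties broken by \<open>v\<close>, has by \<open>ascent_step\<close> a
  neighbour with no smaller value and larger \<open>v\<close>, which must lie outside the ball.\<close>

lemma ascent_growth:
  assumes v: "steep_ascent Y v" and p: "p \<in> Z" and \<kappa>: "\<kappa> > 0"
    and Y: "\<And>q. q \<in> Z \<Longrightarrow> dn p q < \<rho> \<Longrightarrow> q \<notin> Y"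
    and p1: "p1 \<in> Z" "dn p p1 < \<rho>" "v p + \<kappa> * dn p p1 \<le> v p1" "v p < v p1"
  obtains q0 q where "q0 \<in> Z" "dn p q0 < \<rho>" "q \<in> Z" "w q0 q > 0" "v p + \<kappa> * \<rho> \<le> v q"
proof -
  define A where "A = {q\<in>Z. dn p q < \<rho>}"
  have fA: "finite A" "p1 \<in> A" using finite_Z p1 by (auto simp: A_def)
  obtain m where m: "m \<in> A" "\<And>r. r \<in> A \<Longrightarrow> v r - \<kappa> * dn p r \<le> v m - \<kappa> * dn p m"
    "\<And>r. r \<in> A \<Longrightarrow> v m - \<kappa> * dn p m \<le> v r - \<kappa> * dn p r \<Longrightarrow> v r \<le> v m"
    by (rule lexicographic_max[OF fA(1), where f = "\<lambda>r. v r - \<kappa> * dn p r" and v = v]) (use fA(2) in blast)+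
  have mZ: "m \<in> Z" "dn p m < \<rho>" using m by (auto simp: A_def)
  have pm: "v p \<le> v m - \<kappa> * dn p m" using m(2)[OF fA(2)] p1(3) by linarith
  have pm': "p \<noteq> m"
  proof
    assume "p = m"
    then have "v p1 \<le> v p" using m(3)[OF fA(2)] p1(3) dn_refl by auto
    then show False using p1(4) by simp
  qed
  have mY: "m \<in> Z - Y" using mZ Y by auto
  have mx: "v r - \<kappa> * dn p r \<le> v m - \<kappa> * dn p m" if "r \<in> Z" "dn p r < dn p m" for r
    using m(2)[of r] that mZ by (simp add: A_def)
  obtain q where q: "q \<in> Z" "w m q > 0" "v m < v q" "v m - \<kappa> * dn p m \<le> v q - \<kappa> * dn p q"
    using ascent_step[OF v p mY pm' \<kappa> mx] by blast
  have "q \<notin> A" using m(3)[of q] q by auto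
  then have "\<rho> \<le> dn p q" using q by (simp add: A_def)
  then have "\<kappa> * \<rho> \<le> \<kappa> * dn p q" using \<kappa> by (intro mult_left_mono) auto
  then show thesis using that[OF mZ q(1,2)] pm q(4) by linarith
qed

end

section \<open>A graph in a domain\<close>

text \<open>A finite vertex set that is \<open>\<delta>\<close>-dense in the domain, with \<open>\<delta>\<close> at most a quarter of \<open>t0 h\<close>, the largest
  length at which the cost of an edge equals its length.\<close>

locale graph_domain = length_domain X d r0
  for X :: "'a::euclidean_space set" and d r0 +
  fixes \<Omega> Z :: "'a set" and \<eta> :: "real \<Rightarrow> real" and t0 h \<delta> :: real
  assumes X_closure: "X = closure \<Omega>" and open_domain: "open \<Omega>"
    and kernel: "kernel_assumption \<eta> t0" and h: "h > 0"
    and Z: "finite Z" "Z \<subseteq> X"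
    and cover: "x \<in> X \<Longrightarrow> \<exists>p\<in>Z. norm (x - p) \<le> \<delta>"
    and \<delta>: "0 \<le> \<delta>" "\<delta> \<le> t0 * h / 4"
begin

lemma t0: "0 < t0" "t0 \<le> 1" using kernel by (auto simp: kernel_assumption_def)

lemma \<delta>_le: "\<delta> \<le> h / 4" using \<delta> t0 h mult_right_mono[of t0 1 h] by linarith

abbreviation "wt \<equiv> graph_weight \<eta> h"

definition dn :: "'a \<Rightarrow> 'a \<Rightarrow> real" where "dn x y = enn2real (graph_dist \<eta> h Z x y)"

text \<open>Points at successive distances below \<open>t0 h - 2 \<delta>\<close> on a geodesic are replaced by nearby vertices; the edges
  between these are at most \<open>t0 h\<close> long and cost at most \<open>t0 h\<close>.\<close>

lemma graph_dist_chain: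
  assumes "y \<in> X" "y' \<in> X" "p \<in> Z" "q \<in> Z" "norm (y - p) \<le> \<delta>" "norm (y' - q) \<le> \<delta>"
    "d y y' < real n * (t0 * h - 2 * \<delta>)"
  shows "graph_dist \<eta> h Z p q \<le> ennreal (real n * (t0 * h))"
  using assms
proof (induction n arbitrary: y' q)
  case 0
  then show ?case using d_nonneg[of y y'] by simp
next
  case (Suc n)
  have th: "t0 * h > 0" using t0 h by simp
  define l where "l = t0 * h - 2 * \<delta>"
  have l: "l > 0" using \<delta> th by (simp add: l_def)
  show ?case
  proof (cases "n = 0")
    case True
    have "norm (p - q) \<le> norm (y - p) + (norm (y - y') + norm (y' - q))" by norm
    then have "norm (p - q) \<le> t0 * h" using norm_le_d[OF Suc.prems(1,2)] Suc.prems True by simp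
    show ?thesis
    proof (cases "p = q")
      case True then show ?thesis by (simp add: graph_dist_def)
    next
      case False
      note w = graph_weight_near[OF kernel h False \<open>norm (p - q) \<le> t0 * h\<close>]
      have "graph_dist \<eta> h Z p q \<le> graph_dist \<eta> h Z p p + ennreal (1 / wt p q)"
        by (rule graph_dist_step[OF kernel h]) (use Suc.prems w in auto)
      also have "\<dots> \<le> ennreal (t0 * h)" using w by (simp add: graph_dist_def ennreal_leI)
      finally show ?thesis using True by simp
    qed
  next
    case False
    have less: "d y y' < real n * l + l" using Suc.prems by (simp add: l_def algebra_simps)
    obtain y'' where y'': "y'' \<in> X" "d y y'' < real n * l" "d y'' y' < l"
      by (rule split_less[OF Suc.prems(1,2) less]) (use False l in auto)
    obtain p'' where p'': "p'' \<in> Z" "norm (y'' - p'') \<le> \<delta>" using cover[OF y''(1)] by blast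
    have IH: "graph_dist \<eta> h Z p p'' \<le> ennreal (real n * (t0 * h))"
      by (rule Suc.IH[OF _ y''(1)]) (use Suc.prems y'' p'' in \<open>auto simp: l_def\<close>)
    have "norm (p'' - q) \<le> norm (y'' - p'') + (norm (y'' - y') + norm (y' - q))" by norm
    then have near: "norm (p'' - q) \<le> t0 * h" using norm_le_d[OF y''(1) Suc.prems(2)] p'' y'' Suc.prems by (simp add: l_def)
    have eq: "ennreal (real n * (t0 * h)) + ennreal (t0 * h) = ennreal (real (Suc n) * (t0 * h))"
    proof -
      have "0 \<le> real n * (t0 * h)" using t0 h by simp
      then have "ennreal (real n * (t0 * h)) + ennreal (t0 * h) = ennreal (real n * (t0 * h) + t0 * h)"
        using th by (intro ennreal_plus[symmetric]) auto
      also have "real n * (t0 * h) + t0 * h = real (Suc n) * (t0 * h)" by (simp add: algebra_simps)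
      finally show ?thesis .
    qed
    show ?thesis
    proof (cases "p'' = q")
      case True
      have "ennreal (real n * (t0 * h)) \<le> ennreal (real (Suc n) * (t0 * h))"
        using th by (intro ennreal_leI mult_right_mono) auto
      then show ?thesis using IH True by (meson order_trans)
    next
      case False
      note w = graph_weight_near[OF kernel h False near]
      have "graph_dist \<eta> h Z p q \<le> graph_dist \<eta> h Z p p'' + ennreal (1 / wt p'' q)"
        by (rule graph_dist_step[OF kernel h]) (use Suc.prems p'' w in auto)
      also have "\<dots> \<le> ennreal (real n * (t0 * h)) + ennreal (t0 * h)"
        using IH w by (intro add_mono ennreal_leI) auto
      finally show ?thesis using eq by simp
    qed
  qed
qed

lemma graph_dist_upper:
  assumes "p \<in> Z" "q \<in> Z"
  shows "graph_dist \<eta> h Z p q < \<infinity>" "dn p q \<le> (1 + 4 * \<delta> / (t0 * h)) * d p q + h"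
proof -
  have pq: "p \<in> X" "q \<in> X" using assms Z by auto
  have th: "t0 * h > 0" using t0 h by simp
  define l where "l = t0 * h - 2 * \<delta>"
  have l: "l > 0" "l \<ge> t0 * h / 2" using \<delta> th by (simp_all add: l_def mult.commute)
  define n where "n = nat \<lfloor>d p q / l\<rfloor> + 1"
  have D: "0 \<le> d p q / l" using d_nonneg[OF pq] l by simp
  have n: "d p q / l < real n" "real n \<le> d p q / l + 1"
  proof -
    have "real n = of_int \<lfloor>d p q / l\<rfloor> + 1" using D by (simp add: n_def)
    then show "d p q / l < real n" "real n \<le> d p q / l + 1" by linarith+
  qed
  have "d p q < real n * l" using n(1) l by (simp add: field_simps)
  then have g: "graph_dist \<eta> h Z p q \<le> ennreal (real n * (t0 * h))"
    unfolding l_def by (intro graph_dist_chain[OF pq assms]) (use \<delta> in simp_all)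
  then show "graph_dist \<eta> h Z p q < \<infinity>" by (simp add: order_le_less_trans)
  have "dn p q \<le> real n * (t0 * h)"
    unfolding dn_def using g th by (intro enn2real_leI) auto
  also have "\<dots> \<le> (d p q / l + 1) * (t0 * h)" using n th by (intro mult_right_mono) auto
  also have "\<dots> = d p q * (t0 * h / l) + t0 * h" by (simp add: algebra_simps)
  also have "\<dots> \<le> d p q * (1 + 4 * \<delta> / (t0 * h)) + h"
  proof (intro add_mono mult_left_mono d_nonneg pq)
    have "t0 * h * (t0 * h) \<le> (t0 * h + 4 * \<delta>) * l"
    proof -
      have "(t0 * h + 4 * \<delta>) * l = t0 * h * (t0 * h) + 2 * \<delta> * (t0 * h - 4 * \<delta>)" by (simp add: l_def algebra_simps)
      moreover have "0 \<le> t0 * h - 4 * \<delta>" using \<delta> by linarith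
      then have "0 \<le> 2 * \<delta> * (t0 * h - 4 * \<delta>)" using \<delta>(1) by simp
      ultimately show ?thesis by linarith
    qed
    then have "t0 * h \<le> (t0 * h + 4 * \<delta>) * l / (t0 * h)" unfolding pos_le_divide_eq[OF th] .
    also have "\<dots> = (t0 * h + 4 * \<delta>) / (t0 * h) * l" by simp
    also have "(t0 * h + 4 * \<delta>) / (t0 * h) = 1 + 4 * \<delta> / (t0 * h)" using t0 h by (simp add: add_divide_distrib)
    finally show "t0 * h / l \<le> 1 + 4 * \<delta> / (t0 * h)" unfolding pos_divide_le_eq[OF l(1)] .
    show "t0 * h \<le> h" using t0 h by simp
  qed
  finally show "dn p q \<le> (1 + 4 * \<delta> / (t0 * h)) * d p q + h" by (simp add: mult.commute)
qed

lemma graph_metric: "graph_metric Z wt dn"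
proof
  show "finite Z" by (rule Z)
  show "wt x y = wt y x" for x y by (rule graph_weight_sym)
  show "dn x x = 0" for x by (simp add: dn_def graph_dist_def)
  show "dn x y = dn y x" for x y unfolding dn_def using graph_dist_sym[OF kernel h] by metis
  show "dn x y \<ge> 0" for x y by (simp add: dn_def)
  show "dn p q' \<le> dn p q + 1 / wt q q'" if "p \<in> Z" "q \<in> Z" "q' \<in> Z" "wt q q' > 0" for p q q'
  proof -
    have "graph_dist \<eta> h Z p q = ennreal (dn p q)" using graph_dist_upper(1)[OF that(1,2)] by (simp add: dn_def)
    then have "graph_dist \<eta> h Z p q' \<le> ennreal (dn p q) + ennreal (1 / wt q q')"
      using graph_dist_step[OF kernel h that] by simp
    also have "\<dots> = ennreal (dn p q + 1 / wt q q')" using that by (intro ennreal_plus[symmetric]) (auto simp: dn_def)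
    finally show ?thesis unfolding dn_def[of p q'] using that by (intro enn2real_leI) (auto simp: dn_def)
  qed
  show "\<exists>q'\<in>Z. wt q' q > 0 \<and> dn p q' + 1 / wt q' q \<le> dn p q" if "p \<in> Z" "q \<in> Z" "p \<noteq> q" for p q
    using graph_dist_pred[OF kernel h Z(1) that(2,3) graph_dist_upper(1) that(1)] unfolding dn_def by metis
qed

sublocale G: graph_metric Z wt dn by (rule graph_metric)

lemma graph_dist_lower:
  assumes small: "3 * h \<le> r0" "0 \<le> E" "E \<le> h / 100"
    and base: "\<And>x y. x \<in> \<Omega> \<Longrightarrow> y \<in> \<Omega> \<Longrightarrow> norm (x - y) = h \<Longrightarrow> d x y \<le> h + E"
    and pq: "p \<in> Z" "q \<in> Z"
  shows "d p q \<le> (1 + 64 * E / h) * dn p q + 2 * h"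
proof (cases "p = q")
  case True
  have "d p q = 0" using True pq Z by auto
  moreover have "0 \<le> (1 + 64 * E / h) * dn p q"
    using small h G.dn_nonneg by (intro mult_nonneg_nonneg) auto
  ultimately show ?thesis using h by linarith
next
  case False
  define A where "A = 1 + 64 * E / h"
  have A: "A \<ge> 1" using small h by (simp add: A_def)
  show ?thesis unfolding A_def[symmetric]
  proof (rule field_le_epsilon)
    fix e :: real assume e: "e > 0"
    have "graph_dist \<eta> h Z p q = ennreal (dn p q)" using graph_dist_upper(1)[OF pq] by (simp add: dn_def)
    then have lt: "graph_dist \<eta> h Z p q < ennreal (dn p q + e / A)"
      using e A G.dn_nonneg[of p q] by (simp add: ennreal_less_iff)
    obtain N :: nat and f where f: "N \<ge> 1" "f ` {0..N} \<subseteq> Z" "f 0 = p" "f N = q"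
      "\<forall>i\<in>{1..N}. wt (f (i - 1)) (f i) > 0" "(\<Sum>i=1..N. 1 / wt (f (i - 1)) (f i)) < dn p q + e / A"
      using graph_dist_less_path[OF kernel h False lt] by blast
    have "d (f 0) (f N) \<le> A * (\<Sum>i=1..N. norm (f (i - 1) - f i)) + 2 * h"
      unfolding A_def
    proof (rule polygon_length[OF X_closure open_domain h small base])
      show "f ` {0..N} \<subseteq> X" using f(2) Z by auto
      show "norm (f (i - 1) - f i) \<le> h" if "i \<in> {1..N}" for i
        using graph_weight_posD(2)[OF kernel h] f(5) that by blast
    qed
    then have "d p q \<le> A * (\<Sum>i=1..N. norm (f (i - 1) - f i)) + 2 * h" using f(3,4) by simp
    moreover have "(\<Sum>i=1..N. norm (f (i - 1) - f i)) \<le> (\<Sum>i=1..N. 1 / wt (f (i - 1)) (f i))"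
      using graph_weight_posD(3)[OF kernel h] f(5) by (intro sum_mono) blast
    then have "A * (\<Sum>i=1..N. norm (f (i - 1) - f i)) \<le> A * (dn p q + e / A)" using A f(6) by (intro mult_left_mono) auto
    moreover have "A * (dn p q + e / A) = A * dn p q + e" using A by (simp add: algebra_simps)
    ultimately show "d p q \<le> A * dn p q + 2 * h + e" by linarith
  qed
qed

definition vertex_max :: "('a \<Rightarrow> real) \<Rightarrow> real \<Rightarrow> 'a \<Rightarrow> real" where
  "vertex_max v \<epsilon> x = Max (v ` {p\<in>Z. d x p \<le> \<epsilon>})"

lemma near_vertex:
  assumes "x \<in> X" "2 * \<delta> \<le> \<epsilon>" "\<delta> \<le> r0"
  obtains p where "p \<in> Z" "d x p \<le> 2 * \<delta>" "d x p \<le> \<epsilon>"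
proof -
  obtain p where p: "p \<in> Z" "norm (x - p) \<le> \<delta>" using cover assms by blast
  then have "d x p \<le> 103/100 * norm (x - p)" using assms Z by (intro local_d) auto
  then have "d x p \<le> 2 * \<delta>" using p \<delta> by linarith
  then show thesis using that p assms by auto
qed

lemma vertex_max_ge: "p \<in> Z \<Longrightarrow> d x p \<le> \<epsilon> \<Longrightarrow> v p \<le> vertex_max v \<epsilon> x"
  unfolding vertex_max_def using Z by (intro Max_ge) auto

lemma vertex_max_attained:
  assumes "x \<in> X" "2 * \<delta> \<le> \<epsilon>" "\<delta> \<le> r0"
  obtains p where "p \<in> Z" "d x p \<le> \<epsilon>" "vertex_max v \<epsilon> x = v p"
proof -
  obtain p where "p \<in> Z" "d x p \<le> \<epsilon>" using near_vertex[OF assms] by blast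
  then have "Max (v ` {p\<in>Z. d x p \<le> \<epsilon>}) \<in> v ` {p\<in>Z. d x p \<le> \<epsilon>}" using Z by (intro Max_in) auto
  then show thesis using that unfolding vertex_max_def by auto
qed

text \<open>The analogue of \<open>ball_max_subsolution\<close> on the graph. From a vertex \<open>px\<close> near \<open>x\<close> the maximum \<open>p1\<close> over the \<open>\<epsilon>\<close>-ball is reached at
  graph distance at most \<open>\<rho>1\<close>, and the graph ball of radius \<open>\<rho>\<close> around \<open>px\<close>, enlarged by one edge, stays in the geodesic ball of radius \<open>2 \<epsilon>\<close>.
  By \<open>ascent_growth\<close>, \<open>v\<close> rises over this ball by \<open>\<rho> / \<rho>1\<close> times its rise to \<open>p1\<close>; this ratio is \<open>2\<close> up
  to the relative errors.\<close>

lemma discrete_subsolution: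
  assumes small: "3 * h \<le> r0" "0 \<le> E" "64 * E \<le> h / 10" "4 * \<delta> / (t0 * h) \<le> 1/10" "100 * h \<le> \<epsilon>"
    and base: "\<And>x y. x \<in> \<Omega> \<Longrightarrow> y \<in> \<Omega> \<Longrightarrow> norm (x - y) = h \<Longrightarrow> d x y \<le> h + E"
    and v: "G.steep_ascent Y v" and L: "L \<ge> 0" "\<And>p q. p \<in> Z \<Longrightarrow> q \<in> Z \<Longrightarrow> \<bar>v p - v q\<bar> \<le> L * dn p q"
    and x: "x \<in> X" and Y: "\<And>q. q \<in> Y \<Longrightarrow> d x q > 2 * \<epsilon>"
  shows "\<exists>z\<in>X. d x z \<le> \<epsilon> \<and> (\<forall>y\<in>X. d x y \<le> \<epsilon> \<longrightarrow>
     vertex_max v \<epsilon> y + vertex_max v \<epsilon> z \<ge> 2 * vertex_max v \<epsilon> x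
       - L * (2 * \<epsilon> * (4 * \<delta> / (t0 * h) + 64 * E / h) + 13 * h))"
proof -
  define a where "a = 4 * \<delta> / (t0 * h)"
  define b where "b = 64 * E / h"
  have ab: "0 \<le> a" "a \<le> 1/10" "0 \<le> b" "b \<le> 1/10" using small \<delta> t0 h by (auto simp: a_def b_def field_simps)
  have E: "E \<le> h / 100" using small by linarith
  note dl = \<delta>_le
  have lower: "d p q \<le> (1 + b) * dn p q + 2 * h" if "p \<in> Z" "q \<in> Z" for p q
    unfolding b_def by (rule graph_dist_lower[OF small(1,2) E base that])
  have upper: "dn p q \<le> (1 + a) * d p q + h" if "p \<in> Z" "q \<in> Z" for p q
    unfolding a_def by (rule graph_dist_upper(2)[OF that])
  have \<epsilon>: "2 * \<delta> \<le> \<epsilon>" "\<delta> \<le> r0" "\<epsilon> > 0" "h \<le> \<epsilon> / 100" using small dl h by linarith+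
  obtain px where px: "px \<in> Z" "d x px \<le> 2 * \<delta>" "d x px \<le> \<epsilon>" using near_vertex[OF x \<epsilon>(1,2)] by blast
  obtain p1 where p1: "p1 \<in> Z" "d x p1 \<le> \<epsilon>" "vertex_max v \<epsilon> x = v p1" using vertex_max_attained[OF x \<epsilon>(1,2)] by blast
  have ZX: "px \<in> X" "p1 \<in> X" using px p1 Z by auto
  define M where "M = v p1 - v px"
  have M0: "M \<ge> 0" using vertex_max_ge[OF px(1,3), of v] p1 by (simp add: M_def)
  have Vy: "vertex_max v \<epsilon> y \<ge> v px - 4 * L * h" if y: "y \<in> X" "d x y \<le> \<epsilon>" for y
  proof -
    obtain y' where y': "y' \<in> X" "d x y' \<le> 2 * \<delta>" "d y' y \<le> \<epsilon> - 2 * \<delta>"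
      by (rule between[OF x y(1), of "2 * \<delta>" "\<epsilon> - 2 * \<delta>"]) (use y \<epsilon> \<delta> in auto)
    obtain q where q: "q \<in> Z" "d y' q \<le> 2 * \<delta>" using near_vertex[OF y'(1) \<epsilon>(1,2)] by blast
    have qX: "q \<in> X" using q Z by auto
    have "d y q \<le> \<epsilon>" using d_triangle[OF y(1) y'(1) qX] d_sym[of y y'] y' q by linarith
    moreover have "d px q \<le> 6 * \<delta>"
      using d_triangle[OF ZX(1) x qX] d_triangle[OF x y'(1) qX] d_sym[of px x] px y' q by linarith
    then have "dn px q \<le> 3 * h"
    proof -
      have "(1 + a) * d px q \<le> 11/10 * (6 * \<delta>)"
        using ab \<open>d px q \<le> 6 * \<delta>\<close> d_nonneg[OF ZX(1) qX] by (intro mult_mono) auto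
      then show ?thesis using upper[OF px(1) q(1)] dl h by linarith
    qed
    then have "L * dn px q \<le> L * (3 * h)" using L by (intro mult_left_mono)
    then have "v px - 4 * L * h \<le> v q" using L(2)[OF px(1) q(1)] mult_nonneg_nonneg[OF L(1), of h] h by linarith
    ultimately show ?thesis using vertex_max_ge[OF q(1), of y \<epsilon> v] by linarith
  qed
  define \<rho>1 where "\<rho>1 = (1 + a) * (\<epsilon> + 2 * \<delta>) + h"
  \<comment> \<open>The term \<open>5 h\<close> pays for the additive error of the distance comparison, for the last edge, and for the distance from \<open>x\<close> to \<open>px\<close>.\<close>
  define \<rho> where "\<rho> = (2 * \<epsilon> - 5 * h) / (1 + b)"
  have dp1: "dn px p1 \<le> \<rho>1"
  proof -
    have "d px p1 \<le> \<epsilon> + 2 * \<delta>" using d_triangle[OF ZX(1) x ZX(2)] d_sym[of px x] px p1 by linarith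
    then have "(1 + a) * d px p1 \<le> (1 + a) * (\<epsilon> + 2 * \<delta>)" using ab by (intro mult_left_mono) auto
    then show ?thesis using upper[OF px(1) p1(1)] by (simp add: \<rho>1_def)
  qed
  have aeps: "0 \<le> a * \<epsilon>" "a * \<epsilon> \<le> \<epsilon> / 10" "a * \<delta> \<le> \<delta> / 10" "0 \<le> a * \<delta>" "0 \<le> b * \<epsilon>" "0 \<le> b * h"
    using ab \<epsilon> \<delta> h mult_right_mono[OF ab(2), of \<epsilon>] mult_right_mono[OF ab(2), of \<delta>] by auto
  have r1: "\<rho>1 = \<epsilon> + 2 * \<delta> + a * \<epsilon> + 2 * (a * \<delta>) + h" by (simp add: \<rho>1_def algebra_simps)
  have r1': "\<rho>1 \<ge> \<epsilon>" "\<rho>1 \<le> 12/10 * \<epsilon>" using r1 aeps dl \<epsilon> \<delta> h by linarith+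
  have \<rho>b: "(1 + b) * \<rho> = 2 * \<epsilon> - 5 * h" using ab by (simp add: \<rho>_def)
  have \<rho>low: "2 * \<epsilon> - 5 * h - 2 * (b * \<epsilon>) \<le> \<rho>"
  proof -
    have "(2 * \<epsilon> - 5 * h) * (1 - b) * (1 + b) \<le> 2 * \<epsilon> - 5 * h"
    proof -
      have "(2 * \<epsilon> - 5 * h) * (1 - b * b) \<le> (2 * \<epsilon> - 5 * h) * 1" using \<epsilon> by (intro mult_left_mono) auto
      then show ?thesis by (simp add: algebra_simps)
    qed
    then have "(2 * \<epsilon> - 5 * h) * (1 - b) \<le> \<rho>" using ab by (simp add: \<rho>_def field_simps)
    then show ?thesis using aeps by (simp add: algebra_simps)
  qed
  have \<rho>ge: "\<rho> > \<rho>1"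
  proof -
    have "b * \<epsilon> \<le> \<epsilon> / 10" using mult_right_mono[OF ab(4), of \<epsilon>] \<epsilon> by simp
    then show ?thesis using \<rho>low r1' \<epsilon> by linarith
  qed
  have \<rho>le: "\<rho> \<le> 2 * \<rho>1"
  proof -
    have "1 * \<rho> \<le> (1 + b) * \<rho>" using ab \<rho>ge r1' \<epsilon> by (intro mult_right_mono) auto
    then show ?thesis using \<rho>b r1' h by linarith
  qed
  define err where "err = L * (2 * \<epsilon> * (a + b) + 13 * h)"
  have errL: "L * (2 * \<rho>1 - \<rho>) + 4 * L * h \<le> err"
  proof -
    have "2 * \<rho>1 - \<rho> \<le> 2 * \<epsilon> * (a + b) + 9 * h" using r1 \<rho>low aeps dl \<delta> by (simp add: algebra_simps)
    then have "L * (2 * \<rho>1 - \<rho>) \<le> L * (2 * \<epsilon> * (a + b) + 9 * h)" using L by (intro mult_left_mono)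
    then show ?thesis by (simp add: err_def algebra_simps)
  qed
  have "\<exists>z\<in>X. d x z \<le> \<epsilon> \<and> vertex_max v \<epsilon> z \<ge> v p1 + M - L * (2 * \<rho>1 - \<rho>)"
  proof (cases "M = 0")
    case True
    have "0 \<le> L * (2 * \<rho>1 - \<rho>)" using L \<rho>le by simp
    then show ?thesis using x \<epsilon> p1 True by (intro bexI[of _ x]) auto
  next
    case False
    then have Mp: "M > 0" using M0 by simp
    define \<kappa> where "\<kappa> = M / \<rho>1"
    have \<rho>1p: "\<rho>1 > 0" using r1' \<epsilon> by linarith
    have \<kappa>: "\<kappa> > 0" "\<kappa> * \<rho>1 = M" using Mp \<rho>1p by (auto simp: \<kappa>_def)
    have \<kappa>L: "\<kappa> \<le> L"
    proof -
      have "M \<le> L * dn px p1" using L(2)[OF p1(1) px(1)] G.dn_sym[of px p1] by (simp add: M_def)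
      also have "\<dots> \<le> L * \<rho>1" using L dp1 by (intro mult_left_mono)
      finally show ?thesis using \<rho>1p by (simp add: \<kappa>_def field_simps)
    qed
    have inside: "d x q \<le> 2 * \<epsilon> - 3 * h + 2 * \<delta>" if q: "q \<in> Z" "dn px q < \<rho>" for q
    proof -
      have "(1 + b) * dn px q \<le> (1 + b) * \<rho>" using q ab by (intro mult_left_mono) auto
      then have "d px q \<le> 2 * \<epsilon> - 3 * h" using lower[OF px(1) q(1)] \<rho>b by linarith
      moreover have "q \<in> X" using q Z by auto
      ultimately show ?thesis using d_triangle[OF x ZX(1), of q] px by simp
    qed
    obtain q0 q where q: "q0 \<in> Z" "dn px q0 < \<rho>" "q \<in> Z" "wt q0 q > 0" "v px + \<kappa> * \<rho> \<le> v q"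
    proof (rule G.ascent_growth[OF v px(1) \<kappa>(1)])
      show "r \<notin> Y" if "r \<in> Z" "dn px r < \<rho>" for r
        using inside[OF that] Y[of r] dl h by fastforce
      show "dn px p1 < \<rho>" using dp1 \<rho>ge by simp
      have "\<kappa> * dn px p1 \<le> M" using dp1 \<kappa> by (metis less_imp_le mult_left_mono)
      then show "v px + \<kappa> * dn px p1 \<le> v p1" by (simp add: M_def)
      show "v px < v p1" using Mp by (simp add: M_def)
    qed (use p1 in blast)+
    have qX: "q0 \<in> X" "q \<in> X" using q Z by auto
    have "norm (q0 - q) \<le> h" using graph_weight_posD(2)[OF kernel h q(4)] .
    then have "d q0 q \<le> 103/100 * h" using local_d[OF qX] small h by linarith
    then have "d x q \<le> \<epsilon> + \<epsilon>" using d_triangle[OF x qX] inside[OF q(1,2)] dl h by linarith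
    then obtain z where z: "z \<in> X" "d x z \<le> \<epsilon>" "d z q \<le> \<epsilon>"
      using between[OF x qX(2), of \<epsilon> \<epsilon>] \<epsilon> by auto
    have "vertex_max v \<epsilon> z \<ge> v px + \<kappa> * \<rho>" using vertex_max_ge[OF q(3) z(3), of v] q(5) by linarith
    moreover have "\<kappa> * \<rho> = 2 * M - \<kappa> * (2 * \<rho>1 - \<rho>)" using \<kappa> by (simp add: algebra_simps)
    moreover have "\<kappa> * (2 * \<rho>1 - \<rho>) \<le> L * (2 * \<rho>1 - \<rho>)" using \<kappa>L \<rho>le by (intro mult_right_mono) auto
    ultimately have "vertex_max v \<epsilon> z \<ge> v p1 + M - L * (2 * \<rho>1 - \<rho>)" by (simp add: M_def)
    then show ?thesis using z by blast
  qed
  then obtain z where z: "z \<in> X" "d x z \<le> \<epsilon>" "vertex_max v \<epsilon> z \<ge> v p1 + M - L * (2 * \<rho>1 - \<rho>)" by blast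
  have "vertex_max v \<epsilon> y + vertex_max v \<epsilon> z \<ge> 2 * vertex_max v \<epsilon> x - err" if "y \<in> X" "d x y \<le> \<epsilon>" for y
    using Vy[OF that] z(3) errL p1(3) by (simp add: M_def)
  then show ?thesis using z unfolding err_def a_def b_def by blast
qed

end

section \<open>Slopes and gradients\<close>

text \<open>Compare both bounds on the ray from \<open>y0\<close> in direction \<open>- p\<close>.\<close>

lemma touching_gradient_le:
  fixes u :: "'a::euclidean_space \<Rightarrow> real"
  assumes touch: "\<And>y. norm (y - y0) < \<sigma> \<Longrightarrow> u y \<le> u y0 + p \<bullet> (y - y0) + A * (norm (y - y0))\<^sup>2"
    and lip: "\<And>y. norm (y - y0) < \<rho> \<Longrightarrow> \<bar>u y - u y0\<bar> \<le> c * norm (y - y0)"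
    and pos: "\<sigma> > 0" "\<rho> > 0" "A \<ge> 0" "c \<ge> 0"
  shows "norm p \<le> c"
proof (rule field_le_epsilon)
  fix e :: real assume e: "e > 0"
  show "norm p \<le> c + e"
  proof (cases "p = 0")
    case True then show ?thesis using pos e by simp
  next
    case False
    define t where "t = min (min (\<sigma> / 2) (\<rho> / 2)) (e / (A + 1))"
    have t: "t > 0" "t < \<sigma>" "t < \<rho>" using pos e by (auto simp: t_def min_less_iff_disj)
    have "t \<le> e / (A + 1)" by (simp add: t_def)
    then have "t * (A + 1) \<le> e" using pos by (simp add: pos_le_divide_eq)
    moreover have "t * (A + 1) = A * t + t" by (simp add: algebra_simps)
    ultimately have At: "A * t \<le> e" using t by linarith
    define y where "y = y0 - (t / norm p) *\<^sub>R p"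
    have yn: "norm (y - y0) = t" using t False by (simp add: y_def)
    have "p \<bullet> (y - y0) = - (t * norm p)" using False by (simp add: y_def dot_square_norm power2_eq_square)
    then have "u y \<le> u y0 - t * norm p + A * t\<^sup>2" using touch[of y] yn t by simp
    moreover have "u y0 - c * t \<le> u y" using lip[of y] yn t by (simp add: abs_le_iff)
    ultimately have "t * norm p \<le> t * (c + A * t)" by (simp add: power2_eq_square algebra_simps)
    then have "norm p \<le> c + A * t" using t by simp
    then show ?thesis using At by simp
  qed
qed

context length_domain
begin

text \<open>Touching from above yields one half of the expansion of \<open>u\<close> at \<open>y0\<close>. It also shows that the slope of \<open>u\<close> at \<open>y0\<close> is exactly \<open>norm p\<close>: it is not larger by
  the touching paraboloid, hence \<open>u\<close> has Lipschitz constant \<open>norm p + \<eta>\<close> near \<open>y0\<close> (\<open>s1\<close>); and it is not smaller, for a smaller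
  slope would give a Lipschitz constant below \<open>norm p\<close>, against \<open>touching_gradient_le\<close> (\<open>s2\<close>). So in a ball of radius \<open>R\<close> there is a point \<open>z\<close> with
  \<open>u z \<ge> u y0 + norm p * R\<close>, and by the paraboloid \<open>z\<close> is close to \<open>y0 + R p / norm p\<close>. The lower half of the expansion at a
  distance \<open>r\<close> much smaller than \<open>R\<close> follows from the Lipschitz bound between \<open>y\<close> and \<open>z\<close>.\<close>

lemma touching_differentiable:
  assumes u: "absmin S u" and B: "ball y0 \<sigma> \<subseteq> X - S" and \<sigma>: "\<sigma> > 0"
    and flat: "\<And>x y. x \<in> ball y0 \<sigma> \<Longrightarrow> y \<in> ball y0 \<sigma> \<Longrightarrow> d x y = norm (x - y)"
    and touch: "\<And>y. norm (y - y0) < \<sigma> \<Longrightarrow> u y \<le> u y0 + p \<bullet> (y - y0) + A * (norm (y - y0))\<^sup>2"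
    and A: "A \<ge> 0"
  shows "(u has_derivative (\<lambda>v. p \<bullet> v)) (at y0 within X)"
proof -
  have cu: "continuous_on X u" using u by (simp add: absmin_def)
  have y0b: "y0 \<in> ball y0 \<sigma>" using \<sigma> by simp
  then have y0: "y0 \<in> X" "y0 \<in> ball y0 \<sigma>" using B by blast+
  have dn: "norm (y - y0) \<le> d y0 y" if "y \<in> X" for y using norm_le_d[OF y0(1) that] by (simp add: norm_minus_commute)
  have dnorm: "d y0 y = norm (y - y0)" if "norm (y - y0) < \<sigma>" for y
    using flat[OF y0(2), of y] that by (simp add: dist_norm norm_minus_commute)
  have inX: "y \<in> X" "y \<notin> S" if "norm (y - y0) < \<sigma>" for y
    using that B by (auto simp: subset_iff dist_norm norm_minus_commute)
  have far: "y \<notin> S" if "y \<in> X" "d y0 y < \<sigma>" for y using inX dn[OF that(1)] that by force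
  have lipE: "\<exists>\<rho>'>0. \<forall>x y. norm (x - y0) < \<rho>' \<longrightarrow> norm (y - y0) < \<rho>' \<longrightarrow> \<bar>u x - u y\<bar> \<le> c' * norm (x - y)"
    if R: "0 < R" "R < \<sigma>" and c: "\<And>y. y \<in> X \<Longrightarrow> d y0 y \<le> R \<Longrightarrow> u y \<le> u y0 + c * R" "c < c'" for R c c'
  proof -
    obtain \<rho> where \<rho>: "\<rho> > 0" "\<And>x y. x \<in> X \<Longrightarrow> y \<in> X \<Longrightarrow> d y0 x < \<rho> \<Longrightarrow> d y0 y < \<rho> \<Longrightarrow> \<bar>u x - u y\<bar> \<le> c' * d x y"
      by (rule slope_local_Lipschitz[OF u y0(1) R(1) _ c]) (use far R in auto)
    have "\<bar>u x - u y\<bar> \<le> c' * norm (x - y)" if "norm (x - y0) < min \<rho> \<sigma>" "norm (y - y0) < min \<rho> \<sigma>" for x y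
    proof -
      have "d x y = norm (x - y)" using that by (intro flat) (auto simp: dist_norm norm_minus_commute)
      then show ?thesis using \<rho>(2)[of x y] that inX dnorm by auto
    qed
    then show ?thesis using \<rho>(1) \<sigma> by (intro exI[of _ "min \<rho> \<sigma>"]) auto
  qed
  have s1: "\<exists>\<rho>'>0. \<forall>x y. norm (x - y0) < \<rho>' \<longrightarrow> norm (y - y0) < \<rho>' \<longrightarrow> \<bar>u x - u y\<bar> \<le> (norm p + \<eta>) * norm (x - y)"
    if \<eta>: "\<eta> > 0" for \<eta>
  proof -
    define R where "R = min (\<sigma> / 2) (\<eta> / (2 * (A + 1)))"
    have R: "0 < R" "R < \<sigma>" using \<sigma> \<eta> A by (auto simp: R_def min_less_iff_disj)
    have "R \<le> \<eta> / (2 * (A + 1))" by (simp add: R_def)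
    then have "R * (2 * (A + 1)) \<le> \<eta>" using A by (simp add: pos_le_divide_eq)
    then have AR: "A * R \<le> \<eta> / 2" using R by (simp add: algebra_simps)
    show ?thesis
    proof (rule lipE[OF R])
      fix y assume y: "y \<in> X" "d y0 y \<le> R"
      define n where "n = norm (y - y0)"
      have n: "0 \<le> n" "n \<le> R" using dn[OF y(1)] y by (auto simp: n_def)
      have "u y \<le> u y0 + p \<bullet> (y - y0) + A * n\<^sup>2" using touch[of y] n R by (simp add: n_def)
      moreover have "p \<bullet> (y - y0) \<le> norm p * n" unfolding n_def by (rule norm_cauchy_schwarz)
      moreover have "norm p * n \<le> norm p * R" using n by (intro mult_left_mono) auto
      moreover have "A * n\<^sup>2 \<le> \<eta> / 2 * R"
      proof -
        have "A * (n * n) \<le> A * (R * R)" using n A by (intro mult_left_mono mult_mono) auto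
        also have "\<dots> = A * R * R" by simp
        also have "\<dots> \<le> \<eta> / 2 * R" using AR R by (intro mult_right_mono) auto
        finally show ?thesis by (simp add: power2_eq_square)
      qed
      ultimately show "u y \<le> u y0 + (norm p + \<eta> / 2) * R" by (simp add: distrib_right)
    qed (use \<eta> in simp)
  qed
  have s2: "\<exists>z. norm (z - y0) \<le> R \<and> u z \<ge> u y0 + norm p * R" if R: "0 < R" "R < \<sigma>" for R
  proof -
    obtain z where z: "z \<in> X" "d y0 z \<le> R" "\<And>y. y \<in> X \<Longrightarrow> d y0 y \<le> R \<Longrightarrow> u y \<le> u z"
      by (rule ball_max_attained[OF cu y0(1), of R]) (use R in auto)
    have "u z \<ge> u y0 + norm p * R"
    proof (rule ccontr)
      assume neg: "\<not> ?thesis"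
      define c where "c = (u z - u y0) / R"
      have cR: "c * R = u z - u y0" using R by (simp add: c_def)
      have "u y0 \<le> u z" using z(3)[OF y0(1)] y0 R by simp
      then have c0: "c \<ge> 0" using R by (simp add: c_def)
      have "c * R < norm p * R" using neg cR by linarith
      then have cp: "c < norm p" using R by simp
      obtain \<rho>' where \<rho>': "\<rho>' > 0" "\<And>x y. norm (x - y0) < \<rho>' \<Longrightarrow> norm (y - y0) < \<rho>' \<Longrightarrow> \<bar>u x - u y\<bar> \<le> (c + norm p) / 2 * norm (x - y)"
        using lipE[OF R, of c "(c + norm p) / 2"] z(3) cR cp by force
      have "norm p \<le> (c + norm p) / 2"
        by (rule touching_gradient_le[OF touch _ \<sigma> \<rho>'(1) A]) (use \<rho>' c0 in auto)
      then show False using cp by simp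
    qed
    moreover have "norm (z - y0) \<le> R" using dn[OF z(1)] z(2) by linarith
    ultimately show ?thesis by blast
  qed
  show ?thesis
    unfolding has_derivative_within_alt
  proof (intro conjI allI impI)
    show "bounded_linear (\<lambda>v. p \<bullet> v)" by (rule bounded_linear_inner_right)
    fix \<theta> :: real assume \<theta>: "\<theta> > 0"
    show "\<exists>r>0. \<forall>y\<in>X. norm (y - y0) < r \<longrightarrow> norm (u y - u y0 - p \<bullet> (y - y0)) \<le> \<theta> * norm (y - y0)"
    proof (cases "p = 0")
      case True
      then obtain \<rho>' where \<rho>': "\<rho>' > 0" "\<And>x y. norm (x - y0) < \<rho>' \<Longrightarrow> norm (y - y0) < \<rho>' \<Longrightarrow> \<bar>u x - u y\<bar> \<le> \<theta> * norm (x - y)"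
        using s1[OF \<theta>] by auto
      then show ?thesis using True by (intro exI[of _ \<rho>']) auto
    next
      case False
      define P where "P = norm p"
      have P: "P > 0" using False by (simp add: P_def)
      \<comment> \<open>\<open>K = R / r\<close> makes the error \<open>r / K\<close> from the second order part of \<open>norm (z - y)\<close> small; then \<open>\<eta>\<close> is small against \<open>1 / K\<close>, and \<open>r1\<close> makes
          the relative error \<open>\<omega>\<close> in the position of \<open>z\<close> small.\<close>
      define K where "K = max 2 (4 * (P + 1) / \<theta>)"
      have K: "K \<ge> 2" "4 * (P + 1) / \<theta> \<le> K" by (auto simp: K_def)
      have PK: "(P + 1) / K \<le> \<theta> / 4" using K \<theta> by (simp add: field_simps)
      define \<eta> where "\<eta> = min 1 (\<theta> / (4 * (K + 1)))"
      have \<eta>: "\<eta> > 0" "\<eta> \<le> 1" using K \<theta> by (auto simp: \<eta>_def)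
      have "\<eta> \<le> \<theta> / (4 * (K + 1))" by (simp add: \<eta>_def)
      then have \<eta>K: "\<eta> * (K + 1) \<le> \<theta> / 4" using K by (simp add: field_simps)
      obtain \<rho>' where \<rho>': "\<rho>' > 0" "\<And>x y. norm (x - y0) < \<rho>' \<Longrightarrow> norm (y - y0) < \<rho>' \<Longrightarrow> \<bar>u x - u y\<bar> \<le> (P + \<eta>) * norm (x - y)"
        using s1[OF \<eta>(1)] unfolding P_def by auto
      define \<omega> where "\<omega> = \<theta> / (8 * (P + 1))"
      have \<omega>: "\<omega> > 0" "(P + 1) * (2 * \<omega>) = \<theta> / 4"
      proof -
        show "\<omega> > 0" using \<theta> P by (simp add: \<omega>_def)
        define q where "q = P + 1"
        have "q > 0" using P by (simp add: q_def)
        then show "(P + 1) * (2 * \<omega>) = \<theta> / 4" unfolding \<omega>_def q_def[symmetric] by simp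
      qed
      define r1 where "r1 = Min {\<rho>' / (2 * K), \<sigma> / (2 * K), \<omega>\<^sup>2 * P / (2 * (A + 1) * K), \<theta> / (A + 1)}"
      have r1pos: "r1 > 0" using \<rho>' \<sigma> \<omega> P K A \<theta> by (simp add: r1_def)
      have "r1 \<le> q" if "q \<in> {\<rho>' / (2 * K), \<sigma> / (2 * K), \<omega>\<^sup>2 * P / (2 * (A + 1) * K), \<theta> / (A + 1)}" for q
        unfolding r1_def using that by (intro Min_le) auto
      then have r1: "r1 \<le> \<rho>' / (2 * K)" "r1 \<le> \<sigma> / (2 * K)" "r1 \<le> \<omega>\<^sup>2 * P / (2 * (A + 1) * K)" "r1 \<le> \<theta> / (A + 1)"
        by blast+
      show ?thesis
      proof (intro exI[of _ r1] conjI ballI impI r1pos)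
        fix y assume yX: "y \<in> X" and yr: "norm (y - y0) < r1"
        define k where "k = y - y0"
        define r where "r = norm k"
        have r: "r \<ge> 0" "r < r1" using yr by (auto simp: r_def k_def)
        have rK: "r * (2 * K) \<le> \<rho>'" "r * (2 * K) < \<sigma>" "r * (2 * (A + 1) * K) \<le> \<omega>\<^sup>2 * P" "r * (A + 1) \<le> \<theta>"
        proof -
          have Kp: "2 * K > 0" "2 * (A + 1) * K > 0" "A + 1 > 0" using K A by auto
          show "r * (2 * K) \<le> \<rho>'" using r r1(1) Kp by (subst pos_le_divide_eq[symmetric]) auto
          show "r * (2 * K) < \<sigma>" using r r1(2) Kp by (subst pos_less_divide_eq[symmetric]) auto
          show "r * (2 * (A + 1) * K) \<le> \<omega>\<^sup>2 * P" using r r1(3) Kp(2) by (subst pos_le_divide_eq[symmetric]) auto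
          show "r * (A + 1) \<le> \<theta>" using r r1(4) Kp(3) by (subst pos_le_divide_eq[symmetric]) auto
        qed
        have rr: "r \<le> r * (2 * K)" using mult_left_mono[of 1 "2 * K" r] K r by simp
        have upper: "u y - u y0 - p \<bullet> k \<le> \<theta> * r"
        proof -
          have "u y \<le> u y0 + p \<bullet> k + A * r\<^sup>2" using touch[of y] rr rK by (simp add: k_def r_def)
          moreover have "A * r\<^sup>2 \<le> \<theta> * r"
          proof -
            have "A * r \<le> \<theta>" using rK(4) r by (simp add: algebra_simps)
            then have "A * r * r \<le> \<theta> * r" using r by (intro mult_right_mono) auto
            then show ?thesis by (simp add: power2_eq_square)
          qed
          ultimately show ?thesis by linarith
        qed
        have lower: "u y0 + p \<bullet> k - \<theta> * r \<le> u y"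
        proof (cases "r = 0")
          case True
          then show ?thesis by (simp add: r_def k_def)
        next
          case False
          then have rp: "r > 0" using r by simp
          define R where "R = K * r"
          have R: "R > 0" "R < \<sigma>" "R < \<rho>'" "r < \<rho>'" "2 * r \<le> R"
          proof -
            show "R > 0" using K rp by (simp add: R_def)
            have e: "r * (2 * K) = 2 * R" by (simp add: R_def)
            show "R < \<sigma>" "R < \<rho>'" using rK e \<open>R > 0\<close> by linarith+
            show "2 * r \<le> R" using K rp by (simp add: R_def)
            then show "r < \<rho>'" using rK e rp by linarith
          qed
          obtain z where z: "norm (z - y0) \<le> R" "u z \<ge> u y0 + P * R" using s2[OF R(1,2)] by (auto simp: P_def)
          define \<zeta> where "\<zeta> = z - y0"
          define e where "e = (1 / P) *\<^sub>R p"
          have ne: "norm e = 1" using P by (simp add: e_def P_def)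
          have ep: "p \<bullet> v = P * (e \<bullet> v)" for v using P by (simp add: e_def)
          have zR: "norm \<zeta> \<le> R" using z by (simp add: \<zeta>_def)
          have AR: "2 * A * R \<le> \<omega>\<^sup>2 * P"
          proof -
            have "2 * A * R \<le> 2 * (A + 1) * R" using R by simp
            also have "\<dots> = r * (2 * (A + 1) * K)" by (simp add: R_def)
            finally show ?thesis using rK(3) by linarith
          qed
          have ez: "P * R - A * R\<^sup>2 \<le> P * (e \<bullet> \<zeta>)"
          proof -
            have "u z \<le> u y0 + p \<bullet> \<zeta> + A * (norm \<zeta>)\<^sup>2" using touch[of z] z R by (simp add: \<zeta>_def)
            moreover have "A * (norm \<zeta>)\<^sup>2 \<le> A * R\<^sup>2" using A zR by (intro mult_left_mono power_mono) auto
            ultimately show ?thesis using z(2) ep by simp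
          qed
          define f where "f = \<zeta> - R *\<^sub>R e"
          have nf: "norm f \<le> R * \<omega>"
          proof (rule power2_le_imp_le)
            have "(norm f)\<^sup>2 = (norm \<zeta>)\<^sup>2 - 2 * R * (e \<bullet> \<zeta>) + R\<^sup>2"
            proof -
              have "f \<bullet> f = \<zeta> \<bullet> \<zeta> - 2 * R * (e \<bullet> \<zeta>) + R * R * (e \<bullet> e)"
                unfolding f_def by (simp add: inner_diff inner_commute[of \<zeta> e] algebra_simps)
              moreover have "e \<bullet> e = 1" using ne by (simp add: norm_eq_1)
              ultimately show ?thesis unfolding power2_norm_eq_inner by (simp add: power2_eq_square)
            qed
            moreover have "(norm \<zeta>)\<^sup>2 \<le> R\<^sup>2" using zR by (intro power_mono) auto
            ultimately have "(norm f)\<^sup>2 \<le> 2 * R\<^sup>2 - 2 * R * (e \<bullet> \<zeta>)" by linarith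
            then have "P * (norm f)\<^sup>2 \<le> P * (2 * R\<^sup>2 - 2 * R * (e \<bullet> \<zeta>))" using P by (intro mult_left_mono) auto
            also have "\<dots> = 2 * R * (P * R - P * (e \<bullet> \<zeta>))" by (simp add: power2_eq_square algebra_simps)
            also have "\<dots> \<le> 2 * R * (A * R\<^sup>2)" using ez R by (intro mult_left_mono) auto
            also have "\<dots> = 2 * A * R * R\<^sup>2" by simp
            also have "\<dots> \<le> \<omega>\<^sup>2 * P * R\<^sup>2" using AR by (intro mult_right_mono) auto
            also have "\<dots> = P * (R * \<omega>)\<^sup>2" by (simp add: power2_eq_square)
            finally show "(norm f)\<^sup>2 \<le> (R * \<omega>)\<^sup>2" using P by simp
          qed (use R \<omega> in simp)
          have zk: "R * (e \<bullet> k) - R * \<omega> * r \<le> \<zeta> \<bullet> k"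
          proof -
            have "- (norm f * norm k) \<le> f \<bullet> k" using Cauchy_Schwarz_ineq2[of f k] by (simp add: abs_le_iff)
            moreover have "norm f * norm k \<le> R * \<omega> * r" using nf r by (simp add: r_def mult_right_mono)
            moreover have "\<zeta> \<bullet> k = R * (e \<bullet> k) + f \<bullet> k" by (simp add: f_def inner_diff_left)
            ultimately show ?thesis by linarith
          qed
          define Q where "Q = R - e \<bullet> k"
          have ek: "\<bar>e \<bullet> k\<bar> \<le> r" using Cauchy_Schwarz_ineq2[of e k] ne by (simp add: r_def)
          have Q: "R \<le> 2 * Q" using abs_le_D1[OF ek] R(5) unfolding Q_def by argo
          define m where "m = 2 * \<omega> * r + r / K"
          have m: "m \<ge> 0" "R * m = 2 * R * \<omega> * r + r\<^sup>2" using \<omega> rp K by (auto simp: m_def R_def power2_eq_square algebra_simps)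
          have "norm (z - y) \<le> Q + m"
          proof (rule power2_le_imp_le)
            have "(norm (\<zeta> - k))\<^sup>2 = (norm \<zeta>)\<^sup>2 - 2 * (\<zeta> \<bullet> k) + r\<^sup>2"
              by (simp add: r_def power2_norm_eq_inner inner_diff inner_commute)
            moreover have "(norm \<zeta>)\<^sup>2 \<le> R\<^sup>2" using zR by (intro power_mono) auto
            ultimately have "(norm (\<zeta> - k))\<^sup>2 \<le> R\<^sup>2 - 2 * (R * (e \<bullet> k)) + R * m" using zk m(2) by linarith
            also have "\<dots> \<le> Q\<^sup>2 + 2 * Q * m"
            proof -
              have "R * m \<le> 2 * Q * m" using Q m(1) by (rule mult_right_mono)
              moreover have "Q\<^sup>2 = R\<^sup>2 - 2 * (R * (e \<bullet> k)) + (e \<bullet> k)\<^sup>2" by (simp add: Q_def power2_diff)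
              ultimately show ?thesis using zero_le_power2[of "e \<bullet> k"] by linarith
            qed
            also have "\<dots> \<le> (Q + m)\<^sup>2" by (simp add: power2_sum)
            finally show "(norm (z - y))\<^sup>2 \<le> (Q + m)\<^sup>2" by (simp add: \<zeta>_def k_def)
          qed (use Q R m in linarith)
          then have "(P + \<eta>) * norm (z - y) \<le> (P + \<eta>) * (Q + m)" using P \<eta> by (intro mult_left_mono) auto
          moreover have "\<bar>u z - u y\<bar> \<le> (P + \<eta>) * norm (z - y)" using \<rho>'(2)[of z y] z R r_def k_def by force
          ultimately have uy: "u y0 + P * R - (P + \<eta>) * (Q + m) \<le> u y" using z(2) by (simp add: abs_le_iff)
          have "(P + \<eta>) * (Q + m) \<le> P * R - p \<bullet> k + \<theta> * r"
          proof -
            have "(P + \<eta>) * m \<le> (P + 1) * m" using \<eta> m by (intro mult_right_mono) auto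
            also have "\<dots> = ((P + 1) * (2 * \<omega>) + (P + 1) / K) * r" using K by (simp add: m_def field_simps)
            also have "\<dots> \<le> (\<theta> / 4 + \<theta> / 4) * r"
              by (rule mult_right_mono[OF add_mono[OF eq_refl[OF \<omega>(2)] PK] r(1)])
            finally have 1: "(P + \<eta>) * m \<le> \<theta> / 2 * r" by simp
            have "\<eta> * Q \<le> \<eta> * ((K + 1) * r)"
              using ek \<eta> by (intro mult_left_mono) (auto simp: Q_def R_def algebra_simps)
            also have "\<dots> = \<eta> * (K + 1) * r" by simp
            also have "\<dots> \<le> \<theta> / 4 * r" using \<eta>K r by (intro mult_right_mono)
            finally have 2: "\<eta> * Q \<le> \<theta> / 4 * r" .
            have 3: "P * Q = P * R - p \<bullet> k" using ep[of k] by (simp add: Q_def right_diff_distrib)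
            have "(P + \<eta>) * (Q + m) = P * Q + \<eta> * Q + (P + \<eta>) * m" by (simp add: algebra_simps)
            moreover have "0 \<le> \<theta> * r" using \<theta> r by simp
            ultimately show ?thesis using 1 2 3 by linarith
          qed
          then show ?thesis using uy by linarith
        qed
        show "norm (u y - u y0 - p \<bullet> (y - y0)) \<le> \<theta> * norm (y - y0)"
          using upper lower by (simp add: k_def r_def abs_le_iff)
      qed
    qed
  qed
qed

text \<open>Maximizing \<open>u\<close> minus a steep paraboloid over a small ball inside \<open>\<Omega>\<close> produces an interior point at which \<open>u\<close> is touched from above.\<close>

lemma gradient_bound_at_some_point:
  assumes u: "absmin S u" and \<Omega>: "X = closure \<Omega>" "open \<Omega>"
    and seg: "\<And>x y. closed_segment x y \<subseteq> X \<Longrightarrow> d x y \<le> norm (x - y)"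
    and x0: "x0 \<in> X" and \<rho>: "\<rho> > 0" and S: "\<And>y. y \<in> X \<Longrightarrow> d x0 y < \<rho> \<Longrightarrow> y \<notin> S"
    and lip: "\<And>x y. x \<in> X \<Longrightarrow> y \<in> X \<Longrightarrow> d x0 x < \<rho> \<Longrightarrow> d x0 y < \<rho> \<Longrightarrow> \<bar>u x - u y\<bar> \<le> c * d x y" and c: "c \<ge> 0"
  obtains y D where "y \<in> X" "(u has_derivative (\<lambda>v. D \<bullet> v)) (at y within X)" "norm D \<le> c"
proof -
  have cu: "continuous_on X u" using u by (simp add: absmin_def)
  have sub: "\<Omega> \<subseteq> X" using \<Omega> closure_subset by auto
  have "min r0 (\<rho> / 4) > 0" using r0 \<rho> by simp
  then obtain x1 where x1: "x1 \<in> \<Omega>" "dist x1 x0 < min r0 (\<rho> / 4)"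
    using x0 \<Omega> closure_approachable by metis
  have "d x0 x1 \<le> 103/100 * norm (x0 - x1)" using x1 sub x0 by (intro local_d) (auto simp: dist_norm norm_minus_commute)
  then have dx1: "d x0 x1 < \<rho> / 2" using x1 \<rho> by (simp add: dist_norm norm_minus_commute)
  obtain s0 where s0: "s0 > 0" "ball x1 s0 \<subseteq> \<Omega>" using \<Omega>(2) x1(1) open_contains_ball by blast
  define s where "s = min s0 (\<rho> / 4)"
  have s: "s > 0" "ball x1 s \<subseteq> X" "s \<le> \<rho> / 4" using s0 \<rho> sub by (auto simp: s_def)
  have flat: "d x y = norm (x - y)" if "x \<in> ball x1 s" "y \<in> ball x1 s" for x y
  proof (rule antisym)
    have "closed_segment x y \<subseteq> ball x1 s" using that by (intro closed_segment_subset) auto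
    then show "d x y \<le> norm (x - y)" using s by (intro seg) auto
    show "norm (x - y) \<le> d x y" using that s by (intro norm_le_d) auto
  qed
  have near: "d x0 y < \<rho>" if "y \<in> ball x1 s" for y
  proof -
    have "d x1 y < \<rho> / 4" using flat[of x1 y] that s by (auto simp: dist_norm)
    then show ?thesis using d_triangle[OF x0, of x1 y] that s x1 sub dx1 by force
  qed
  have lipE: "\<bar>u x - u y\<bar> \<le> c * norm (x - y)" if "x \<in> ball x1 s" "y \<in> ball x1 s" for x y
  proof -
    have "x \<in> X" "y \<in> X" using s(2) that by blast+
    then show ?thesis using lip[of x y] near flat that by metis
  qed
  \<comment> \<open>steep enough to keep the maximum off the sphere of radius \<open>s / 2\<close>\<close>
  define A where "A = 2 * c / s + 1"
  have A: "A > 0" using c s by (simp add: A_def add_nonneg_pos)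
  define f where "f y = u y - A * (norm (y - x1))\<^sup>2" for y
  have cb: "cball x1 (s/2) \<subseteq> ball x1 s" using s by auto
  have "\<exists>y\<in>cball x1 (s/2). \<forall>z\<in>cball x1 (s/2). f z \<le> f y"
  proof (rule continuous_attains_sup)
    show "continuous_on (cball x1 (s/2)) f"
      unfolding f_def using cb s by (intro continuous_intros continuous_on_subset[OF cu]) auto
  qed (use s in auto)
  then obtain y0 where y0: "y0 \<in> cball x1 (s/2)" "\<And>z. z \<in> cball x1 (s/2) \<Longrightarrow> f z \<le> f y0" by blast
  have n0: "norm (y0 - x1) < s / 2"
  proof (rule ccontr)
    assume "\<not> ?thesis"
    then have eq: "norm (y0 - x1) = s / 2" using y0(1) by (simp add: dist_norm norm_minus_commute)
    have "f x1 \<le> f y0" using y0(2)[of x1] s by simp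
    moreover have "u y0 - u x1 \<le> c * (s / 2)" using lipE[of y0 x1] y0(1) cb eq s by (auto simp: abs_le_iff)
    ultimately have "A * (s / 2)\<^sup>2 \<le> c * (s / 2)" using eq by (simp add: f_def)
    then have "A * (s / 2) \<le> c" using s by (simp add: power2_eq_square)
    moreover have "A * (s / 2) = c + s / 2" using s by (simp add: A_def distrib_right)
    ultimately show False using s by linarith
  qed
  define \<sigma> where "\<sigma> = s / 2 - norm (y0 - x1)"
  have \<sigma>: "\<sigma> > 0" using n0 by (simp add: \<sigma>_def)
  define p where "p = (2 * A) *\<^sub>R (y0 - x1)"
  have inb: "y \<in> cball x1 (s/2)" if "norm (y - y0) < \<sigma>" for y
  proof -
    have "norm (y - x1) \<le> norm (y - y0) + norm (y0 - x1)" by norm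
    then show ?thesis using that by (simp add: \<sigma>_def dist_norm norm_minus_commute)
  qed
  have touch: "u y \<le> u y0 + p \<bullet> (y - y0) + A * (norm (y - y0))\<^sup>2" if "norm (y - y0) < \<sigma>" for y
  proof -
    have "(norm (y - x1))\<^sup>2 = (norm ((y0 - x1) + (y - y0)))\<^sup>2" by simp
    also have "\<dots> = (norm (y0 - x1))\<^sup>2 + 2 * ((y0 - x1) \<bullet> (y - y0)) + (norm (y - y0))\<^sup>2"
      unfolding power2_norm_eq_inner by (simp only: inner_add inner_commute)
    finally have E: "(norm (y - x1))\<^sup>2 = (norm (y0 - x1))\<^sup>2 + 2 * ((y0 - x1) \<bullet> (y - y0)) + (norm (y - y0))\<^sup>2" .
    have "p \<bullet> (y - y0) = A * (2 * ((y0 - x1) \<bullet> (y - y0)))" unfolding p_def inner_scaleR_left by simp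
    then have "A * (norm (y - x1))\<^sup>2 = A * (norm (y0 - x1))\<^sup>2 + p \<bullet> (y - y0) + A * (norm (y - y0))\<^sup>2"
      unfolding E by (simp only: distrib_left)
    then show ?thesis using y0(2)[OF inb[OF that]] by (simp add: f_def)
  qed
  have ballsub: "ball y0 \<sigma> \<subseteq> ball x1 s" using inb cb by (auto simp: subset_iff dist_norm norm_minus_commute)
  have "(u has_derivative (\<lambda>v. p \<bullet> v)) (at y0 within X)"
  proof (rule touching_differentiable[OF u _ \<sigma> _ touch])
    show "ball y0 \<sigma> \<subseteq> X - S" using ballsub s near S by blast
    show "d x y = norm (x - y)" if "x \<in> ball y0 \<sigma>" "y \<in> ball y0 \<sigma>" for x y using flat ballsub that by blast
  qed (use A in auto)
  moreover have "norm p \<le> c"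
  proof (rule touching_gradient_le[OF touch _ \<sigma> \<sigma>])
    show "\<bar>u y - u y0\<bar> \<le> c * norm (y - y0)" if "norm (y - y0) < \<sigma>" for y
      using lipE[of y y0] inb[OF that] y0(1) cb by blast
  qed (use A c in auto)
  moreover have "y0 \<in> X" using y0(1) cb s by blast
  ultimately show thesis using that by blast
qed

text \<open>If the slope over the \<open>\<epsilon>\<close>-ball is below \<open>\<alpha>\<close>, then \<open>u\<close> has a Lipschitz constant below \<open>\<alpha>\<close> near \<open>x\<close> and, by the
  preceding lemma, somewhere a gradient of norm below \<open>\<alpha>\<close>. The sign \<open>m\<close> covers \<open>u\<close> and \<open>- u\<close> at once.\<close>

lemma steep_of_gradient:
  assumes u: "absmin S u" "\<bar>m\<bar> = 1" and \<Omega>: "X = closure \<Omega>" "open \<Omega>"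
    and seg: "\<And>x y. closed_segment x y \<subseteq> X \<Longrightarrow> d x y \<le> norm (x - y)"
    and grad: "\<And>y D. y \<in> X \<Longrightarrow> (u has_derivative (\<lambda>v. D \<bullet> v)) (at y within X) \<Longrightarrow> \<alpha> \<le> norm D"
    and x: "x \<in> inner_part S \<epsilon>" and \<epsilon>: "\<epsilon> > 0"
  shows "ball_max (\<lambda>y. m * u y) \<epsilon> x \<ge> m * u x + \<alpha> * \<epsilon>"
proof (rule ccontr)
  assume neg: "\<not> ?thesis"
  have xX: "x \<in> X" and xS: "\<And>z. z \<in> S \<Longrightarrow> d x z > 3 * \<epsilon>" using x by (auto simp: inner_part_def)
  have m: "m = 1 \<or> m = -1" using u(2) by linarith
  have u': "absmin S (\<lambda>y. m * u y)" using m u(1) absmin_minus[OF u(1)] by auto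
  have cu: "continuous_on X (\<lambda>y. m * u y)" using u' by (simp add: absmin_def)
  define c where "c = (ball_max (\<lambda>y. m * u y) \<epsilon> x - m * u x) / \<epsilon>"
  have c\<epsilon>: "c * \<epsilon> = ball_max (\<lambda>y. m * u y) \<epsilon> x - m * u x" using \<epsilon> by (simp add: c_def)
  have "c * \<epsilon> < \<alpha> * \<epsilon>" using neg c\<epsilon> by linarith
  then have c\<alpha>: "c < \<alpha>" using \<epsilon> by simp
  have "m * u x \<le> ball_max (\<lambda>y. m * u y) \<epsilon> x" using xX \<epsilon> by (intro ball_max_ge[OF cu]) auto
  then have c0: "c \<ge> 0" using \<epsilon> by (simp add: c_def)
  define c' where "c' = (c + \<alpha>) / 2"
  obtain \<rho> where \<rho>: "\<rho> > 0" "\<And>y z. y \<in> X \<Longrightarrow> z \<in> X \<Longrightarrow> d x y < \<rho> \<Longrightarrow> d x z < \<rho> \<Longrightarrow> \<bar>m * u y - m * u z\<bar> \<le> c' * d y z"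
  proof (rule slope_local_Lipschitz[OF u' xX \<epsilon>])
    show "y \<notin> S" if "y \<in> X" "d x y < \<epsilon>" for y using xS[of y] that \<epsilon> by auto
    show "m * u y \<le> m * u x + c * \<epsilon>" if "y \<in> X" "d x y \<le> \<epsilon>" for y
      using ball_max_ge[OF cu xX that] c\<epsilon> by simp
    show "c < c'" using c\<alpha> by (simp add: c'_def)
  qed blast
  obtain y D where "y \<in> X" "(u has_derivative (\<lambda>v. D \<bullet> v)) (at y within X)" "norm D \<le> c'"
  proof (rule gradient_bound_at_some_point[OF u(1) \<Omega> seg xX, of "min \<rho> \<epsilon>" c'])
    show "\<bar>u y - u z\<bar> \<le> c' * d y z" if "y \<in> X" "z \<in> X" "d x y < min \<rho> \<epsilon>" "d x z < min \<rho> \<epsilon>" for y z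
      using \<rho>(2)[of y z] that m by auto
    show "y \<notin> S" if "y \<in> X" "d x y < min \<rho> \<epsilon>" for y using xS[of y] that \<epsilon> by auto
  qed (use \<rho> \<epsilon> c0 c\<alpha> in \<open>auto simp: c'_def\<close>)
  then show False using grad[of y D] c\<alpha> by (simp add: c'_def)
qed

end

section \<open>Uniqueness of absolute minimizers\<close>

lemma Lip_const_le_iff:
  assumes d: "\<And>x y. x \<in> A \<Longrightarrow> y \<in> A \<Longrightarrow> D x y = ennreal (d x y)" "\<And>x y. x \<in> A \<Longrightarrow> y \<in> A \<Longrightarrow> x \<noteq> y \<Longrightarrow> d x y > 0"
    "\<And>x. x \<in> A \<Longrightarrow> d x x = 0" and \<kappa>: "\<kappa> \<ge> 0"
  shows "Lip_const D v A \<le> ennreal \<kappa> \<longleftrightarrow> (\<forall>x\<in>A. \<forall>y\<in>A. \<bar>v x - v y\<bar> \<le> \<kappa> * d x y)"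
proof -
  have pair: "ennreal \<bar>v x - v y\<bar> / D x y \<le> ennreal \<kappa> \<longleftrightarrow> \<bar>v x - v y\<bar> \<le> \<kappa> * d x y"
    if "x \<in> A" "y \<in> A" "x \<noteq> y" for x y
  proof -
    have "ennreal \<bar>v x - v y\<bar> / D x y = ennreal (\<bar>v x - v y\<bar> / d x y)"
      using d that by (simp add: divide_ennreal)
    then show ?thesis using d(2)[OF that] \<kappa> by (simp add: pos_divide_le_eq)
  qed
  have "Lip_const D v A \<le> ennreal \<kappa> \<longleftrightarrow> (\<forall>x\<in>A. \<forall>y\<in>A. x \<noteq> y \<longrightarrow> \<bar>v x - v y\<bar> \<le> \<kappa> * d x y)"
    unfolding Lip_const_def SUP_le_iff using pair by auto
  also have "\<dots> \<longleftrightarrow> (\<forall>x\<in>A. \<forall>y\<in>A. \<bar>v x - v y\<bar> \<le> \<kappa> * d x y)"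
    using d(3) by (metis abs_zero diff_self mult_zero_right order_refl)
  finally show ?thesis .
qed

locale geo_domain = length_domain "closure \<Omega>" "real_geo_dist \<Omega>" r0
  for \<Omega> :: "'a::euclidean_space set" and r0 +
  assumes open_domain: "open \<Omega>"
    and geo_dist_eq: "x \<in> closure \<Omega> \<Longrightarrow> y \<in> closure \<Omega> \<Longrightarrow> geo_dist \<Omega> x y = ennreal (real_geo_dist \<Omega> x y)"
begin

lemma Lip_const_geo_dist:
  assumes "A \<subseteq> closure \<Omega>" "\<kappa> \<ge> 0"
  shows "Lip_const (geo_dist \<Omega>) v A \<le> ennreal \<kappa> \<longleftrightarrow> (\<forall>x\<in>A. \<forall>y\<in>A. \<bar>v x - v y\<bar> \<le> \<kappa> * real_geo_dist \<Omega> x y)"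
proof (rule Lip_const_le_iff)
  show "real_geo_dist \<Omega> x y > 0" if "x \<in> A" "y \<in> A" "x \<noteq> y" for x y
  proof -
    have "0 < norm (x - y)" using that by simp
    also have "\<dots> \<le> real_geo_dist \<Omega> x y" using that assms by (intro norm_le_d) auto
    finally show ?thesis .
  qed
qed (use assms geo_dist_eq in auto)

text \<open>The geodesic topology is the Euclidean one, so that its closures and frontiers become those of \<open>absmin\<close>.\<close>

lemma AMLE_absmin:
  assumes "AMLE \<Omega> S g u"
  shows "absmin S u"
  unfolding absmin_def
proof (intro conjI allI impI)
  show "continuous_on (closure \<Omega>) u" using assms by (simp add: AMLE_def)
  have top: "geo_topology \<Omega> = top_of_set (closure \<Omega>)" by (rule topology_eq) (simp_all add: real_geo_dist_def)
  fix V and \<kappa> :: real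
  assume "openin (top_of_set (closure \<Omega>)) V \<and> connected V \<and> V \<subseteq> closure \<Omega> - S \<and> 0 \<le> \<kappa> \<and>
    (\<forall>x\<in>closure V - V. \<forall>y\<in>closure V - V. \<bar>u x - u y\<bar> \<le> \<kappa> * real_geo_dist \<Omega> x y)"
  then have V: "openin (top_of_set (closure \<Omega>)) V" "connected V" "V \<subseteq> closure \<Omega> - S" and \<kappa>: "0 \<le> \<kappa>"
    and fr: "\<forall>x\<in>closure V - V. \<forall>y\<in>closure V - V. \<bar>u x - u y\<bar> \<le> \<kappa> * real_geo_dist \<Omega> x y" by blast+
  have VX: "V \<subseteq> closure \<Omega>" using V by auto
  have clV: "closure V \<subseteq> closure \<Omega>" using VX by (simp add: closure_minimal)
  have c: "top_of_set (closure \<Omega>) closure_of V = closure V"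
    using clV VX by (simp add: closure_of_subtopology Int_absorb1 Int_absorb2)
  have f: "top_of_set (closure \<Omega>) frontier_of V = closure V - V"
    unfolding frontier_of_def c interior_of_openin[OF V(1)] ..
  have "Lip_const (geo_dist \<Omega>) u (geo_topology \<Omega> closure_of V) = Lip_const (geo_dist \<Omega>) u (geo_topology \<Omega> frontier_of V)"
    using assms V VX unfolding AMLE_def top by (auto simp: connectedin_subtopology)
  then have "Lip_const (geo_dist \<Omega>) u (closure V) = Lip_const (geo_dist \<Omega>) u (closure V - V)"
    unfolding top c f .
  moreover have "closure V - V \<subseteq> closure \<Omega>" using clV by auto
  then have "Lip_const (geo_dist \<Omega>) u (closure V - V) \<le> ennreal \<kappa>" using Lip_const_geo_dist \<kappa> fr by blast
  ultimately show "\<forall>x\<in>closure V. \<forall>y\<in>closure V. \<bar>u x - u y\<bar> \<le> \<kappa> * real_geo_dist \<Omega> x y"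
    using Lip_const_geo_dist[OF clV \<kappa>] by metis
qed

lemma segment_real_geo_dist:
  assumes "closed_segment x y \<subseteq> closure \<Omega>"
  shows "real_geo_dist \<Omega> x y \<le> norm (x - y)"
  using geo_dist_segment[OF assms] unfolding real_geo_dist_def by (intro enn2real_leI) auto

end

context length_domain
begin

text \<open>The minima of \<open>u2\<close> over \<open>\<epsilon>\<close>-balls form an exact supersolution, so the error \<open>e\<close> may be chosen as \<open>\<epsilon>\<^sup>5\<close>; with \<open>\<alpha> = \<epsilon>\<close> the comparison gives
  a difference of order \<open>\<epsilon>\<close>.\<close>

lemma absmin_le:
  assumes u1: "absmin S u1" and u2: "absmin S u2" and S: "closed S" "S \<subseteq> X" "S \<noteq> {}" and \<kappa>: "\<kappa> \<ge> 0"
    and eq: "\<And>z. z \<in> S \<Longrightarrow> u1 z = u2 z"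
    and lip: "\<And>z w. z \<in> S \<Longrightarrow> w \<in> S \<Longrightarrow> \<bar>u1 z - u1 w\<bar> \<le> \<kappa> * d z w"
    and x: "x \<in> X"
  shows "u1 x \<le> u2 x"
proof -
  have L1: "\<bar>u1 y - u1 z\<bar> \<le> \<kappa> * d y z" if "y \<in> X" "z \<in> X" for y z
    by (rule absmin_Lipschitz[OF u1 S(1,2) \<kappa> lip that])
  have L2: "\<bar>u2 y - u2 z\<bar> \<le> \<kappa> * d y z" if "y \<in> X" "z \<in> X" for y z
    by (rule absmin_Lipschitz[OF u2 S(1,2) \<kappa> _ that]) (use lip eq in auto)
  have c1: "continuous_on X u1" and c2: "continuous_on X u2" using u1 u2 by (auto simp: absmin_def)
  have c2': "continuous_on X (\<lambda>y. - u2 y)" using c2 by (intro continuous_on_minus)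
  obtain D where D: "D > 0" "\<And>x y. x \<in> X \<Longrightarrow> y \<in> X \<Longrightarrow> d x y \<le> D" using diameter_bound by blast
  have "bounded (u1 ` X)" "bounded (u2 ` X)" using compact_imp_bounded[OF compact_continuous_image[OF _ compact]] c1 c2 by auto
  then obtain M1 M2 where M1: "\<And>y. y \<in> X \<Longrightarrow> \<bar>u1 y\<bar> \<le> M1" and M2: "\<And>y. y \<in> X \<Longrightarrow> \<bar>u2 y\<bar> \<le> M2"
    unfolding bounded_iff by auto
  define M where "M = max M1 M2"
  have M: "\<bar>u1 y\<bar> \<le> M" "\<bar>u2 y\<bar> \<le> M" if "y \<in> X" for y using M1[OF that] M2[OF that] by (auto simp: M_def)
  define C where "C = 8 * \<kappa> + 2 * (D + 1) + 8 * (M + 2 * (D + 1))\<^sup>2"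
  have C: "C > 0" using \<kappa> D by (simp add: C_def add_nonneg_pos add_pos_nonneg)
  have main: "u1 x - u2 x \<le> C * \<epsilon>" if \<epsilon>: "0 < \<epsilon>" "\<epsilon> \<le> 1" for \<epsilon>
  proof -
    define V where "V y = - ball_max (\<lambda>y. - u2 y) \<epsilon> y" for y
    have VM: "\<bar>V y\<bar> \<le> M" if y: "y \<in> X" for y
      unfolding V_def by (rule ball_max_attained[OF c2' y, of \<epsilon>]) (use \<epsilon> M in auto)
    have Vle: "V x \<le> u2 x" using ball_max_ge[OF c2' x x, of \<epsilon>] x \<epsilon> by (simp add: V_def)
    have e5: "\<epsilon> ^ 5 > 0" using \<epsilon> by simp
    have "u1 x - V x \<le> 8 * \<kappa> * \<epsilon> + 2 * (D + 1) * \<epsilon> + 8 * \<epsilon> ^ 5 * (M + 2 * (D + 1))\<^sup>2 / (\<epsilon> * \<epsilon>)\<^sup>2"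
    proof (rule one_sided_comparison[OF u1 S(3,2) \<epsilon> \<epsilon> e5 D(2) M(1) VM _ _ x])
      fix y assume y: "y \<in> inner_part S \<epsilon>"
      then have yX: "y \<in> X" and yS: "\<And>z. z \<in> X \<Longrightarrow> d y z < 2 * \<epsilon> \<Longrightarrow> z \<notin> S" using \<epsilon> by (fastforce simp: inner_part_def)+
      obtain z where z: "z \<in> X" "d y z \<le> \<epsilon>"
        "\<And>w. w \<in> X \<Longrightarrow> d y w \<le> \<epsilon> \<Longrightarrow> ball_max (\<lambda>y. - u2 y) \<epsilon> z + ball_max (\<lambda>y. - u2 y) \<epsilon> w \<ge> 2 * ball_max (\<lambda>y. - u2 y) \<epsilon> y"
        by (rule ball_max_subsolution[OF absmin_minus[OF u2] yX \<epsilon>(1) yS]) blast+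
      have "V w + V z \<le> 2 * V y + \<epsilon> ^ 5" if "w \<in> X" "d y w \<le> \<epsilon>" for w
        using z(3)[OF that] e5 unfolding V_def by linarith
      then show "\<exists>z\<in>X. d y z \<le> \<epsilon> \<and> (\<forall>w\<in>X. d y w \<le> \<epsilon> \<longrightarrow> V w + V z \<le> 2 * V y + \<epsilon> ^ 5)"
        using z by blast
    next
      fix y assume y: "y \<in> X - inner_part S \<epsilon>"
      then obtain z where z: "z \<in> S" "d y z \<le> 3 * \<epsilon>" by (auto simp: inner_part_def not_less)
      have yX: "y \<in> X" "z \<in> X" using y z S by auto
      have near: "\<kappa> * d p z \<le> 4 * \<kappa> * \<epsilon>" if "p \<in> X" "d y p \<le> \<epsilon>" for p
      proof -
        have "d p z \<le> 4 * \<epsilon>" using d_triangle[OF that(1) yX] d_sym[of y p] that z by linarith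
        then have "\<kappa> * d p z \<le> \<kappa> * (4 * \<epsilon>)" using \<kappa> by (intro mult_left_mono)
        then show ?thesis by simp
      qed
      obtain p where p: "p \<in> X" "d y p \<le> \<epsilon>" "ball_max u1 \<epsilon> y = u1 p"
        by (rule ball_max_attained[OF c1 yX(1), of \<epsilon>]) (use \<epsilon> in auto)
      obtain q where q: "q \<in> X" "d y q \<le> \<epsilon>" "V y = u2 q"
        by (rule ball_max_attained[OF c2' yX(1), of \<epsilon>]) (use \<epsilon> in \<open>auto simp: V_def\<close>)
      show "ball_max u1 \<epsilon> y - V y \<le> 8 * \<kappa> * \<epsilon>"
        using L1[OF p(1) yX(2)] L2[OF q(1) yX(2)] near[OF p(1,2)] near[OF q(1,2)] eq[OF z(1)] p(3) q(3) by linarith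
    qed
    also have "8 * \<epsilon> ^ 5 * (M + 2 * (D + 1))\<^sup>2 / (\<epsilon> * \<epsilon>)\<^sup>2 = 8 * (M + 2 * (D + 1))\<^sup>2 * \<epsilon>"
    proof -
      have "\<epsilon> ^ 5 = (\<epsilon> * \<epsilon>)\<^sup>2 * \<epsilon>" by (simp add: power2_eq_square power_numeral_reduce)
      then show ?thesis using \<epsilon> by simp
    qed
    finally show ?thesis using Vle by (simp add: C_def distrib_right)
  qed
  show ?thesis
  proof (rule field_le_epsilon)
    fix e :: real assume e: "e > 0"
    have "u1 x - u2 x \<le> C * min 1 (e / C)" using main[of "min 1 (e / C)"] e C by simp
    also have "\<dots> \<le> C * (e / C)" using C by (intro mult_left_mono) auto
    finally show "u1 x \<le> u2 x + e" using C by simp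
  qed
qed

lemma absmin_unique:
  assumes "absmin S u1" "absmin S u2" "closed S" "S \<subseteq> X" "S \<noteq> {}" "\<kappa> \<ge> 0"
    "\<And>z. z \<in> S \<Longrightarrow> u1 z = u2 z" "\<And>z w. z \<in> S \<Longrightarrow> w \<in> S \<Longrightarrow> \<bar>u1 z - u1 w\<bar> \<le> \<kappa> * d z w" "x \<in> X"
  shows "u1 x = u2 x"
proof (rule antisym)
  show "u1 x \<le> u2 x" by (rule absmin_le[OF assms])
  show "u2 x \<le> u1 x" by (rule absmin_le[OF assms(2,1,3-6) _ _ assms(9)]) (use assms(7,8) in auto)
qed

end

section \<open>The error estimate\<close>

lemma hausdorff_dist_ge:
  fixes A B :: "'a::euclidean_space set"
  assumes "bounded A" "bounded B" "A \<noteq> {}" "B \<noteq> {}"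
  shows "x \<in> A \<Longrightarrow> infdist x B \<le> hausdorff_dist A B" "x \<in> B \<Longrightarrow> infdist x A \<le> hausdorff_dist A B"
proof -
  have bdd: "bdd_above ((\<lambda>x. infdist x B) ` A)" if bA: "bounded A" and bB: "bounded B" and B: "B \<noteq> {}" for A B :: "'a set"
  proof -
    obtain b where b: "b \<in> B" using B by blast
    obtain e where e: "\<And>x. x \<in> A \<Longrightarrow> dist b x \<le> e" using bA bounded_any_center[of A b] by auto
    show ?thesis
      by (rule bdd_aboveI2[of _ _ e]) (metis b e infdist_le2 dist_commute)
  qed
  show "infdist x B \<le> hausdorff_dist A B" if "x \<in> A"
  proof -
    have "infdist x B \<le> (SUP x\<in>A. infdist x B)" by (rule cSUP_upper[OF that bdd]) (use assms in auto)
    then show ?thesis by (simp add: hausdorff_dist_def)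
  qed
  show "infdist x A \<le> hausdorff_dist A B" if "x \<in> B"
  proof -
    have "infdist x A \<le> (SUP x\<in>B. infdist x A)" by (rule cSUP_upper[OF that bdd]) (use assms in auto)
    then show ?thesis by (simp add: hausdorff_dist_def)
  qed
qed

lemma graph_inf_laplacian_minus:
  assumes "finite Z" "Z \<noteq> {}"
  shows "graph_inf_laplacian \<eta> h Z (\<lambda>x. - v x) x = - graph_inf_laplacian \<eta> h Z v x"
proof -
  let ?A = "(\<lambda>y. scaled_kernel \<eta> h (norm (x - y)) * (v y - v x)) ` Z"
  have eq: "(\<lambda>y. scaled_kernel \<eta> h (norm (x - y)) * (- v y - - v x)) ` Z = uminus ` ?A"
    unfolding image_image by (intro image_cong) (simp_all add: algebra_simps)
  have A: "finite ?A" "?A \<noteq> {}" using assms by auto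
  show ?thesis unfolding graph_inf_laplacian_def eq
    using minus_Max_eq_Min[OF A] minus_Min_eq_Max[OF A] by simp
qed

context graph_domain
begin

lemma equation_steep_ascent:
  assumes eq: "\<And>x. x \<in> Z - Y \<Longrightarrow> graph_inf_laplacian \<eta> h Z v x = 0"
  shows "G.steep_ascent Y v"
  unfolding G.steep_ascent_def
proof (intro ballI impI, elim conjE)
  fix x y assume x: "x \<in> Z - Y" and y: "y \<in> Z" and w: "wt x y > 0" and less: "v y < v x"
  define A where "A y = scaled_kernel \<eta> h (norm (x - y)) * (v y - v x)" for y
  have Aw: "A y = wt x y * (v y - v x)" for y by (simp add: A_def graph_weight_def)
  have fin: "finite (A ` Z)" "A ` Z \<noteq> {}" using Z y by auto
  have "Min (A ` Z) + Max (A ` Z) = 0" using eq[OF x] by (simp add: graph_inf_laplacian_def A_def)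
  moreover have "Min (A ` Z) \<le> A y" using fin y by (intro Min_le) auto
  moreover have "Max (A ` Z) \<in> A ` Z" using fin by (intro Max_in) auto
  then obtain y' where y': "y' \<in> Z" "Max (A ` Z) = A y'" by auto
  ultimately have le: "- A y \<le> A y'" by linarith
  have pos: "0 < wt x y * (v x - v y)" using w less by simp
  have "- A y = wt x y * (v x - v y)" by (simp add: Aw algebra_simps)
  then have le': "wt x y * (v x - v y) \<le> wt x y' * (v y' - v x)" using le Aw by simp
  then have "wt x y' \<noteq> 0" using pos by auto
  then have "wt x y' > 0" using graph_weight_nonneg[OF kernel h, of x y'] by simp
  then show "\<exists>y'\<in>Z. 0 < wt x y' \<and> wt x y * (v x - v y) \<le> wt x y' * (v y' - v x)" using y' le' by blast
qed

lemma dn_pos: "p \<in> Z \<Longrightarrow> q \<in> Z \<Longrightarrow> p \<noteq> q \<Longrightarrow> dn p q > 0"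
proof -
  assume pq: "p \<in> Z" "q \<in> Z" "p \<noteq> q"
  obtain q' where q': "wt q' q > 0" "dn p q' + 1 / wt q' q \<le> dn p q" using G.dn_pred[OF pq] by blast
  have "1 / wt q' q > 0" using q' by simp
  then show ?thesis using q'(2) G.dn_nonneg[of p q'] by linarith
qed

lemma label_Lipschitz:
  assumes "Y \<subseteq> Z" "Lip_const (graph_dist \<eta> h Z) f Y \<le> ennreal L" "L \<ge> 0" "p \<in> Y" "q \<in> Y"
  shows "\<bar>f p - f q\<bar> \<le> L * dn p q"
proof -
  have "\<forall>x\<in>Y. \<forall>y\<in>Y. \<bar>f x - f y\<bar> \<le> L * dn x y"
  proof (rule iffD1[OF Lip_const_le_iff assms(2)])
    show "graph_dist \<eta> h Z x y = ennreal (dn x y)" if "x \<in> Y" "y \<in> Y" for x y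
    proof -
      have "x \<in> Z" "y \<in> Z" using that assms(1) by auto
      then have "graph_dist \<eta> h Z x y < top" using graph_dist_upper(1)[of x y] by simp
      then show ?thesis unfolding dn_def by simp
    qed
    show "dn x y > 0" if "x \<in> Y" "y \<in> Y" "x \<noteq> y" for x y using dn_pos that assms(1) by blast
    show "dn x x = 0" for x by (rule G.dn_refl)
  qed (rule assms(3))
  then show ?thesis using assms by blast
qed

lemma dn_upper2: "p \<in> Z \<Longrightarrow> q \<in> Z \<Longrightarrow> dn p q \<le> 2 * d p q + h"
proof -
  assume pq: "p \<in> Z" "q \<in> Z"
  have th: "t0 * h > 0" using t0 h by simp
  have "4 * \<delta> / (t0 * h) \<le> 1" using \<delta> th by (subst pos_divide_le_eq) auto
  moreover have "0 \<le> d p q" using pq Z by (intro d_nonneg) auto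
  ultimately have "(1 + 4 * \<delta> / (t0 * h)) * d p q \<le> 2 * d p q" by (intro mult_right_mono) auto
  then show ?thesis using graph_dist_upper(2)[OF pq] by linarith
qed

text \<open>The comparison of the maxima of \<open>u\<close> over \<open>\<epsilon>\<close>-balls with the minima \<open>V\<close> of \<open>un\<close>. The constants in \<open>C\<close> are those of
  \<open>discrete_subsolution\<close>, rewritten in terms of the three parts of the rate.\<close>

lemma one_sided_error:
  assumes S: "S \<noteq> {}" "S \<subseteq> X" and u: "absmin S u"
    and \<kappa>: "\<kappa> \<ge> 0" "\<And>x y. x \<in> X \<Longrightarrow> y \<in> X \<Longrightarrow> \<bar>u x - u y\<bar> \<le> \<kappa> * d x y"
    and un: "G.steep_ascent Y (\<lambda>x. - un x)"
    and L: "L \<ge> 1" "\<And>p q. p \<in> Z \<Longrightarrow> q \<in> Z \<Longrightarrow> \<bar>un p - un q\<bar> \<le> L * dn p q"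
    and Y: "\<And>q. q \<in> Y \<Longrightarrow> q \<in> Z \<and> (\<exists>z\<in>S. norm (q - z) \<le> \<delta>)"
    and Y2: "\<And>z. z \<in> S \<Longrightarrow> \<exists>q\<in>Y. norm (z - q) \<le> \<delta> \<and> u z \<le> un q + K * \<delta>" and K: "K \<ge> 0"
    and M: "\<And>x. x \<in> X \<Longrightarrow> \<bar>u x\<bar> \<le> M" "\<And>p. p \<in> Z \<Longrightarrow> \<bar>un p\<bar> \<le> M"
    and D: "\<And>x y. x \<in> X \<Longrightarrow> y \<in> X \<Longrightarrow> d x y \<le> D"
    and small: "3 * h \<le> r0" "0 \<le> E" "64 * E \<le> h / 10" "4 * \<delta> / (t0 * h) \<le> 1/10" "100 * h \<le> \<epsilon>" "\<epsilon> \<le> 1"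
    and base: "\<And>x y. x \<in> \<Omega> \<Longrightarrow> y \<in> \<Omega> \<Longrightarrow> norm (x - y) = h \<Longrightarrow> d x y \<le> h + E"
    and x: "x \<in> X" and p: "p \<in> Z" "d x p \<le> \<epsilon>"
  defines "rate \<equiv> \<delta> / (h * \<epsilon>) + h / \<epsilon>\<^sup>2 + E / (h * \<epsilon>)"
  defines "B \<equiv> 4 * \<kappa> + K + 11 * L" and "C \<equiv> 8 * L * (8 / t0 + 141)"
  shows "0 < \<alpha> \<Longrightarrow> \<alpha> \<le> 1 \<Longrightarrow> u x - un p \<le> B * \<epsilon> + 2 * (D + 1) * \<alpha> + C * (M + 2 * (D + 1))\<^sup>2 * rate / \<alpha>\<^sup>2"
    and "0 < \<alpha> \<Longrightarrow> (\<And>x. x \<in> inner_part S \<epsilon> \<Longrightarrow> ball_max u \<epsilon> x \<ge> u x + \<alpha> * \<epsilon>) \<Longrightarrow>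
       u x - un p \<le> B * \<epsilon> + C * M\<^sup>2 * rate / \<alpha>\<^sup>2"
proof -
  note dl = \<delta>_le
  have \<epsilon>: "\<epsilon> > 0" "2 * \<delta> \<le> \<epsilon>" "\<delta> \<le> r0" "4 * \<delta> \<le> \<epsilon>" "\<delta> \<le> \<epsilon>" "h \<le> \<epsilon>" "2 * \<delta> < \<epsilon>" using small h dl by linarith+
  define V where "V y = - vertex_max (\<lambda>x. - un x) \<epsilon> y" for y
  have Vat: "\<exists>q\<in>Z. d y q \<le> \<epsilon> \<and> V y = un q" if y: "y \<in> X" for y
    unfolding V_def by (rule vertex_max_attained[OF y \<epsilon>(2,3), of "\<lambda>x. - un x"]) auto
  have VM: "\<bar>V y\<bar> \<le> M" if y: "y \<in> X" for y using Vat[OF y] M(2) by auto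
  have Vle: "V x \<le> un p" using vertex_max_ge[OF p, of "\<lambda>x. - un x"] by (simp add: V_def)
  define e where "e = L * (2 * \<epsilon> * (4 * \<delta> / (t0 * h) + 64 * E / h) + 13 * h)"
  have e: "e > 0"
  proof -
    have "0 \<le> 2 * \<epsilon> * (4 * \<delta> / (t0 * h) + 64 * E / h)"
      using \<epsilon> \<delta> t0 h small by (intro mult_nonneg_nonneg add_nonneg_nonneg divide_nonneg_pos) auto
    then show ?thesis using L h unfolding e_def by (intro mult_pos_pos add_nonneg_pos) auto
  qed
  have near_d: "d a b \<le> 2 * \<delta>" if "a \<in> X" "b \<in> X" "norm (a - b) \<le> \<delta>" for a b
    using local_d[OF that(1,2)] that \<epsilon> \<delta> by linarith
  have super: "\<exists>z\<in>X. d y z \<le> \<epsilon> \<and> (\<forall>w\<in>X. d y w \<le> \<epsilon> \<longrightarrow> V w + V z \<le> 2 * V y + e)"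
    if y: "y \<in> inner_part S \<epsilon>" for y
  proof -
    have yX: "y \<in> X" and yS: "\<And>z. z \<in> S \<Longrightarrow> d y z > 3 * \<epsilon>" using y by (auto simp: inner_part_def)
    have far: "d y q > 2 * \<epsilon>" if q: "q \<in> Y" for q
    proof -
      obtain z where z: "z \<in> S" "norm (q - z) \<le> \<delta>" using Y[OF q] by blast
      have X': "q \<in> X" "z \<in> X" using Y[OF q] Z z S by auto
      show ?thesis using d_triangle[OF yX X'] near_d[OF X' z(2)] yS[OF z(1)] \<epsilon> by linarith
    qed
    have L': "\<bar>- un p - - un q\<bar> \<le> L * dn p q" if "p \<in> Z" "q \<in> Z" for p q using L(2)[OF that] by simp
    have L0: "0 \<le> L" using L(1) by simp
    have "\<exists>z\<in>X. d y z \<le> \<epsilon> \<and> (\<forall>w\<in>X. d y w \<le> \<epsilon> \<longrightarrow>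
        vertex_max (\<lambda>x. - un x) \<epsilon> w + vertex_max (\<lambda>x. - un x) \<epsilon> z \<ge> 2 * vertex_max (\<lambda>x. - un x) \<epsilon> y - e)"
      unfolding e_def by (rule discrete_subsolution[OF small(1-5) base un L0 L' yX far])
    then obtain z where z: "z \<in> X" "d y z \<le> \<epsilon>"
      and z3: "\<forall>w\<in>X. d y w \<le> \<epsilon> \<longrightarrow> vertex_max (\<lambda>x. - un x) \<epsilon> w + vertex_max (\<lambda>x. - un x) \<epsilon> z \<ge> 2 * vertex_max (\<lambda>x. - un x) \<epsilon> y - e"
      by blast
    have "V w + V z \<le> 2 * V y + e" if "w \<in> X" "d y w \<le> \<epsilon>" for w
    proof -
      have "vertex_max (\<lambda>x. - un x) \<epsilon> w + vertex_max (\<lambda>x. - un x) \<epsilon> z \<ge> 2 * vertex_max (\<lambda>x. - un x) \<epsilon> y - e"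
        using z3 that by blast
      then show ?thesis unfolding V_def by linarith
    qed
    then show ?thesis using z by blast
  qed
  have bdry: "ball_max u \<epsilon> y - V y \<le> B * \<epsilon>" if y: "y \<in> X - inner_part S \<epsilon>" for y
  proof -
    obtain z where z: "z \<in> S" "d y z \<le> 3 * \<epsilon>" using y by (auto simp: inner_part_def not_less)
    have yX: "y \<in> X" "z \<in> X" using y z S by auto
    have near: "d w z \<le> 4 * \<epsilon>" if "w \<in> X" "d y w \<le> \<epsilon>" for w
      using d_triangle[OF that(1) yX] d_sym[of y w] that z by linarith
    have cu: "continuous_on X u" using u by (simp add: absmin_def)
    obtain w where w: "w \<in> X" "d y w \<le> \<epsilon>" "ball_max u \<epsilon> y = u w"
      by (rule ball_max_attained[OF cu yX(1), of \<epsilon>]) (use \<epsilon> in auto)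
    have "\<kappa> * d w z \<le> \<kappa> * (4 * \<epsilon>)" using near[OF w(1,2)] \<kappa> by (intro mult_left_mono) auto
    then have 1: "ball_max u \<epsilon> y \<le> u z + 4 * (\<kappa> * \<epsilon>)" using \<kappa>(2)[OF w(1) yX(2)] w(3) by simp
    obtain q where q: "q \<in> Z" "d y q \<le> \<epsilon>" "V y = un q" using Vat[OF yX(1)] by blast
    obtain q' where q': "q' \<in> Y" "norm (z - q') \<le> \<delta>" "u z \<le> un q' + K * \<delta>" using Y2[OF z(1)] by blast
    have qX: "q \<in> X" "q' \<in> X" "q' \<in> Z" using q Z Y[OF q'(1)] by auto
    have "d q q' \<le> 5 * \<epsilon>" using d_triangle[OF qX(1) yX(2) qX(2)] near[OF qX(1) q(2)] near_d[OF yX(2) qX(2) q'(2)] \<epsilon> by linarith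
    then have "dn q' q \<le> 11 * \<epsilon>" using dn_upper2[OF qX(3) q(1)] d_sym[of q q'] \<epsilon> by linarith
    then have "L * dn q' q \<le> L * (11 * \<epsilon>)" using L by (intro mult_left_mono) auto
    then have 2: "un q' \<le> un q + 11 * (L * \<epsilon>)" using L(2)[OF qX(3) q(1)] by simp
    have "K * \<delta> \<le> K * \<epsilon>" using K \<epsilon> by (intro mult_left_mono) auto
    then show ?thesis using 1 2 q(3) q'(3) by (simp add: B_def algebra_simps)
  qed
  have eC: "8 * e = C * (\<epsilon>\<^sup>2 * (((8 / t0) * (\<delta> / (h * \<epsilon>)) + 128 * (E / (h * \<epsilon>)) + 13 * (h / \<epsilon>\<^sup>2)) / (8 / t0 + 141)))"
  proof -
    have "8 / t0 + 141 > 0" using t0 by (simp add: add_pos_pos)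
    then have "C * (\<epsilon>\<^sup>2 * (((8 / t0) * (\<delta> / (h * \<epsilon>)) + 128 * (E / (h * \<epsilon>)) + 13 * (h / \<epsilon>\<^sup>2)) / (8 / t0 + 141)))
       = 8 * L * (\<epsilon>\<^sup>2 * ((8 / t0) * (\<delta> / (h * \<epsilon>)) + 128 * (E / (h * \<epsilon>)) + 13 * (h / \<epsilon>\<^sup>2)))"
      unfolding C_def by simp
    also have "\<epsilon>\<^sup>2 * ((8 / t0) * (\<delta> / (h * \<epsilon>)) + 128 * (E / (h * \<epsilon>)) + 13 * (h / \<epsilon>\<^sup>2))
       = 2 * \<epsilon> * (4 * \<delta> / (t0 * h) + 64 * E / h) + 13 * h"
      using \<epsilon> t0 h by (simp add: power2_eq_square field_simps)
    finally show ?thesis by (simp add: e_def)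
  qed
  have C0: "C \<ge> 0" using L t0 by (simp add: C_def)
  have t: "\<delta> / (h * \<epsilon>) \<ge> 0" "E / (h * \<epsilon>) \<ge> 0" "h / \<epsilon>\<^sup>2 \<ge> 0" using \<delta> small h \<epsilon> by auto
  have le_rate: "((8 / t0) * (\<delta> / (h * \<epsilon>)) + 128 * (E / (h * \<epsilon>)) + 13 * (h / \<epsilon>\<^sup>2)) / (8 / t0 + 141) \<le> rate"
  proof -
    have q: "8 / t0 + 141 > 0" "8 / t0 > 0" using t0 by (simp_all add: add_pos_pos)
    have "(8 / t0) * (\<delta> / (h * \<epsilon>)) + 128 * (E / (h * \<epsilon>)) + 13 * (h / \<epsilon>\<^sup>2)
        \<le> (8 / t0 + 141) * (\<delta> / (h * \<epsilon>)) + (8 / t0 + 141) * (E / (h * \<epsilon>)) + (8 / t0 + 141) * (h / \<epsilon>\<^sup>2)"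
      using t q by (intro add_mono mult_right_mono) auto
    also have "\<dots> = rate * (8 / t0 + 141)" by (simp add: rate_def algebra_simps)
    finally show ?thesis unfolding pos_divide_le_eq[OF q(1)] .
  qed
  have e_rate: "8 * e \<le> C * (\<epsilon>\<^sup>2 * rate)"
    unfolding eC using C0 le_rate by (intro mult_left_mono) auto
  have fin: "8 * e * m / (\<alpha> * \<epsilon>)\<^sup>2 \<le> C * m * rate / \<alpha>\<^sup>2" if "m \<ge> 0" "\<alpha> > 0" for m \<alpha>
  proof -
    have "8 * e * m / (\<alpha> * \<epsilon>)\<^sup>2 \<le> C * (\<epsilon>\<^sup>2 * rate) * m / (\<alpha> * \<epsilon>)\<^sup>2"
      using e_rate that by (intro divide_right_mono mult_right_mono) auto
    also have "\<dots> = C * m * rate / \<alpha>\<^sup>2" using \<epsilon> that by (simp add: power_mult_distrib)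
    finally show ?thesis .
  qed
  show "u x - un p \<le> B * \<epsilon> + 2 * (D + 1) * \<alpha> + C * (M + 2 * (D + 1))\<^sup>2 * rate / \<alpha>\<^sup>2" if \<alpha>: "0 < \<alpha>" "\<alpha> \<le> 1"
    using one_sided_comparison[OF u S \<epsilon>(1) small(6) \<alpha> e D M(1) VM super bdry x] Vle fin[OF zero_le_power2 \<alpha>(1), of "M + 2 * (D + 1)"]
    by linarith
  show "u x - un p \<le> B * \<epsilon> + C * M\<^sup>2 * rate / \<alpha>\<^sup>2"
    if \<alpha>: "0 < \<alpha>" and steep: "\<And>x. x \<in> inner_part S \<epsilon> \<Longrightarrow> ball_max u \<epsilon> x \<ge> u x + \<alpha> * \<epsilon>"
    using one_sided_comparison_steep[OF u \<epsilon>(1) mult_pos_pos[OF \<alpha> \<epsilon>(1)] e steep M(1) VM super bdry x] Vle fin[OF zero_le_power2 \<alpha>, of M]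
    by linarith
qed

end

lemma closest_point_distance:
  fixes A B :: "'a::euclidean_space set"
  assumes "closest_point_projection A B p" "bounded A" "compact B" "B \<noteq> {}" "x \<in> A"
  shows "p x \<in> B" "norm (x - p x) \<le> hausdorff_dist B A"
proof -
  have a: "p x \<in> B" "\<And>y. y \<in> B \<Longrightarrow> norm (x - p x) \<le> norm (x - y)"
    using assms(1,5) by (force simp: closest_point_projection_def is_arg_min_def not_less)+
  then show "p x \<in> B" by simp
  obtain y where y: "y \<in> B" "infdist x B = dist x y" using infdist_attains_inf[of B x] assms compact_imp_closed by blast
  have "norm (x - p x) \<le> infdist x B" using a(2)[OF y(1)] y(2) by (simp add: dist_norm)
  also have "\<dots> \<le> hausdorff_dist B A"
    using assms by (intro hausdorff_dist_ge(2)) (auto intro: compact_imp_bounded)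
  finally show "norm (x - p x) \<le> hausdorff_dist B A" .
qed

context geo_domain
begin

text \<open>By uniqueness all absolute minimizers have the same gradients on \<open>closure \<Omega>\<close>.\<close>

lemma gradient_bound_uniform:
  assumes S: "closed S" "S \<subseteq> closure \<Omega>" "S \<noteq> {}" and \<kappa>: "\<kappa> \<ge> 0"
    and g: "\<And>z w. z \<in> S \<Longrightarrow> w \<in> S \<Longrightarrow> \<bar>g z - g w\<bar> \<le> \<kappa> * real_geo_dist \<Omega> z w"
  obtains \<alpha> where "\<alpha> > 0" "\<And>u y D. AMLE \<Omega> S g u \<Longrightarrow> inf_grad (closure \<Omega>) u > 0 \<Longrightarrow> y \<in> closure \<Omega> \<Longrightarrow>
     (u has_derivative (\<lambda>v. D \<bullet> v)) (at y within closure \<Omega>) \<Longrightarrow> \<alpha> \<le> norm D"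
proof (cases "\<exists>u. AMLE \<Omega> S g u \<and> inf_grad (closure \<Omega>) u > 0")
  case False
  then show thesis using that[of 1] by auto
next
  case True
  then obtain u0 where u0: "AMLE \<Omega> S g u0" "inf_grad (closure \<Omega>) u0 > 0" by blast
  obtain c where c: "0 < c" "c < inf_grad (closure \<Omega>) u0" using u0(2) dense by blast
  have ctop: "c \<noteq> top" using c by auto
  define \<alpha> where "\<alpha> = enn2real c"
  have \<alpha>: "c = ennreal \<alpha>" "\<alpha> > 0" using c ctop by (auto simp: \<alpha>_def enn2real_positive_iff less_top)
  show thesis
  proof (rule that[OF \<alpha>(2)])
    fix u y D
    assume u: "AMLE \<Omega> S g u" and y: "y \<in> closure \<Omega>" and D: "(u has_derivative (\<lambda>v. D \<bullet> v)) (at y within closure \<Omega>)"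
    have "u0 x = u x" if "x \<in> closure \<Omega>" for x
      by (rule absmin_unique[OF AMLE_absmin[OF u0(1)] AMLE_absmin[OF u] S \<kappa> _ _ that])
        (use u u0(1) g in \<open>auto simp: AMLE_def\<close>)
    then have "(u0 has_derivative (\<lambda>v. D \<bullet> v)) (at y within closure \<Omega>)"
      using y D by (intro has_derivative_transform[OF y _ D]) auto
    then have "inf_grad (closure \<Omega>) u0 \<le> ennreal (norm D)"
      unfolding inf_grad_def using y by (intro INF_lower2[of "(y, D)"]) auto
    then have "ennreal \<alpha> \<le> ennreal (norm D)" using c(2) unfolding \<alpha>(1) by (meson less_imp_le order_trans)
    then show "\<alpha> \<le> norm D" by simp
  qed
qed

text \<open>The constant is chosen before \<open>\<phi>\<close>, so the smallness of \<open>\<epsilon>\<close> may only be measured by \<open>r0\<close> and \<open>t0\<close>. For \<open>\<epsilon> < \<epsilon>0\<close> and a rate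
  below \<open>1\<close> all hypotheses of \<open>one_sided_error\<close> hold, for instance \<open>h < \<epsilon>\<^sup>2\<close> and \<open>\<phi> h < h \<epsilon>\<close>. In the other cases the error is
  at most \<open>c1 + c2 \<epsilon>\<close>, which the right-hand sides dominate.\<close>

lemma error_estimate:
  assumes bd: "bounded \<Omega>" and S: "closed S" "S \<subseteq> closure \<Omega>" "S \<noteq> {}" and kernel: "kernel_assumption \<eta> t0"
    and g: "Lip_const (geo_dist \<Omega>) g S < \<infinity>" and K: "K > 0"
  shows "\<exists>C>0. \<forall>\<phi> r Z Y f h \<pi>Y \<pi> \<epsilon> un u.
    domain_assumption \<Omega> \<phi> r \<longrightarrow> finite Z \<longrightarrow> Z \<subseteq> closure \<Omega> \<longrightarrow> Y \<subseteq> Z \<longrightarrow> Y \<noteq> {} \<longrightarrow> h > 0 \<longrightarrow>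
    closest_point_projection (closure \<Omega>) Z \<pi> \<longrightarrow> closest_point_projection S Y \<pi>Y \<longrightarrow>
    Lip_const (graph_dist \<eta> h Z) f Y \<le> ennreal L \<longrightarrow>
    (\<forall>z\<in>S. \<bar>f (\<pi>Y z) - g z\<bar> \<le> K * resolution \<Omega> S Z Y) \<longrightarrow>
    resolution \<Omega> S Z Y > 0 \<longrightarrow> \<epsilon> > 0 \<longrightarrow> scaling_assumption \<phi> r t0 (resolution \<Omega> S Z Y) h \<epsilon> \<longrightarrow>
    solves_graph_equation \<eta> h Z Y f un \<longrightarrow> AMLE \<Omega> S g u \<longrightarrow>
    (let \<delta> = resolution \<Omega> S Z Y;
         err_graph = (SUP x\<in>Z. \<bar>u x - un x\<bar>);
         err_domain = (SUP x\<in>closure \<Omega>. \<bar>u x - un (\<pi> x)\<bar>);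
         rate = \<delta> / (h * \<epsilon>) + h / \<epsilon>\<^sup>2 + \<phi> h / (h * \<epsilon>)
     in err_graph \<le> err_domain \<and> err_domain \<le> err_graph + C * \<delta> \<and>
        err_domain \<le> C * (\<epsilon> + root 3 rate) \<and>
        (inf_grad (closure \<Omega>) u > 0 \<longrightarrow> err_domain \<le> C * (\<epsilon> + rate)))"
proof -
  let ?X = "closure \<Omega>" and ?d = "real_geo_dist \<Omega>"
  obtain z0 where z0: "z0 \<in> S" using S by blast
  then have z0X: "z0 \<in> ?X" using S by auto
  define \<kappa> where "\<kappa> = enn2real (Lip_const (geo_dist \<Omega>) g S)"
  have \<kappa>: "\<kappa> \<ge> 0" by (simp add: \<kappa>_def)
  have "Lip_const (geo_dist \<Omega>) g S \<le> ennreal \<kappa>" using g by (simp add: \<kappa>_def)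
  then have g\<kappa>: "\<bar>g z - g w\<bar> \<le> \<kappa> * ?d z w" if "z \<in> S" "w \<in> S" for z w
    using Lip_const_geo_dist[OF S(2) \<kappa>] that by blast
  obtain \<alpha>0 where \<alpha>0: "\<alpha>0 > 0" "\<And>u y D. AMLE \<Omega> S g u \<Longrightarrow> inf_grad ?X u > 0 \<Longrightarrow> y \<in> ?X \<Longrightarrow>
     (u has_derivative (\<lambda>v. D \<bullet> v)) (at y within ?X) \<Longrightarrow> \<alpha>0 \<le> norm D"
    by (rule gradient_bound_uniform[OF S \<kappa> g\<kappa>]) blast+
  obtain D where D: "D > 0" "\<And>x y. x \<in> ?X \<Longrightarrow> y \<in> ?X \<Longrightarrow> ?d x y \<le> D" by (rule diameter_bound) blast
  obtain Ad where Ad: "Ad \<ge> 1" "\<And>x y. x \<in> ?X \<Longrightarrow> y \<in> ?X \<Longrightarrow> ?d x y \<le> Ad * norm (x - y)" by (rule d_le_norm) blast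
  have t0: "0 < t0" "t0 \<le> 1" using kernel by (auto simp: kernel_assumption_def)
  define L' where "L' = max L 1"
  have L': "L' \<ge> 1" "L \<le> L'" by (auto simp: L'_def)
  \<comment> \<open>\<open>M\<close> bounds \<open>u\<close> and \<open>un\<close> when \<open>h \<le> 1\<close>.\<close>
  define M where "M = \<bar>g z0\<bar> + \<kappa> * D + K + L' + 2 * L' * D"
  have M0: "M \<ge> 0" using \<kappa> D K L' by (simp add: M_def)
  define c1 where "c1 = 2 * \<bar>g z0\<bar> + \<kappa> * D + 2 * L' * D"
  have c1: "c1 \<ge> 0" using \<kappa> D L' by (simp add: c1_def)
  define c2 where "c2 = K + L'"
  have c2: "c2 \<ge> 0" using K L' by (simp add: c2_def)
  \<comment> \<open>\<open>1/640\<close> yields \<open>64 * \<phi> h \<le> h / 10\<close> and \<open>100 * h \<le> \<epsilon>\<close>, \<open>t0 / 40\<close> the bound for \<open>\<delta>\<close>, and \<open>r0 / 3\<close> the bound for \<open>h\<close>.\<close>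
  define \<epsilon>0 where "\<epsilon>0 = Min {1/640, t0 / 40, r0 / 3}"
  have \<epsilon>0pos: "\<epsilon>0 > 0" using t0 r0 by (simp add: \<epsilon>0_def)
  have "\<epsilon>0 \<le> q" if "q \<in> {1/640, t0 / 40, r0 / 3}" for q unfolding \<epsilon>0_def using that by (intro Min_le) auto
  then have \<epsilon>0: "\<epsilon>0 \<le> 1/640" "\<epsilon>0 \<le> t0 / 40" "\<epsilon>0 \<le> r0 / 3" by blast+
  define B where "B = 4 * \<kappa> + K + 11 * L'"
  define C3 where "C3 = 8 * L' * (8 / t0 + 141)"
  have B: "B \<ge> 0" using \<kappa> K L' by (simp add: B_def)
  have C3: "C3 \<ge> 0" using L' t0 by (simp add: C3_def)
  define CA where "CA = 2 * (D + 1) + C3 * (M + 2 * (D + 1))\<^sup>2"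
  define CB where "CB = C3 * M\<^sup>2 / \<alpha>0\<^sup>2"
  have CAB: "CA \<ge> 0" "CB \<ge> 0" using C3 D by (simp_all add: CA_def CB_def)
  define C where "C = \<kappa> * Ad + (c1 / \<epsilon>0 + c2) + (c1 + c2) + B + CA + CB + 1"
  have parts: "\<kappa> * Ad \<ge> 0" "c1 / \<epsilon>0 + c2 \<ge> 0" "c1 + c2 \<ge> 0" using \<kappa> Ad c1 c2 \<epsilon>0pos by simp_all
  have Cge: "C > 0" "\<kappa> * Ad \<le> C" "c1 / \<epsilon>0 + c2 \<le> C" "c1 + c2 \<le> C" "B + CA \<le> C" "B + CB \<le> C" "B \<le> C" "CA \<le> C" "CB \<le> C"
    using parts B CAB unfolding C_def by linarith+
  show ?thesis
  proof (intro exI[of _ C] conjI Cge(1) allI impI)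
    fix \<phi> :: "real \<Rightarrow> real" and r :: real and Z Y :: "'a set" and f :: "'a \<Rightarrow> real" and h :: real
      and \<pi>Y \<pi> :: "'a \<Rightarrow> 'a" and \<epsilon> :: real and un u :: "'a \<Rightarrow> real"
    assume dom: "domain_assumption \<Omega> \<phi> r" and Z: "finite Z" "Z \<subseteq> ?X" and Y: "Y \<subseteq> Z" "Y \<noteq> {}" and h: "h > 0"
      and \<pi>: "closest_point_projection ?X Z \<pi>" and \<pi>Y: "closest_point_projection S Y \<pi>Y"
      and fL: "Lip_const (graph_dist \<eta> h Z) f Y \<le> ennreal L"
      and fg: "\<forall>z\<in>S. \<bar>f (\<pi>Y z) - g z\<bar> \<le> K * resolution \<Omega> S Z Y"
      and res: "resolution \<Omega> S Z Y > 0" and \<epsilon>: "\<epsilon> > 0"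
      and scal: "scaling_assumption \<phi> r t0 (resolution \<Omega> S Z Y) h \<epsilon>"
      and sol: "solves_graph_equation \<eta> h Z Y f un" and amle: "AMLE \<Omega> S g u"
    define \<delta> where "\<delta> = resolution \<Omega> S Z Y"
    define rate where "rate = \<delta> / (h * \<epsilon>) + h / \<epsilon>\<^sup>2 + \<phi> h / (h * \<epsilon>)"
    define errg where "errg = (SUP x\<in>Z. \<bar>u x - un x\<bar>)"
    define errd where "errd = (SUP x\<in>?X. \<bar>u x - un (\<pi> x)\<bar>)"
    have Zne: "Z \<noteq> {}" using Y by auto
    have cZ: "compact Z" "compact Y" using Z Y by (auto intro: finite_imp_compact finite_subset)
    have bX: "bounded ?X" using bd by (simp add: bounded_closure)
    have bS: "bounded S" using S bX bounded_subset by blast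
    have \<delta>: "\<delta> > 0" "hausdorff_dist Z ?X \<le> \<delta>" "hausdorff_dist Y S \<le> \<delta>"
      using res by (simp_all add: \<delta>_def resolution_def)
    have \<pi>Z: "\<pi> x \<in> Z" "norm (x - \<pi> x) \<le> \<delta>" if "x \<in> ?X" for x
      using closest_point_distance[OF \<pi> bX cZ(1) Zne that] \<delta> by auto
    have \<pi>YS: "\<pi>Y z \<in> Y" "norm (z - \<pi>Y z) \<le> \<delta>" if "z \<in> S" for z
      using closest_point_distance[OF \<pi>Y bS cZ(2) Y(2) that] \<delta> by auto
    have Ynear: "\<exists>z\<in>S. norm (q - z) \<le> \<delta>" if q: "q \<in> Y" for q
    proof -
      obtain z where z: "z \<in> S" "infdist q S = dist q z" using infdist_attains_inf[of S q] S by blast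
      have "infdist q S \<le> hausdorff_dist Y S"
        using q S bS cZ Y by (intro hausdorff_dist_ge(1)) (auto intro: compact_imp_bounded)
      then show ?thesis using z \<delta> by (intro bexI[of _ z]) (auto simp: dist_norm)
    qed
    have \<phi>0: "\<phi> s \<ge> 0" if "s \<ge> 0" for s using dom that by (simp add: domain_assumption_def)
    have sc: "h \<le> r" "h / \<epsilon> < 1 / 2" "bdd_above ((\<lambda>s. \<phi> s / s) ` {0<..h})"
      "sigma_phi \<phi> h + \<delta> / h \<le> t0 / (4 + 2 * sigma_phi \<phi> h) * (1 - 2 * (h / \<epsilon>))"
      using scal by (auto simp: scaling_assumption_def \<delta>_def)
    have h\<epsilon>: "2 * h < \<epsilon>" using sc(2) \<epsilon> by (simp add: field_simps)
    have \<sigma>0: "sigma_phi \<phi> h \<ge> 0"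
    proof -
      have "\<phi> h / h \<le> sigma_phi \<phi> h" unfolding sigma_phi_def by (rule cSUP_upper) (use h sc in auto)
      then show ?thesis using \<phi>0[of h] h divide_nonneg_pos[of "\<phi> h" h] by linarith
    qed
    \<comment> \<open>The scaling assumption is used through this bound, \<open>2 * h < \<epsilon>\<close> and \<open>h \<le> r\<close>.\<close>
    have \<delta>h: "\<delta> \<le> t0 * h / 4"
    proof -
      have "t0 / (4 + 2 * sigma_phi \<phi> h) * (1 - 2 * (h / \<epsilon>)) \<le> t0 / 4 * 1"
        using \<sigma>0 t0 h \<epsilon> sc(2) by (intro mult_mono divide_left_mono) auto
      then have "\<delta> / h \<le> t0 / 4" using sc(4) \<sigma>0 by linarith
      then show ?thesis using h by (simp add: field_simps)
    qed
    interpret GD: graph_domain ?X ?d r0 \<Omega> Z \<eta> t0 h \<delta>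
    proof
      show "\<exists>p\<in>Z. norm (x - p) \<le> \<delta>" if "x \<in> ?X" for x using \<pi>Z[OF that] by blast
    qed (use open_domain kernel h Z \<delta> \<delta>h in auto)
    have u: "absmin S u" by (rule AMLE_absmin[OF amle])
    have ug: "u z = g z" if "z \<in> S" for z using amle that by (simp add: AMLE_def)
    have uL: "\<bar>u x - u y\<bar> \<le> \<kappa> * ?d x y" if "x \<in> ?X" "y \<in> ?X" for x y
      by (rule absmin_Lipschitz[OF u S(1,2) \<kappa> _ that]) (use ug g\<kappa> in auto)
    have eq: "graph_inf_laplacian \<eta> h Z un x = 0" if "x \<in> Z - Y" for x
      using sol that by (simp add: solves_graph_equation_def)
    have unf: "un q = f q" if "q \<in> Y" for q using sol that by (simp add: solves_graph_equation_def)
    have asc: "GD.G.steep_ascent Y un" by (rule GD.equation_steep_ascent) (rule eq)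
    have asc': "GD.G.steep_ascent Y (\<lambda>x. - un x)"
      by (rule GD.equation_steep_ascent) (use eq graph_inf_laplacian_minus[OF Z(1) Zne] in simp)
    have "Lip_const (graph_dist \<eta> h Z) f Y \<le> ennreal L'" using fL L'(2) ennreal_leI order_trans by blast
    then have fL': "\<bar>f p - f q\<bar> \<le> L' * GD.dn p q" if "p \<in> Y" "q \<in> Y" for p q
      by (rule GD.label_Lipschitz[OF Y(1)]) (use L' that in auto)
    have unL: "\<bar>un p - un q\<bar> \<le> L' * GD.dn p q" if "p \<in> Z" "q \<in> Z" for p q
      by (rule GD.G.Lipschitz_bound[OF asc asc' Y(1) _ _ that]) (use L' fL' unf in auto)
    have uM: "\<bar>u x\<bar> \<le> \<bar>g z0\<bar> + \<kappa> * D" if x: "x \<in> ?X" for x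
    proof -
      have "\<kappa> * ?d x z0 \<le> \<kappa> * D" using D(2)[OF x z0X] \<kappa> by (intro mult_left_mono)
      then show ?thesis using uL[OF x z0X] ug[OF z0] by linarith
    qed
    have unM: "\<bar>un p\<bar> \<le> \<bar>g z0\<bar> + K * h + L' * (2 * D + h)" if p: "p \<in> Z" for p
    proof -
      have q: "\<pi>Y z0 \<in> Y" "\<pi>Y z0 \<in> Z" using \<pi>YS[OF z0] Y by auto
      have "?d p (\<pi>Y z0) \<le> D" using p q Z by (intro D) auto
      then have "GD.dn p (\<pi>Y z0) \<le> 2 * D + h" using GD.dn_upper2[OF p q(2)] by linarith
      then have "L' * GD.dn p (\<pi>Y z0) \<le> L' * (2 * D + h)" using L' by (intro mult_left_mono) auto
      moreover have "\<bar>un (\<pi>Y z0) - g z0\<bar> \<le> K * \<delta>" using fg z0 unf[OF q(1)] by (simp add: \<delta>_def)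
      moreover have "K * \<delta> \<le> K * h" using K GD.\<delta>_le h by (intro mult_left_mono) auto
      ultimately show ?thesis using unL[OF p q(2)] by linarith
    qed
    have triv: "\<bar>u x - un (\<pi> x)\<bar> \<le> c1 + c2 * \<epsilon>" if x: "x \<in> ?X" for x
    proof -
      have "K * h + L' * h \<le> K * \<epsilon> + L' * \<epsilon>" using h\<epsilon> h K L' by (intro add_mono mult_left_mono) auto
      moreover have "L' * (2 * D + h) = 2 * L' * D + L' * h" by (simp add: algebra_simps)
      moreover have "c2 * \<epsilon> = K * \<epsilon> + L' * \<epsilon>" by (simp add: c2_def distrib_right)
      ultimately show ?thesis using uM[OF x] unM[OF \<pi>Z(1)[OF x]] unfolding c1_def by linarith
    qed
    have bdd: "bdd_above ((\<lambda>x. \<bar>u x - un (\<pi> x)\<bar>) ` ?X)" by (rule bdd_aboveI2[of _ _ "c1 + c2 * \<epsilon>"]) (rule triv)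
    have errd_le: "errd \<le> b" if "\<And>x. x \<in> ?X \<Longrightarrow> \<bar>u x - un (\<pi> x)\<bar> \<le> b" for b
      unfolding errd_def by (rule cSUP_least) (use z0X that in auto)
    have \<pi>id: "\<pi> x = x" if x: "x \<in> Z" for x
    proof -
      have "x \<in> ?X" using x Z by auto
      then have "\<not> norm (x - x) < norm (x - \<pi> x)"
        using \<pi> x unfolding closest_point_projection_def is_arg_min_def by blast
      then show ?thesis by simp
    qed
    have 1: "errg \<le> errd"
      unfolding errg_def
    proof (rule cSUP_least[OF Zne])
      fix x assume x: "x \<in> Z"
      then have xX: "x \<in> ?X" using Z by auto
      have "\<bar>u x - un (\<pi> x)\<bar> \<le> errd" unfolding errd_def by (rule cSUP_upper[OF xX bdd])
      then show "\<bar>u x - un x\<bar> \<le> errd" using \<pi>id[OF x] by simp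
    qed
    have 2: "errd \<le> errg + C * \<delta>"
    proof (rule errd_le)
      fix x assume x: "x \<in> ?X"
      have \<pi>X: "\<pi> x \<in> ?X" using \<pi>Z[OF x] Z by auto
      have "\<bar>u (\<pi> x) - un (\<pi> x)\<bar> \<le> errg"
        unfolding errg_def by (rule cSUP_upper[OF \<pi>Z(1)[OF x]]) (use Z in simp)
      moreover have "\<bar>u x - u (\<pi> x)\<bar> \<le> C * \<delta>"
      proof -
        have "\<kappa> * ?d x (\<pi> x) \<le> \<kappa> * (Ad * norm (x - \<pi> x))" using Ad(2)[OF x \<pi>X] \<kappa> by (intro mult_left_mono)
        also have "\<dots> = \<kappa> * Ad * norm (x - \<pi> x)" by simp
        also have "\<dots> \<le> C * \<delta>" using Cge \<pi>Z[OF x] parts by (intro mult_mono) auto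
        finally show ?thesis using uL[OF x \<pi>X] by linarith
      qed
      ultimately show "\<bar>u x - un (\<pi> x)\<bar> \<le> errg + C * \<delta>" by linarith
    qed
    have terms: "\<delta> / (h * \<epsilon>) \<ge> 0" "h / \<epsilon>\<^sup>2 > 0" "\<phi> h / (h * \<epsilon>) \<ge> 0" using \<delta> h \<epsilon> \<phi>0[of h] by simp_all
    then have rate0: "rate > 0" by (simp add: rate_def)
    have root0: "root 3 rate > 0" using rate0 by simp
    have root3: "root 3 rate ^ 3 = rate" using rate0 by (intro real_root_pow_pos2) auto
    have "errd \<le> C * (\<epsilon> + root 3 rate) \<and> (inf_grad ?X u > 0 \<longrightarrow> errd \<le> C * (\<epsilon> + rate))"
    proof (cases "\<epsilon> \<ge> \<epsilon>0 \<or> rate \<ge> 1")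
      case True
      have "errd \<le> C * (\<epsilon> + q)" if q: "q \<ge> 0" "rate \<ge> 1 \<Longrightarrow> q \<ge> 1" for q
      proof (cases "\<epsilon> \<ge> \<epsilon>0")
        case True
        have "c1 * 1 \<le> c1 * (\<epsilon> / \<epsilon>0)" using True \<epsilon>0pos c1 by (intro mult_left_mono) auto
        then have "c1 + c2 * \<epsilon> \<le> (c1 / \<epsilon>0 + c2) * \<epsilon>" by (simp add: algebra_simps)
        also have "\<dots> \<le> C * \<epsilon>" using Cge \<epsilon> by (intro mult_right_mono) auto
        also have "\<dots> \<le> C * (\<epsilon> + q)" using Cge q by (intro mult_left_mono) auto
        finally show ?thesis using triv errd_le order_trans by blast
      next
        case False
        then have q1: "q \<ge> 1" and "\<epsilon> < \<epsilon>0" using q True \<open>\<epsilon> \<ge> \<epsilon>0 \<or> rate \<ge> 1\<close> by auto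
        then have "c2 * \<epsilon> \<le> c2 * 1" using c2 \<epsilon>0 by (intro mult_left_mono) auto
        then have "c1 + c2 * \<epsilon> \<le> (c1 + c2) * 1" by simp
        also have "\<dots> \<le> C * (\<epsilon> + q)" using Cge q1 \<epsilon> parts by (intro mult_mono) auto
        finally show ?thesis using triv errd_le order_trans by blast
      qed
      moreover have "rate \<ge> 1 \<Longrightarrow> root 3 rate \<ge> 1" by simp
      ultimately show ?thesis using rate0 root0 by auto
    next
      case False
      then have \<epsilon>s: "\<epsilon> < \<epsilon>0" and r1: "rate < 1" by auto
      have t1: "\<delta> / (h * \<epsilon>) < 1" "h / \<epsilon>\<^sup>2 < 1" "\<phi> h / (h * \<epsilon>) < 1" using r1 terms by (simp_all add: rate_def)
      have he: "h < \<epsilon> * \<epsilon>" using t1(2) \<epsilon> by (simp add: power2_eq_square)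
      have e2: "\<epsilon> * \<epsilon> \<le> 1/640 * \<epsilon>" using \<epsilon>s \<epsilon>0 \<epsilon> by (intro mult_right_mono) auto
      have h\<epsilon>p: "h * \<epsilon> > 0" using h \<epsilon> by simp
      have E: "\<phi> h < h * \<epsilon>" "\<delta> < h * \<epsilon>" using t1 h\<epsilon>p by (simp_all add: divide_less_eq_1_pos)
      have small: "3 * h \<le> r0" "0 \<le> \<phi> h" "64 * \<phi> h \<le> h / 10" "4 * \<delta> / (t0 * h) \<le> 1/10" "100 * h \<le> \<epsilon>" "\<epsilon> \<le> 1"
      proof -
        show "3 * h \<le> r0" using he e2 \<epsilon>s \<epsilon>0(1,3) \<epsilon> by linarith
        show "0 \<le> \<phi> h" using \<phi>0 h by simp
        have "h * \<epsilon> \<le> h * (1/640)" using h \<epsilon>s \<epsilon>0(1) by (intro mult_left_mono) auto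
        then show "64 * \<phi> h \<le> h / 10" using E by linarith
        have "h * \<epsilon> \<le> h * (t0 / 40)" using h \<epsilon>s \<epsilon>0(2) by (intro mult_left_mono) auto
        then have "4 * \<delta> \<le> 1/10 * (t0 * h)" using E by (simp add: mult.commute)
        then show "4 * \<delta> / (t0 * h) \<le> 1/10" using t0 h by (subst pos_divide_le_eq) auto
        show "100 * h \<le> \<epsilon>" using he e2 \<epsilon> by linarith
        show "\<epsilon> \<le> 1" using \<epsilon>s \<epsilon>0 by linarith
      qed
      have base: "?d x y \<le> h + \<phi> h" if "x \<in> \<Omega>" "y \<in> \<Omega>" "norm (x - y) = h" for x y
      proof -
        have "geo_dist \<Omega> x y \<le> ennreal (h + \<phi> h)" using dom that sc(1) by (auto simp: domain_assumption_def)
        then show ?thesis unfolding real_geo_dist_def using h \<phi>0[of h] by (intro enn2real_leI) auto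
      qed
      have near: "?d x (\<pi> x) \<le> \<epsilon>" if x: "x \<in> ?X" for x
      proof -
        have "\<pi> x \<in> ?X" using \<pi>Z[OF x] Z by auto
        then have "?d x (\<pi> x) \<le> 103/100 * norm (x - \<pi> x)"
          using \<pi>Z(2)[OF x] GD.\<delta>_le small(1) h by (intro local_d x) auto
        then show ?thesis using \<pi>Z(2)[OF x] GD.\<delta>_le small(5) h by linarith
      qed
      have h1: "h \<le> 1" using small h by linarith
      have uM': "\<bar>u x\<bar> \<le> M" if "x \<in> ?X" for x
      proof -
        have "0 \<le> 2 * L' * D" using L' D by simp
        then show ?thesis using uM[OF that] K L' unfolding M_def by linarith
      qed
      have unM': "\<bar>un p\<bar> \<le> M" if "p \<in> Z" for p
      proof -
        have "K * h \<le> K * 1" "L' * (2 * D + h) \<le> L' * (2 * D + 1)" using K L' h1 by (intro mult_left_mono; simp)+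
        moreover have "L' * (2 * D + 1) = 2 * L' * D + L'" by (simp add: algebra_simps)
        moreover have "0 \<le> \<kappa> * D" using \<kappa> D by simp
        ultimately show ?thesis using unM[OF that] unfolding M_def by linarith
      qed
      have Y1: "q \<in> Z \<and> (\<exists>z\<in>S. norm (q - z) \<le> \<delta>)" if "q \<in> Y" for q using Ynear[OF that] that Y by auto
      have lab: "\<bar>un (\<pi>Y z) - u z\<bar> \<le> K * \<delta>" if "z \<in> S" for z
        using fg that unf[OF \<pi>YS(1)[OF that]] ug[OF that] by (simp add: \<delta>_def)
      have Y2: "\<exists>q\<in>Y. norm (z - q) \<le> \<delta> \<and> u z \<le> un q + K * \<delta>" if "z \<in> S" for z
        using \<pi>YS[OF that] lab[OF that] by (intro bexI[of _ "\<pi>Y z"]) (auto simp: abs_le_iff)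
      have Y2': "\<exists>q\<in>Y. norm (z - q) \<le> \<delta> \<and> - u z \<le> - un q + K * \<delta>" if "z \<in> S" for z
        using \<pi>YS[OF that] lab[OF that] by (intro bexI[of _ "\<pi>Y z"]) (auto simp: abs_le_iff)
      have K0: "K \<ge> 0" using K by simp
      have u': "absmin S (\<lambda>x. - u x)" by (rule absmin_minus[OF u])
      have uL': "\<bar>- u x - - u y\<bar> \<le> \<kappa> * ?d x y" if "x \<in> ?X" "y \<in> ?X" for x y using uL[OF that] by simp
      have unL': "\<bar>- un x - - un y\<bar> \<le> L' * GD.dn x y" if "x \<in> Z" "y \<in> Z" for x y using unL[OF that] by simp
      have asc'': "GD.G.steep_ascent Y (\<lambda>x. - (- un x))" using asc by simp
      have uM'': "\<bar>- u x\<bar> \<le> M" if "x \<in> ?X" for x using uM'[OF that] by simp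
      have unM'': "\<bar>- un p\<bar> \<le> M" if "p \<in> Z" for p using unM'[OF that] by simp
      have up1: "u x - un (\<pi> x) \<le> B * \<epsilon> + 2 * (D + 1) * \<alpha> + C3 * (M + 2 * (D + 1))\<^sup>2 * rate / \<alpha>\<^sup>2"
        if "x \<in> ?X" "0 < \<alpha>" "\<alpha> \<le> 1" for x \<alpha>
        unfolding rate_def B_def C3_def
        by (rule GD.one_sided_error(1)[OF S(3,2) u \<kappa> uL asc' L'(1) unL Y1 Y2 K0 uM' unM' D(2) small base that(1) \<pi>Z(1)[OF that(1)] near[OF that(1)] that(2,3)])
      have up2: "u x - un (\<pi> x) \<le> B * \<epsilon> + C3 * M\<^sup>2 * rate / \<alpha>\<^sup>2"
        if "x \<in> ?X" "0 < \<alpha>" "\<And>y. y \<in> inner_part S \<epsilon> \<Longrightarrow> ball_max u \<epsilon> y \<ge> u y + \<alpha> * \<epsilon>" for x \<alpha>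
        unfolding rate_def B_def C3_def
        by (rule GD.one_sided_error(2)[OF S(3,2) u \<kappa> uL asc' L'(1) unL Y1 Y2 K0 uM' unM' D(2) small base that(1) \<pi>Z(1)[OF that(1)] near[OF that(1)] that(2,3)])
      have down1: "- u x - - un (\<pi> x) \<le> B * \<epsilon> + 2 * (D + 1) * \<alpha> + C3 * (M + 2 * (D + 1))\<^sup>2 * rate / \<alpha>\<^sup>2"
        if "x \<in> ?X" "0 < \<alpha>" "\<alpha> \<le> 1" for x \<alpha>
        unfolding rate_def B_def C3_def
        by (rule GD.one_sided_error(1)[OF S(3,2) u' \<kappa> uL' asc'' L'(1) unL' Y1 Y2' K0 uM'' unM'' D(2) small base that(1) \<pi>Z(1)[OF that(1)] near[OF that(1)] that(2,3)])
      have down2: "- u x - - un (\<pi> x) \<le> B * \<epsilon> + C3 * M\<^sup>2 * rate / \<alpha>\<^sup>2"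
        if "x \<in> ?X" "0 < \<alpha>" "\<And>y. y \<in> inner_part S \<epsilon> \<Longrightarrow> ball_max (\<lambda>y. - u y) \<epsilon> y \<ge> - u y + \<alpha> * \<epsilon>" for x \<alpha>
        unfolding rate_def B_def C3_def
        by (rule GD.one_sided_error(2)[OF S(3,2) u' \<kappa> uL' asc'' L'(1) unL' Y1 Y2' K0 uM'' unM'' D(2) small base that(1) \<pi>Z(1)[OF that(1)] near[OF that(1)] that(2,3)])
      have i: "errd \<le> C * (\<epsilon> + root 3 rate)"
      proof (rule errd_le)
        fix x assume x: "x \<in> ?X"
        have \<alpha>: "0 < root 3 rate" "root 3 rate \<le> 1" using root0 r1 by simp_all
        have "rate / (root 3 rate)\<^sup>2 = root 3 rate"
        proof -
          have "rate = root 3 rate * (root 3 rate)\<^sup>2" using root3 by (simp add: power3_eq_cube power2_eq_square)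
          then show ?thesis using root0 by (metis nonzero_mult_div_cancel_right power_not_zero less_irrefl)
        qed
        then have "C3 * (M + 2 * (D + 1))\<^sup>2 * rate / (root 3 rate)\<^sup>2 = C3 * (M + 2 * (D + 1))\<^sup>2 * root 3 rate"
          by (metis times_divide_eq_right)
        then have e: "B * \<epsilon> + 2 * (D + 1) * root 3 rate + C3 * (M + 2 * (D + 1))\<^sup>2 * rate / (root 3 rate)\<^sup>2 = B * \<epsilon> + CA * root 3 rate"
          by (simp add: CA_def algebra_simps)
        have "\<bar>u x - un (\<pi> x)\<bar> \<le> B * \<epsilon> + CA * root 3 rate"
          using up1[OF x \<alpha>] down1[OF x \<alpha>] unfolding e by linarith
        also have "\<dots> \<le> C * \<epsilon> + C * root 3 rate" using Cge \<epsilon> root0 by (intro add_mono mult_right_mono) auto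
        finally show "\<bar>u x - un (\<pi> x)\<bar> \<le> C * (\<epsilon> + root 3 rate)" by (simp add: distrib_left)
      qed
      moreover have "errd \<le> C * (\<epsilon> + rate)" if gr: "inf_grad ?X u > 0"
      proof (rule errd_le)
        fix x assume x: "x \<in> ?X"
        have st: "ball_max (\<lambda>y. m * u y) \<epsilon> y \<ge> m * u y + \<alpha>0 * \<epsilon>" if "y \<in> inner_part S \<epsilon>" "\<bar>m\<bar> = 1" for y m
          by (rule steep_of_gradient[OF u that(2) refl open_domain segment_real_geo_dist \<alpha>0(2)[OF amle gr] that(1) \<epsilon>])
        have st1: "ball_max u \<epsilon> y \<ge> u y + \<alpha>0 * \<epsilon>" if "y \<in> inner_part S \<epsilon>" for y using st[OF that, of 1] by simp
        have st2: "ball_max (\<lambda>y. - u y) \<epsilon> y \<ge> - u y + \<alpha>0 * \<epsilon>" if "y \<in> inner_part S \<epsilon>" for y using st[OF that, of "-1"] by simp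
        have e: "B * \<epsilon> + C3 * M\<^sup>2 * rate / \<alpha>0\<^sup>2 = B * \<epsilon> + CB * rate" by (simp add: CB_def)
        have "\<bar>u x - un (\<pi> x)\<bar> \<le> B * \<epsilon> + CB * rate"
          using up2[OF x \<alpha>0(1) st1] down2[OF x \<alpha>0(1) st2] unfolding e by linarith
        also have "\<dots> \<le> C * \<epsilon> + C * rate" using Cge \<epsilon> rate0 by (intro add_mono mult_right_mono) auto
        finally show "\<bar>u x - un (\<pi> x)\<bar> \<le> C * (\<epsilon> + rate)" by (simp add: distrib_left)
      qed
      ultimately show ?thesis by blast
    qed
    then show "let \<delta> = resolution \<Omega> S Z Y;
         err_graph = (SUP x\<in>Z. \<bar>u x - un x\<bar>);
         err_domain = (SUP x\<in>closure \<Omega>. \<bar>u x - un (\<pi> x)\<bar>);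
         rate = \<delta> / (h * \<epsilon>) + h / \<epsilon>\<^sup>2 + \<phi> h / (h * \<epsilon>)
     in err_graph \<le> err_domain \<and> err_domain \<le> err_graph + C * \<delta> \<and>
        err_domain \<le> C * (\<epsilon> + root 3 rate) \<and>
        (inf_grad (closure \<Omega>) u > 0 \<longrightarrow> err_domain \<le> C * (\<epsilon> + rate))"
      using 1 2 unfolding Let_def errg_def errd_def rate_def \<delta>_def by blast
  qed
qed

end

theorem theorem2p2:
  fixes \<Omega> \<O> :: "'a::euclidean_space set" and g :: "'a \<Rightarrow> real"
    and \<eta> :: "real \<Rightarrow> real" and t0 L K :: real
  assumes "open \<Omega>" "bounded \<Omega>" "connected \<Omega>"
    and "closed \<O>" "\<O> \<subseteq> closure \<Omega>" "\<O> \<noteq> {}"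
    and "kernel_assumption \<eta> t0"
    and "Lip_const (geo_dist \<Omega>) g \<O> < \<infinity>"
    and "K > 0"
  shows "\<exists>C>0. \<forall>(\<phi> :: real \<Rightarrow> real) (r :: real) (\<Omega>s :: nat \<Rightarrow> 'a set) (\<O>s :: nat \<Rightarrow> 'a set)
      (gs :: nat \<Rightarrow> 'a \<Rightarrow> real) (h :: nat \<Rightarrow> real) (\<pi>\<O> :: nat \<Rightarrow> 'a \<Rightarrow> 'a) (\<pi> :: nat \<Rightarrow> 'a \<Rightarrow> 'a).
    domain_assumption \<Omega> \<phi> r \<and> point_clouds \<Omega> \<Omega>s \<O>s \<and> (\<forall>n. h n > 0) \<and>
    (\<forall>n. closest_point_projection (closure \<Omega>) (\<Omega>s n) (\<pi> n)) \<and>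
    (\<forall>n. closest_point_projection \<O> (\<O>s n) (\<pi>\<O> n)) \<and>
    data_assumption \<Omega> \<O> g \<eta> L K h \<Omega>s \<O>s \<pi>\<O> gs \<longrightarrow>
    (\<forall>(n :: nat) (\<epsilon> :: real) (un :: 'a \<Rightarrow> real) (u :: 'a \<Rightarrow> real).
      let \<delta> = resolution \<Omega> \<O> (\<Omega>s n) (\<O>s n);
          err_graph = (SUP x\<in>\<Omega>s n. \<bar>u x - un x\<bar>);
          err_domain = (SUP x\<in>closure \<Omega>. \<bar>u x - (un \<circ> \<pi> n) x\<bar>);
          rate = \<delta> / (h n * \<epsilon>) + h n / \<epsilon>\<^sup>2 + \<phi> (h n) / (h n * \<epsilon>)
      in
      \<delta> > 0 \<and> \<epsilon> > 0 \<and> scaling_assumption \<phi> r t0 \<delta> (h n) \<epsilon> \<and>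
      solves_graph_equation \<eta> (h n) (\<Omega>s n) (\<O>s n) (gs n) un \<and> AMLE \<Omega> \<O> g u \<longrightarrow>
        err_graph \<le> err_domain \<and> err_domain \<le> err_graph + C * \<delta> \<and>
        err_domain \<le> C * (\<epsilon> + root 3 rate) \<and>
        (inf_grad (closure \<Omega>) u > 0 \<longrightarrow> err_domain \<le> C * (\<epsilon> + rate)))"
proof (cases "\<exists>\<phi> r. domain_assumption \<Omega> \<phi> r")
  case False
  then show ?thesis by (intro exI[of _ 1]) auto
next
  case True
  then obtain \<phi>0 r' where dom: "domain_assumption \<Omega> \<phi>0 r'" by blast
  obtain r0 where r0: "length_domain (closure \<Omega>) (real_geo_dist \<Omega>) r0"
    and eq: "\<And>x y. x \<in> closure \<Omega> \<Longrightarrow> y \<in> closure \<Omega> \<Longrightarrow> geo_dist \<Omega> x y = ennreal (real_geo_dist \<Omega> x y)"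
    by (rule domain_length_domain[OF dom assms(2,3)]) blast
  interpret geo_domain \<Omega> r0
    by (intro geo_domain.intro r0 geo_domain_axioms.intro assms(1) eq)
  note estimate = error_estimate[OF assms(2,4,5,6,7,8,9), of L]
  obtain C where C: "C > 0" and est: "\<And>\<phi> r Z Y f h \<pi>Y \<pi> \<epsilon> un u.
    \<lbrakk>domain_assumption \<Omega> \<phi> r; finite Z; Z \<subseteq> closure \<Omega>; Y \<subseteq> Z; Y \<noteq> {}; h > 0;
     closest_point_projection (closure \<Omega>) Z \<pi>; closest_point_projection \<O> Y \<pi>Y;
     Lip_const (graph_dist \<eta> h Z) f Y \<le> ennreal L;
     \<forall>z\<in>\<O>. \<bar>f (\<pi>Y z) - g z\<bar> \<le> K * resolution \<Omega> \<O> Z Y;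
     resolution \<Omega> \<O> Z Y > 0; \<epsilon> > 0; scaling_assumption \<phi> r t0 (resolution \<Omega> \<O> Z Y) h \<epsilon>;
     solves_graph_equation \<eta> h Z Y f un; AMLE \<Omega> \<O> g u\<rbrakk> \<Longrightarrow>
     (let \<delta> = resolution \<Omega> \<O> Z Y;
          err_graph = (SUP x\<in>Z. \<bar>u x - un x\<bar>);
          err_domain = (SUP x\<in>closure \<Omega>. \<bar>u x - un (\<pi> x)\<bar>);
          rate = \<delta> / (h * \<epsilon>) + h / \<epsilon>\<^sup>2 + \<phi> h / (h * \<epsilon>)
      in err_graph \<le> err_domain \<and> err_domain \<le> err_graph + C * \<delta> \<and>
         err_domain \<le> C * (\<epsilon> + root 3 rate) \<and>
         (inf_grad (closure \<Omega>) u > 0 \<longrightarrow> err_domain \<le> C * (\<epsilon> + rate)))"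
    using estimate by (elim exE conjE) (rule that, assumption, blast)
  show ?thesis
  proof (intro exI[of _ C] conjI C allI impI)
    fix \<phi> :: "real \<Rightarrow> real" and r :: real and \<Omega>s \<O>s :: "nat \<Rightarrow> 'a set" and gs :: "nat \<Rightarrow> 'a \<Rightarrow> real"
      and h :: "nat \<Rightarrow> real" and \<pi>\<O> \<pi> :: "nat \<Rightarrow> 'a \<Rightarrow> 'a" and n :: nat and \<epsilon> :: real and un u :: "'a \<Rightarrow> real"
    assume H: "domain_assumption \<Omega> \<phi> r \<and> point_clouds \<Omega> \<Omega>s \<O>s \<and> (\<forall>n. h n > 0) \<and>
      (\<forall>n. closest_point_projection (closure \<Omega>) (\<Omega>s n) (\<pi> n)) \<and>
      (\<forall>n. closest_point_projection \<O> (\<O>s n) (\<pi>\<O> n)) \<and>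
      data_assumption \<Omega> \<O> g \<eta> L K h \<Omega>s \<O>s \<pi>\<O> gs"
    then have pc: "finite (\<Omega>s n)" "\<Omega>s n \<subseteq> closure \<Omega>" "\<O>s n \<subseteq> \<Omega>s n" "\<O>s n \<noteq> {}" and hn: "h n > 0"
      and pr: "closest_point_projection (closure \<Omega>) (\<Omega>s n) (\<pi> n)" "closest_point_projection \<O> (\<O>s n) (\<pi>\<O> n)"
      and lab: "\<forall>z\<in>\<O>. \<bar>gs n (\<pi>\<O> n z) - g z\<bar> \<le> K * resolution \<Omega> \<O> (\<Omega>s n) (\<O>s n)"
      by (auto simp: point_clouds_def data_assumption_def)
    have "Lip_const (graph_dist \<eta> (h n) (\<Omega>s n)) (gs n) (\<O>s n)
        \<le> (SUP n. Lip_const (graph_dist \<eta> (h n) (\<Omega>s n)) (gs n) (\<O>s n))"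
      by (intro SUP_upper) simp
    also have "\<dots> \<le> ennreal L" using H by (simp add: data_assumption_def)
    finally have lip: "Lip_const (graph_dist \<eta> (h n) (\<Omega>s n)) (gs n) (\<O>s n) \<le> ennreal L" .
    show "let \<delta> = resolution \<Omega> \<O> (\<Omega>s n) (\<O>s n);
          err_graph = (SUP x\<in>\<Omega>s n. \<bar>u x - un x\<bar>);
          err_domain = (SUP x\<in>closure \<Omega>. \<bar>u x - (un \<circ> \<pi> n) x\<bar>);
          rate = \<delta> / (h n * \<epsilon>) + h n / \<epsilon>\<^sup>2 + \<phi> (h n) / (h n * \<epsilon>)
      in
      \<delta> > 0 \<and> \<epsilon> > 0 \<and> scaling_assumption \<phi> r t0 \<delta> (h n) \<epsilon> \<and>
      solves_graph_equation \<eta> (h n) (\<Omega>s n) (\<O>s n) (gs n) un \<and> AMLE \<Omega> \<O> g u \<longrightarrow>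
        err_graph \<le> err_domain \<and> err_domain \<le> err_graph + C * \<delta> \<and>
        err_domain \<le> C * (\<epsilon> + root 3 rate) \<and>
        (inf_grad (closure \<Omega>) u > 0 \<longrightarrow> err_domain \<le> C * (\<epsilon> + rate))"
      using est[OF _ pc hn pr lip lab, of \<phi> r \<epsilon> un u] H unfolding Let_def comp_apply by blast
  qed
qed

end
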